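(* There exist a real sequence $\{\lambda_n\}_{n=1}^{\infty}$ satisfying $\lambda_n = n + o(1)$ as $n\to\infty$, and a Schwartz function $f$ on $\mathbb{R}$, such that for every positive integer $N$ the system of translates $$\{f(x - \lambda_n)\}, \quad n > N,$$ is complete in every Banach function space $X$ on $\mathbb{R}$ that satisfies the following two conditions: (i) the Schwartz space $\mathcal{S}(\mathbb{R})$ is continuously and densely embedded in $X$; (ii) if a temperate distribution $\alpha \in X^*$ satisfies $\operatorname{supp}(\widehat{\alpha}) \subset \mathbb{Z}$, then $\alpha = 0$. (The sequence $\{\lambda_n\}$ and the function $f$ do not depend on $N$ or $X$.)
   Context: Functions and scalars are complex. A Banach function space on $\mathbb{R}$ is a Banach space whose elements are functions (or equivalence classes of functions) on $\mathbb{R}$; the embedding in (i) is the natural one, regarding a Schwartz function as an element of $X$. The Schwartz space $\mathcal{S}(\mathbb{R})$ consists of all infinitely smooth functions $\varphi$ on $\mathbb{R}$ such that for all integers $n,k\ge 0$ the seminorm $\|\varphi\|_{n,k} := \sup_{x\in\mathbb{R}}(1+|x|)^n|\varphi^{(k)}(x)|$ is finite, with the topology induced by these seminorms. A temperate distribution is a continuous linear functional on $\mathcal{S}(\mathbb{R})$. Under (i), every element $\alpha$ of the dual space $X^*$ defines, by restriction, a continuous linear functional on $\mathcal{S}(\mathbb{R})$, and so is regarded as a temperate distribution on $\mathbb{R}$. The Fourier transform of a Schwartz function is $\widehat{\varphi}(x) = \int_{\mathbb{R}} \varphi(t) e^{-2\pi i x t}\,dt$, and that of a temperate distribution is defined by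 $\widehat{\alpha}(\varphi) = \alpha(\widehat{\varphi})$; $\operatorname{supp}$ denotes the closed support of a temperate distribution. A system of vectors in a topological linear space is called complete if its finite linear combinations are dense in the space. *)

theory Defs
  imports "HOL-Analysis.Analysis" "HOL-Library.Function_Algebras" "HOL-Library.Landau_Symbols"
begin

definition cscale :: "complex \<Rightarrow> (real \<Rightarrow> complex) \<Rightarrow> real \<Rightarrow> complex" where
  "cscale c f = (\<lambda>x. c * f x)"

interpretation cfun: vector_space cscale
  by unfold_locales (auto simp: cscale_def algebra_simps fun_eq_iff)

definition linear_functional_on ::
    "(real \<Rightarrow> complex) set \<Rightarrow> ((real \<Rightarrow> complex) \<Rightarrow> complex) \<Rightarrow> bool" where
  "linear_functional_on V \<alpha> \<longleftrightarrow>
     (\<forall>f\<in>V. \<forall>g\<in>V. \<alpha> (f + g) = \<alpha> f + \<alpha> g) \<and>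
     (\<forall>c. \<forall>f\<in>V. \<alpha> (cscale c f) = c * \<alpha> f)"

text \<open>The topology on \<open>V\<close> induced by a family \<open>P\<close> of seminorms; the balls form a subbasis.\<close>

definition seminorm_topology ::
    "(real \<Rightarrow> complex) set \<Rightarrow> ((real \<Rightarrow> complex) \<Rightarrow> real) set \<Rightarrow> (real \<Rightarrow> complex) topology" where
  "seminorm_topology V P =
     topology_generated_by {{g \<in> V. p (g - f) < e} | f p e. f \<in> V \<and> p \<in> P \<and> e > 0}"

definition complete_system :: "(real \<Rightarrow> complex) topology \<Rightarrow> (real \<Rightarrow> complex) set \<Rightarrow> bool" where
  "complete_system T A \<longleftrightarrow> A \<subseteq> topspace T \<and> T closure_of (cfun.span A) = topspace T"

definition higher_vderiv :: "nat \<Rightarrow> (real \<Rightarrow> complex) \<Rightarrow> real \<Rightarrow> complex" where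
  "higher_vderiv k = (\<lambda>f x. vector_derivative f (at x)) ^^ k"

definition smooth :: "(real \<Rightarrow> complex) \<Rightarrow> bool" where
  "smooth \<phi> \<longleftrightarrow> (\<forall>k x. higher_vderiv k \<phi> differentiable (at x))"

definition schwartz_seminorm :: "nat \<Rightarrow> nat \<Rightarrow> (real \<Rightarrow> complex) \<Rightarrow> real" where
  "schwartz_seminorm n k \<phi> = (SUP x. (1 + \<bar>x\<bar>) ^ n * cmod (higher_vderiv k \<phi> x))"

definition schwartz :: "(real \<Rightarrow> complex) set" where
  "schwartz = {\<phi>. smooth \<phi> \<and>
     (\<forall>n k. bdd_above (range (\<lambda>x. (1 + \<bar>x\<bar>) ^ n * cmod (higher_vderiv k \<phi> x))))}"

definition schwartz_topology :: "(real \<Rightarrow> complex) topology" where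
  "schwartz_topology = seminorm_topology schwartz {schwartz_seminorm n k | n k. True}"

definition temperate_distribution :: "((real \<Rightarrow> complex) \<Rightarrow> complex) \<Rightarrow> bool" where
  "temperate_distribution \<alpha> \<longleftrightarrow>
     linear_functional_on schwartz \<alpha> \<and> continuous_map schwartz_topology euclidean \<alpha>"

definition fourier :: "(real \<Rightarrow> complex) \<Rightarrow> real \<Rightarrow> complex" where
  "fourier \<phi> x =
     (LINT t|lborel. \<phi> t * exp (- 2 * of_real pi * \<i> * of_real x * of_real t))"

definition distribution_fourier ::
    "((real \<Rightarrow> complex) \<Rightarrow> complex) \<Rightarrow> (real \<Rightarrow> complex) \<Rightarrow> complex" where
  "distribution_fourier \<alpha> \<phi> = \<alpha> (fourier \<phi>)"

text \<open>The closed support: the complement of the largest open set on which the distribution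
  vanishes, tested as usual on smooth functions compactly supported in that set.\<close>

definition distribution_supp :: "((real \<Rightarrow> complex) \<Rightarrow> complex) \<Rightarrow> real set" where
  "distribution_supp \<alpha> =
     - \<Union>{U. open U \<and>
           (\<forall>\<phi>. smooth \<phi> \<and> compact (closure {x. \<phi> x \<noteq> 0}) \<and> closure {x. \<phi> x \<noteq> 0} \<subseteq> U
              \<longrightarrow> \<alpha> \<phi> = 0)}"

text \<open>
  A Banach space of functions, or of equivalence classes of functions, is given by the linear
  space \<open>V\<close> of all representatives and the function \<open>p\<close> that maps a representative to the norm
  of its class.  Since the vector operations are defined on representatives, two functions
  represent the same element of the space iff \<open>p (f - g) = 0\<close>, so that the space is \<open>V\<close>
  modulo the null space of \<open>p\<close>; its elements are genuine functions when \<open>p\<close> is a norm.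
  Closures and continuity in the quotient agree with those in \<open>seminorm_topology V {p}\<close>.
\<close>

definition banach_function_space ::
    "(real \<Rightarrow> complex) set \<Rightarrow> ((real \<Rightarrow> complex) \<Rightarrow> real) \<Rightarrow> bool" where
  "banach_function_space V p \<longleftrightarrow>
     cfun.subspace V \<and>
     (\<forall>f\<in>V. 0 \<le> p f) \<and>
     (\<forall>f\<in>V. \<forall>g\<in>V. p (f + g) \<le> p f + p g) \<and>
     (\<forall>c. \<forall>f\<in>V. p (cscale c f) = cmod c * p f) \<and>
     (\<forall>u :: nat \<Rightarrow> real \<Rightarrow> complex.
        range u \<subseteq> V \<and> (\<forall>e>0. \<exists>M. \<forall>m\<ge>M. \<forall>n\<ge>M. p (u m - u n) < e)
        \<longrightarrow> (\<exists>g\<in>V. (\<lambda>n. p (u n - g)) \<longlonglongrightarrow> 0))"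

text \<open>The second conjunct is injectivity of the natural map from Schwartz functions to classes.\<close>

definition schwartz_embedded ::
    "(real \<Rightarrow> complex) set \<Rightarrow> ((real \<Rightarrow> complex) \<Rightarrow> real) \<Rightarrow> bool" where
  "schwartz_embedded V p \<longleftrightarrow>
     schwartz \<subseteq> V \<and>
     (\<forall>\<phi>\<in>schwartz. p \<phi> = 0 \<longrightarrow> \<phi> = 0) \<and>
     continuous_map schwartz_topology (seminorm_topology V {p}) (\<lambda>\<phi>. \<phi>) \<and>
     seminorm_topology V {p} closure_of schwartz = V"

text \<open>Continuity makes the functionals below vanish on the null space of \<open>p\<close>, so they are
  exactly the elements of the dual of the quotient.\<close>

definition dual_space ::
    "(real \<Rightarrow> complex) set \<Rightarrow> ((real \<Rightarrow> complex) \<Rightarrow> real) \<Rightarrow> ((real \<Rightarrow> complex) \<Rightarrow> complex) set" where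
  "dual_space V p =
     {\<alpha>. linear_functional_on V \<alpha> \<and> continuous_map (seminorm_topology V {p}) euclidean \<alpha>}"

end

theory Submission
  imports Defs
begin

text \<open>Write \<open>e\<^sub>\<lambda>(t) = exp (2 \<pi> i \<lambda> t)\<close> and let \<open>f\<close> be the Fourier transform of \<open>\<phi>\<close>. Then \<open>f(x - \<lambda>)\<close> is the
  Fourier transform of \<open>\<phi> e\<^sub>\<lambda>\<close>, so a functional \<open>\<alpha>\<close> that annihilates the translates of \<open>f\<close> by \<open>\<lambda>\<^sub>n\<close>, \<open>n > N\<close>,
  has a Fourier transform that annihilates \<open>\<phi> P\<close> for all exponential sums \<open>P\<close> with these frequencies. By
  the Hahn-Banach theorem and condition (ii), completeness follows if every such \<open>\<alpha>\<close> satisfies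
  \<open>\<alpha>(fourier \<psi>) = 0\<close> for all test functions \<open>\<psi>\<close> supported off the integers. So \<open>\<phi>\<close> and the frequencies are to be
  chosen such that each \<open>\<psi>\<close> is a limit of functions \<open>\<phi> P\<close>.

  Two facts on exponential sums make this possible. On a compact set that contains no integer, the
  constant \<open>1\<close> is a limit, with all derivatives, of trigonometric polynomials of period \<open>1\<close> with only
  frequencies greater than \<open>N\<close> (\<open>high_frequency_unit\<close>); the reason is that such a set corresponds to
  a proper part of the unit circle. And since \<open>(e\<^sub>\<delta> - 1) / (2 \<pi> i \<delta>)\<close> tends to \<open>t\<close> as \<open>\<delta>\<close> tends to \<open>0\<close>, small perturbations of
  the frequencies overcome the periodicity: every smooth function can be approximated by sums whose
  frequencies are small perturbations of large integers (\<open>block_approximable_smooth\<close>).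

  Let \<open>b\<^sub>0, b\<^sub>1, \<dots>\<close> be bumps with compact supports that cover the complement of the integers in a locally finite
  way. The targets \<open>b\<^sub>i t\<^sup>m\<close> are enumerated such that each occurs infinitely often, and the \<open>c\<close>-th block of
  frequencies is chosen such that some sum \<open>P\<^sub>c\<close> with these frequencies is close to the \<open>c\<close>-th target \<open>h\<^sub>c\<close>
  on the supports of \<open>b\<^sub>0, \<dots>, b\<^sub>c\<close> (\<open>frequencies_exist\<close>). Away from these supports nothing is known about \<open>P\<^sub>c\<close>. This is
  repaired by the choice of \<open>\<phi> = \<Sum>j. a\<^sub>j b\<^sub>j\<close>: the amplitude \<open>a\<^sub>j\<close> is positive, but so small that the \<open>j\<close>-th
  summand is negligible against \<open>P\<^sub>c - h\<^sub>c\<close> for all \<open>c < j\<close> (\<open>amplitudes_exist\<close>). Then \<open>\<phi> (P\<^sub>c - h\<^sub>c)\<close> tends to zero,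
  whence \<open>\<alpha>(fourier (\<phi> b\<^sub>i t\<^sup>m)) = 0\<close> for all \<open>i\<close> and \<open>m\<close> (\<open>annihilates_cut_power\<close>). A test function \<open>\<psi>\<close> off the integers
  is a finite sum of functions \<open>\<phi> b\<^sub>i g\<close> with \<open>g\<close> smooth, and Weierstrass' theorem with derivatives
  approximates \<open>g\<close> by polynomials (\<open>annihilates_test_off_integers\<close>).

  The series for \<open>\<phi>\<close> is summed only after the Fourier transform, as a series in the Schwartz space. In
  this way the Fourier transform has to be studied on compactly supported functions only.\<close>

section \<open>Calculus of smooth functions\<close>

abbreviation vd :: "(real \<Rightarrow> complex) \<Rightarrow> real \<Rightarrow> complex" where
  "vd f \<equiv> \<lambda>x. vector_derivative f (at x)"

lemma higher_vderiv_0 [simp]: "higher_vderiv 0 f = f"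
  by (simp add: higher_vderiv_def)

lemma higher_vderiv_Suc: "higher_vderiv (Suc k) f = vd (higher_vderiv k f)"
  by (simp add: higher_vderiv_def)

lemma higher_vderiv_Suc': "higher_vderiv (Suc k) f = higher_vderiv k (vd f)"
  by (simp only: higher_vderiv_def funpow_Suc_right o_apply)

text \<open>Closure properties of smoothness are proved for finitely many derivatives first, where an
  induction on the number of derivatives is available.\<close>

primrec diff_times :: "nat \<Rightarrow> (real \<Rightarrow> complex) \<Rightarrow> bool" where
  "diff_times 0 f \<longleftrightarrow> True"
| "diff_times (Suc k) f \<longleftrightarrow> (\<forall>x. f differentiable at x) \<and> diff_times k (vd f)"

lemma diff_times_iff:
  "diff_times n f \<longleftrightarrow> (\<forall>k<n. \<forall>x. higher_vderiv k f differentiable at x)"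
proof (induction n arbitrary: f)
  case (Suc n)
  show ?case
    by (simp add: Suc.IH All_less_Suc2 flip: higher_vderiv_Suc')
qed simp

lemma smooth_iff: "smooth f \<longleftrightarrow> (\<forall>n. diff_times n f)"
  by (auto simp: smooth_def diff_times_iff)

lemma diff_times_SucI:
  assumes "\<And>x. (f has_vector_derivative f' x) (at x)" "diff_times k f'"
  shows "diff_times (Suc k) f"
proof -
  have "vd f = f'" using assms(1) by (auto intro: vector_derivative_at)
  then show ?thesis using assms by (auto intro: differentiableI_vector)
qed

lemma diff_times_SucD: "diff_times (Suc k) f \<Longrightarrow> diff_times k f"
  by (auto simp: diff_times_iff)

lemma diff_times_has_vd: "diff_times (Suc k) f \<Longrightarrow> (f has_vector_derivative vd f x) (at x)"
  by (simp add: vector_derivative_works)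

lemma smooth_has_vd: "smooth f \<Longrightarrow> (f has_vector_derivative vd f x) (at x)"
  unfolding smooth_iff by (metis diff_times_has_vd)

lemma smooth_vd: "smooth f \<Longrightarrow> smooth (vd f)"
  unfolding smooth_iff by (metis diff_times.simps(2))

lemma smooth_higher_vderiv: "smooth f \<Longrightarrow> smooth (higher_vderiv k f)"
  by (induction k) (auto simp: higher_vderiv_Suc smooth_vd)

lemma smooth_continuous: "smooth f \<Longrightarrow> continuous_on A f"
  by (meson continuous_at_imp_continuous_on has_vector_derivative_continuous smooth_has_vd)

lemma smoothI:
  assumes "\<And>x. (f has_vector_derivative f' x) (at x)" "smooth f'"
  shows "smooth f"
  unfolding smooth_iff
proof
  fix n show "diff_times n f"
    using assms by (cases n) (auto simp: smooth_iff simp del: diff_times.simps(2) intro!: diff_times_SucI)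
qed

lemma diff_times_const: "diff_times n (\<lambda>_. c)"
proof (induction n arbitrary: c)
  case (Suc n)
  show ?case by (rule diff_times_SucI[where f' = "\<lambda>_. 0"]) (use Suc in auto)
qed simp

lemma smooth_const [simp]: "smooth (\<lambda>_. c)"
  by (simp add: smooth_iff diff_times_const)

lemma diff_times_add: "diff_times n f \<Longrightarrow> diff_times n g \<Longrightarrow> diff_times n (\<lambda>x. f x + g x)"
proof (induction n arbitrary: f g)
  case (Suc n)
  show ?case
    by (rule diff_times_SucI[where f' = "\<lambda>x. vd f x + vd g x"])
       (use Suc in \<open>auto intro!: derivative_intros diff_times_has_vd simp: vector_derivative_works\<close>)
qed simp

lemma smooth_add: "smooth f \<Longrightarrow> smooth g \<Longrightarrow> smooth (\<lambda>x. f x + g x)"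
  by (simp add: smooth_iff diff_times_add)

lemma diff_times_mult: "diff_times n f \<Longrightarrow> diff_times n g \<Longrightarrow> diff_times n (\<lambda>x. f x * g x)"
proof (induction n arbitrary: f g)
  case (Suc n)
  have "diff_times n f" "diff_times n g"
    using Suc.prems by (auto dest: diff_times_SucD simp del: diff_times.simps)
  then show ?case
    by (intro diff_times_SucI[where f' = "\<lambda>x. f x * vd g x + vd f x * g x"])
       (use Suc in \<open>auto intro!: derivative_intros diff_times_add simp: vector_derivative_works\<close>)
qed simp

lemma smooth_mult: "smooth f \<Longrightarrow> smooth g \<Longrightarrow> smooth (\<lambda>x. f x * g x)"
  by (simp add: smooth_iff diff_times_mult)

lemma smooth_cmult: "smooth f \<Longrightarrow> smooth (\<lambda>x. c * f x)"
  by (simp add: smooth_mult)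

lemma smooth_diff: "smooth f \<Longrightarrow> smooth g \<Longrightarrow> smooth (\<lambda>x. f x - g x)"
  using smooth_add[of f "\<lambda>x. - g x"] smooth_cmult[of g "-1"] by simp

lemma smooth_power: "smooth f \<Longrightarrow> smooth (\<lambda>x. f x ^ m)"
  by (induction m) (auto intro: smooth_mult)

lemma smooth_sum: "(\<And>i. i \<in> A \<Longrightarrow> smooth (f i)) \<Longrightarrow> smooth (\<lambda>x. \<Sum>i\<in>A. f i x)"
  by (induction A rule: infinite_finite_induct) (auto intro: smooth_add)

lemma smooth_ident: "smooth complex_of_real"
  by (rule smoothI[where f' = "\<lambda>_. 1"]) (auto intro!: derivative_eq_intros has_vector_derivative_of_real)

lemma has_vector_derivative_poly_of_real:
  "((\<lambda>x. poly p (complex_of_real x)) has_vector_derivative poly (pderiv p) (of_real x)) (at x)"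
  by (rule has_vector_derivative_real_field) (rule poly_DERIV)

lemma smooth_poly: "smooth (\<lambda>x. poly p (complex_of_real x))"
proof -
  have "diff_times n (\<lambda>x. poly p (complex_of_real x))" for n
  proof (induction n arbitrary: p)
    case (Suc n)
    show ?case
      by (rule diff_times_SucI[OF has_vector_derivative_poly_of_real Suc])
  qed simp
  then show ?thesis by (simp add: smooth_iff)
qed

lemmas smooth_intros = smooth_const smooth_add smooth_mult smooth_diff smooth_cmult smooth_power
  smooth_sum smooth_ident smooth_poly

lemma vd_add: "smooth f \<Longrightarrow> smooth g \<Longrightarrow> vd (\<lambda>x. f x + g x) = (\<lambda>x. vd f x + vd g x)"
  by (auto intro!: vector_derivative_at derivative_intros smooth_has_vd)

lemma vd_mult: "smooth f \<Longrightarrow> smooth g \<Longrightarrow> vd (\<lambda>x. f x * g x) = (\<lambda>x. f x * vd g x + vd f x * g x)"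
  by (intro ext vector_derivative_at has_vector_derivative_mult smooth_has_vd)

lemma vd_cmult: "smooth f \<Longrightarrow> vd (\<lambda>x. c * f x) = (\<lambda>x. c * vd f x)"
  by (intro ext vector_derivative_at has_vector_derivative_mult_right smooth_has_vd)

lemma higher_vderiv_add:
  "smooth f \<Longrightarrow> smooth g \<Longrightarrow>
   higher_vderiv k (\<lambda>x. f x + g x) = (\<lambda>x. higher_vderiv k f x + higher_vderiv k g x)"
  by (induction k) (auto simp: higher_vderiv_Suc vd_add smooth_higher_vderiv)

lemma higher_vderiv_cmult:
  "smooth f \<Longrightarrow> higher_vderiv k (\<lambda>x. c * f x) = (\<lambda>x. c * higher_vderiv k f x)"
  by (induction k) (auto simp: higher_vderiv_Suc vd_cmult smooth_higher_vderiv)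

lemma higher_vderiv_diff:
  assumes "smooth f" "smooth g"
  shows "higher_vderiv k (\<lambda>x. f x - g x) = (\<lambda>x. higher_vderiv k f x - higher_vderiv k g x)"
  using higher_vderiv_add[of f "\<lambda>x. -1 * g x" k] higher_vderiv_cmult[of g k "-1"] assms
    smooth_cmult[of g "-1"] by simp

lemma higher_vderiv_zero: "higher_vderiv k (\<lambda>_. 0) = (\<lambda>_. 0)"
  by (induction k) (auto simp: higher_vderiv_Suc vector_derivative_at)

lemma higher_vderiv_shift:
  assumes "smooth f"
  shows "higher_vderiv k (\<lambda>x. f (x - a)) = (\<lambda>x. higher_vderiv k f (x - a))"
proof (induction k)
  case (Suc k)
  have "((\<lambda>x. higher_vderiv k f (x - a)) has_vector_derivative higher_vderiv (Suc k) f (x - a)) (at x)"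
    for x
  proof -
    have "(higher_vderiv k f has_vector_derivative higher_vderiv (Suc k) f (x - a)) (at (x - a))"
      unfolding higher_vderiv_Suc by (rule smooth_has_vd[OF smooth_higher_vderiv[OF assms]])
    then have "((higher_vderiv k f \<circ> (\<lambda>x. x - a)) has_vector_derivative
        1 *\<^sub>R higher_vderiv (Suc k) f (x - a)) (at x)"
      by (intro vector_diff_chain_at) (auto intro!: derivative_eq_intros)
    then show ?thesis by (simp add: o_def)
  qed
  then show ?case
    by (auto simp: higher_vderiv_Suc[of _ "\<lambda>x. f (x - a)"] Suc intro!: vector_derivative_at)
qed simp

lemma smooth_shift: "smooth f \<Longrightarrow> smooth (\<lambda>x. f (x - a))"
  unfolding smooth_def
proof (intro allI)
  fix k x assume "\<forall>k x. higher_vderiv k f differentiable at x"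
  then have s: "smooth f" by (simp add: smooth_def)
  have "higher_vderiv k (\<lambda>x. f (x - a)) = higher_vderiv k f \<circ> (\<lambda>x. x - a)"
    using higher_vderiv_shift[OF s] by (simp add: o_def)
  moreover have "(higher_vderiv k f \<circ> (\<lambda>x. x - a)) differentiable at x"
    using s by (intro differentiable_chain_at) (auto simp: smooth_def)
  ultimately show "higher_vderiv k (\<lambda>x. f (x - a)) differentiable at x" by simp
qed

lemma vd_zero_off_closed:
  assumes "closed K" "\<And>x. x \<notin> K \<Longrightarrow> w x = 0" "x \<notin> K"
  shows "vd w x = 0"
proof (rule vector_derivative_at)
  have "((\<lambda>_. 0) has_vector_derivative 0) (at x)" by simp
  then show "(w has_vector_derivative 0) (at x)"
    by (rule has_vector_derivative_transform_within_open[of _ _ _ "- K"]) (use assms in auto)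
qed

lemma higher_vderiv_zero_off_closed:
  assumes "closed K" "\<And>x. x \<notin> K \<Longrightarrow> w x = 0" "x \<notin> K"
  shows "higher_vderiv k w x = 0"
  using assms(3)
proof (induction k arbitrary: x)
  case (Suc k)
  show ?case unfolding higher_vderiv_Suc
    by (rule vd_zero_off_closed[OF assms(1) _ Suc.prems]) (rule Suc.IH)
qed (use assms in auto)

text \<open>Allowing a power in the denominator makes this class of quotients closed under differentiation.\<close>

lemma diff_times_divide_power:
  assumes "closed K" "\<And>x. x \<in> K \<Longrightarrow> u x \<noteq> 0" "smooth u"
  shows "diff_times n \<psi> \<Longrightarrow> (\<And>x. x \<notin> K \<Longrightarrow> \<psi> x = 0) \<Longrightarrow> diff_times n (\<lambda>x. \<psi> x / u x ^ m)"
proof (induction n arbitrary: \<psi> m)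
  case (Suc n)
  \<comment> \<open>Off \<open>K\<close> numerator and derivative vanish, so the default value of a division by zero is the right one.\<close>
  let ?d = "\<lambda>x. vd \<psi> x / u x ^ m + (\<psi> x * (- of_nat m * vd u x)) / u x ^ Suc m"
  have d0: "vd \<psi> x = 0" if "x \<notin> K" for x
    using vd_zero_off_closed[of K \<psi> x] assms Suc that by blast
  have *: "((\<lambda>x. \<psi> x / u x ^ m) has_vector_derivative ?d x) (at x)" for x
  proof (cases "x \<in> K")
    case True
    have P: "((\<lambda>x. inverse (u x ^ m)) has_vector_derivative
        (vd u x * (of_nat m * u x ^ (m - 1)) * - (inverse ((u x ^ m)\<^sup>2)))) (at x)"
    proof -
      have D: "((\<lambda>z. inverse (z ^ m)) has_field_derivative
           ((of_nat m * u x ^ (m - 1)) * - (inverse ((u x ^ m)\<^sup>2)))) (at (u x))"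
        using assms(2)[OF True]
        by (auto intro!: derivative_eq_intros simp: power2_eq_square field_simps)
      from field_vector_diff_chain_at[OF smooth_has_vd[OF assms(3)] D]
      show ?thesis by (simp add: o_def mult.assoc)
    qed
    have eq: "\<psi> x * (vd u x * (of_nat m * u x ^ (m - 1)) * - (inverse ((u x ^ m)\<^sup>2)))
       + vd \<psi> x * inverse (u x ^ m) = ?d x"
      using assms(2)[OF True] by (cases m) (auto simp: field_simps power2_eq_square)
    have "((\<lambda>x. \<psi> x * inverse (u x ^ m)) has_vector_derivative
       \<psi> x * (vd u x * (of_nat m * u x ^ (m - 1)) * - (inverse ((u x ^ m)\<^sup>2)))
       + vd \<psi> x * inverse (u x ^ m)) (at x)"
      by (rule has_vector_derivative_mult[OF diff_times_has_vd[OF Suc.prems(1)] P])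
    then have "((\<lambda>x. \<psi> x * inverse (u x ^ m)) has_vector_derivative ?d x) (at x)"
      by (subst (asm) eq)
    then show ?thesis by (simp only: divide_inverse)
  next
    case False
    have "((\<lambda>_. 0) has_vector_derivative 0) (at x)" by simp
    then have "((\<lambda>x. \<psi> x / u x ^ m) has_vector_derivative 0) (at x)"
      by (rule has_vector_derivative_transform_within_open[of _ _ _ "- K"])
         (use assms False Suc in auto)
    moreover have "?d x = 0" using False d0 Suc by simp
    ultimately show ?thesis by simp
  qed
  have "diff_times n \<psi>" using Suc.prems(1) by (rule diff_times_SucD)
  moreover have "diff_times n (\<lambda>x. - of_nat m * vd u x)"
    using smooth_cmult[OF smooth_vd[OF assms(3)]] unfolding smooth_iff by blast
  ultimately have "diff_times n (\<lambda>x. \<psi> x * (- of_nat m * vd u x))" by (rule diff_times_mult)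
  then have "diff_times n ?d"
    using Suc.prems d0 by (intro diff_times_add Suc.IH) auto
  with * show ?case by (rule diff_times_SucI)
qed simp

lemma smooth_divide:
  assumes "closed K" "\<And>x. x \<in> K \<Longrightarrow> u x \<noteq> 0" "smooth u" "smooth \<psi>" "\<And>x. x \<notin> K \<Longrightarrow> \<psi> x = 0"
  shows "smooth (\<lambda>x. \<psi> x / u x)"
  using diff_times_divide_power[OF assms(1-3), of _ \<psi> 1] assms(4,5) by (simp add: smooth_iff)

text \<open>A quantitative Leibniz rule. Writing \<open>(w g)' = w g' + w' g\<close> and applying the induction hypothesis to
  the factors \<open>w\<close> and \<open>w'\<close> gives a constant that depends on \<open>w\<close> only, so that smallness of the jets of \<open>g\<close>
  on \<open>K\<close> passes to \<open>w g\<close>, uniformly in \<open>g\<close>.\<close>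

lemma higher_vderiv_mult_bound:
  assumes "compact K" "smooth w" "\<forall>x. x \<notin> K \<longrightarrow> w x = 0"
  shows "\<exists>C\<ge>0. \<forall>g \<eta>. smooth g \<longrightarrow> \<eta> \<ge> 0 \<longrightarrow>
     (\<forall>i\<le>n. \<forall>x\<in>K. cmod (higher_vderiv i g x) \<le> \<eta>) \<longrightarrow>
     (\<forall>x. cmod (higher_vderiv n (\<lambda>x. w x * g x) x) \<le> C * \<eta>)"
  using assms(2,3)
proof (induction n arbitrary: w)
  case 0
  have "compact (w ` K)" by (intro compact_continuous_image smooth_continuous 0 assms)
  then have "bounded (w ` K)" by (rule compact_imp_bounded)
  then obtain C where "C > 0" "\<forall>y\<in>w ` K. cmod y \<le> C" unfolding bounded_pos by auto
  then have C: "\<And>x. x \<in> K \<Longrightarrow> cmod (w x) \<le> C" "C > 0" by auto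
  have "cmod (w x * g x) \<le> C * \<eta>"
    if "\<eta> \<ge> 0" "\<forall>x\<in>K. cmod (g x) \<le> \<eta>" for x \<eta> and g :: "real \<Rightarrow> complex"
  proof (cases "x \<in> K")
    case True
    then show ?thesis
      using that C(1)[OF True] C(2) unfolding norm_mult by (intro mult_mono) auto
  next
    case False
    then show ?thesis using 0(2)[rule_format, OF False] C(2) that by simp
  qed
  then show ?case using C(2) by (intro exI[of _ C] conjI allI impI) auto
next
  case (Suc n)
  have cl: "closed K" using assms(1) by (rule compact_imp_closed)
  obtain C1 where C1: "C1 \<ge> 0" "\<forall>g \<eta>. smooth g \<longrightarrow> \<eta> \<ge> 0 \<longrightarrow>
     (\<forall>i\<le>n. \<forall>x\<in>K. cmod (higher_vderiv i g x) \<le> \<eta>) \<longrightarrow>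
     (\<forall>x. cmod (higher_vderiv n (\<lambda>x. w x * g x) x) \<le> C1 * \<eta>)"
    using Suc.IH[OF Suc.prems] by (elim exE conjE) (rule that)
  obtain C2 where C2: "C2 \<ge> 0" "\<forall>g \<eta>. smooth g \<longrightarrow> \<eta> \<ge> 0 \<longrightarrow>
     (\<forall>i\<le>n. \<forall>x\<in>K. cmod (higher_vderiv i g x) \<le> \<eta>) \<longrightarrow>
     (\<forall>x. cmod (higher_vderiv n (\<lambda>x. vd w x * g x) x) \<le> C2 * \<eta>)"
  proof -
    have "\<forall>x. x \<notin> K \<longrightarrow> vd w x = 0"
      using Suc.prems(2) by (intro allI impI vd_zero_off_closed[OF cl]) auto
    from Suc.IH[OF smooth_vd[OF Suc.prems(1)] this] show ?thesis by (elim exE conjE) (rule that)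
  qed
  show ?case
  proof (intro exI[of _ "C1 + C2"] conjI allI impI)
    fix g \<eta> x assume *: "smooth g" "(0::real) \<le> \<eta>"
      "\<forall>i\<le>Suc n. \<forall>x\<in>K. cmod (higher_vderiv i g x) \<le> \<eta>"
    have "higher_vderiv (Suc n) (\<lambda>x. w x * g x) x
       = higher_vderiv n (\<lambda>x. w x * vd g x) x + higher_vderiv n (\<lambda>x. vd w x * g x) x"
    proof -
      have "higher_vderiv (Suc n) (\<lambda>x. w x * g x) = higher_vderiv n (\<lambda>x. w x * vd g x + vd w x * g x)"
        unfolding higher_vderiv_Suc' vd_mult[OF Suc.prems(1) *(1)] ..
      also have "\<dots> = (\<lambda>x. higher_vderiv n (\<lambda>x. w x * vd g x) x + higher_vderiv n (\<lambda>x. vd w x * g x) x)"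
        by (intro higher_vderiv_add smooth_mult smooth_vd Suc.prems(1) *(1))
      finally show ?thesis by simp
    qed
    moreover have "cmod (higher_vderiv n (\<lambda>x. w x * vd g x) x) \<le> C1 * \<eta>"
    proof -
      have "cmod (higher_vderiv i (vd g) y) \<le> \<eta>" if "i \<le> n" "y \<in> K" for i y
        using *(3)[rule_format, of "Suc i" y] that unfolding higher_vderiv_Suc' by simp
      then show ?thesis using C1(2)[rule_format, OF smooth_vd[OF *(1)] *(2)] by simp
    qed
    moreover have "cmod (higher_vderiv n (\<lambda>x. vd w x * g x) x) \<le> C2 * \<eta>"
      using *(3) by (intro C2(2)[rule_format, OF *(1,2)]) simp
    ultimately show "cmod (higher_vderiv (Suc n) (\<lambda>x. w x * g x) x) \<le> (C1 + C2) * \<eta>"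
      by (simp add: distrib_right norm_triangle_le)
  qed (use C1 C2 in simp)
qed

section \<open>The Fourier transform of test functions\<close>

definition wave :: "real \<Rightarrow> real \<Rightarrow> complex" where
  "wave a t = exp (2 * of_real pi * \<i> * of_real a * of_real t)"

lemma wave_add: "wave (a + b) t = wave a t * wave b t"
  by (simp add: wave_def algebra_simps flip: exp_add)

lemma wave_minus_add: "wave (- (x - a)) t = wave a t * wave (- x) t"
  by (simp flip: wave_add)

lemma norm_wave [simp]: "cmod (wave a t) = 1"
  by (simp add: wave_def norm_exp_eq_Re)

lemma wave_of_nat: "wave (of_nat n) t = wave 1 t ^ n"
  by (simp add: wave_def mult_ac flip: exp_of_nat_mult)

lemma has_vector_derivative_wave:
  "(wave a has_vector_derivative 2 * of_real pi * \<i> * of_real a * wave a t) (at t)"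
proof -
  have "((\<lambda>z. exp (2 * of_real pi * \<i> * of_real a * z)) has_field_derivative
      2 * of_real pi * \<i> * of_real a * wave a t) (at (of_real t))"
    by (auto intro!: derivative_eq_intros simp: wave_def)
  then show ?thesis
    unfolding wave_def[abs_def] by (rule has_vector_derivative_real_field)
qed

lemma smooth_wave: "smooth (wave a)"
proof -
  have "diff_times n (wave a)" for n
  proof (induction n)
    case (Suc n)
    show ?case
      by (rule diff_times_SucI[OF has_vector_derivative_wave diff_times_mult[OF diff_times_const Suc]])
  qed simp
  then show ?thesis by (simp add: smooth_iff)
qed

lemma vd_wave: "vd (wave a) = (\<lambda>t. 2 * of_real pi * \<i> * of_real a * wave a t)"
  by (intro ext vector_derivative_at has_vector_derivative_wave)

definition test_functions :: "(real \<Rightarrow> complex) set" where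
  "test_functions = {u. smooth u \<and> (\<exists>R. \<forall>t. R \<le> \<bar>t\<bar> \<longrightarrow> u t = 0)}"

lemma test_functions_smooth: "u \<in> test_functions \<Longrightarrow> smooth u"
  by (simp add: test_functions_def)

lemma test_functionsI:
  assumes "smooth u" "compact K" "\<And>x. x \<notin> K \<Longrightarrow> u x = 0"
  shows "u \<in> test_functions"
proof -
  obtain R where "\<forall>x\<in>K. \<bar>x\<bar> \<le> R"
    using compact_imp_bounded[OF assms(2)] unfolding bounded_iff by auto
  then have "\<forall>t. R + 1 \<le> \<bar>t\<bar> \<longrightarrow> u t = 0" using assms(3) by force
  then show ?thesis using assms(1) by (auto simp: test_functions_def)
qed

lemma test_functions_vanish:
  assumes "u \<in> test_functions"
  shows "\<exists>R>0. \<forall>t. R \<le> \<bar>t\<bar> \<longrightarrow> u t = 0"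
proof -
  obtain R where "\<forall>t. R \<le> \<bar>t\<bar> \<longrightarrow> u t = 0" using assms by (auto simp: test_functions_def)
  then show ?thesis by (intro exI[of _ "max R 1"]) auto
qed

lemma test_functions_mult:
  "u \<in> test_functions \<Longrightarrow> smooth g \<Longrightarrow> (\<lambda>t. u t * g t) \<in> test_functions"
  "u \<in> test_functions \<Longrightarrow> smooth g \<Longrightarrow> (\<lambda>t. g t * u t) \<in> test_functions"
  by (auto simp: test_functions_def smooth_mult)

lemma test_functions_cmult: "u \<in> test_functions \<Longrightarrow> (\<lambda>t. c * u t) \<in> test_functions"
  by (auto simp: test_functions_def smooth_cmult)

lemma test_functions_add:
  assumes "u \<in> test_functions" "v \<in> test_functions"
  shows "(\<lambda>t. u t + v t) \<in> test_functions"
proof -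
  obtain R1 R2 where "\<And>t. R1 \<le> \<bar>t\<bar> \<Longrightarrow> u t = 0" "\<And>t. R2 \<le> \<bar>t\<bar> \<Longrightarrow> v t = 0"
    using assms by (auto simp: test_functions_def)
  then have "\<forall>t. max R1 R2 \<le> \<bar>t\<bar> \<longrightarrow> u t + v t = 0" by auto
  then show ?thesis using assms unfolding test_functions_def by (blast intro: smooth_add)
qed

lemma test_functions_zero: "(\<lambda>t. 0) \<in> test_functions"
  by (auto simp: test_functions_def)

lemma test_functions_sum:
  "(\<And>i. i \<in> A \<Longrightarrow> u i \<in> test_functions) \<Longrightarrow> (\<lambda>t. \<Sum>i\<in>A. u i t) \<in> test_functions"
  by (induction A rule: infinite_finite_induct) (auto intro: test_functions_add test_functions_zero)

lemma test_functions_vd: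
  assumes "u \<in> test_functions" shows "vd u \<in> test_functions"
proof -
  obtain R where R: "R > 0" "\<forall>t. R \<le> \<bar>t\<bar> \<longrightarrow> u t = 0"
    using test_functions_vanish[OF assms] by blast
  show ?thesis
  proof (rule test_functionsI[of _ "{-R..R}"])
    show "smooth (vd u)" using assms by (intro smooth_vd test_functions_smooth)
    show "vd u x = 0" if "x \<notin> {-R..R}" for x
      by (rule vd_zero_off_closed[of "{-R..R}"]) (use that R in auto)
  qed simp
qed

lemma test_functions_higher_vderiv:
  "u \<in> test_functions \<Longrightarrow> higher_vderiv n u \<in> test_functions"
  by (induction n) (auto simp: higher_vderiv_Suc test_functions_vd)

lemma integrable_vanishing:
  fixes u :: "real \<Rightarrow> complex"
  assumes "continuous_on UNIV u" "\<forall>t. R \<le> \<bar>t\<bar> \<longrightarrow> u t = 0"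
  shows "integrable lborel u" "integral\<^sup>L lborel u = integral {-R..R} u"
proof -
  have eq: "(\<lambda>t. indicator {-R..R} t *\<^sub>R u t) = u"
    using assms(2) by (force simp: indicator_def)
  have *: "integrable lborel (\<lambda>t. indicator {-R..R} t *\<^sub>R u t)"
    by (rule borel_integrable_compact) (auto intro: continuous_on_subset[OF assms(1)])
  then show "integrable lborel u" by (simp add: eq)
  have "set_integrable lborel {-R..R} u" using * by (simp add: set_integrable_def)
  from set_borel_integral_eq_integral(2)[OF this]
  show "integral\<^sup>L lborel u = integral {-R..R} u"
    by (simp add: set_lebesgue_integral_def eq)
qed

lemma fourier_wave: "fourier u x = (LINT t|lborel. u t * wave (- x) t)"
  by (simp add: fourier_def wave_def)

lemma continuous_on_times_wave: "u \<in> test_functions \<Longrightarrow> continuous_on A (\<lambda>t. u t * wave a t)"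
  by (intro continuous_intros smooth_continuous test_functions_smooth smooth_wave)

lemma integrable_times_wave:
  assumes "u \<in> test_functions"
  shows "integrable lborel (\<lambda>t. u t * wave a t)"
proof -
  obtain R where "R > 0" "\<forall>t. R \<le> \<bar>t\<bar> \<longrightarrow> u t = 0" using test_functions_vanish[OF assms] by blast
  then show ?thesis
    by (intro integrable_vanishing(1)[of _ R] continuous_on_times_wave assms) auto
qed

lemma fourier_integral:
  assumes "u \<in> test_functions" "\<forall>t. R \<le> \<bar>t\<bar> \<longrightarrow> u t = 0"
  shows "fourier u x = integral {-R..R} (\<lambda>t. u t * wave (- x) t)"
  unfolding fourier_wave
  by (rule integrable_vanishing(2)) (use assms in \<open>auto intro: continuous_on_times_wave\<close>)

lemma fourier_add:
  "u \<in> test_functions \<Longrightarrow> v \<in> test_functions \<Longrightarrow>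
   fourier (\<lambda>t. u t + v t) = (\<lambda>x. fourier u x + fourier v x)"
  by (auto simp: fourier_wave distrib_right integrable_times_wave)

lemma fourier_cmult: "fourier (\<lambda>t. c * u t) = (\<lambda>x. c * fourier u x)"
  by (auto simp: fourier_wave mult.assoc)

lemma fourier_zero: "fourier (\<lambda>t. 0) = (\<lambda>x. 0)"
  by (auto simp: fourier_wave)

lemma fourier_diff:
  assumes "u \<in> test_functions" "v \<in> test_functions"
  shows "fourier (\<lambda>t. u t - v t) = (\<lambda>x. fourier u x - fourier v x)"
  using fourier_add[OF assms(1) test_functions_cmult[OF assms(2), of "-1"]]
    fourier_cmult[of "-1" v] by simp

lemma fourier_sum:
  "(\<And>i. i \<in> A \<Longrightarrow> u i \<in> test_functions) \<Longrightarrow>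
   fourier (\<lambda>t. \<Sum>i\<in>A. u i t) = (\<lambda>x. \<Sum>i\<in>A. fourier (u i) x)"
  by (induction A rule: infinite_finite_induct)
     (auto simp: fourier_add test_functions_sum fourier_zero)

text \<open>Translates of \<open>fourier u\<close> are Fourier transforms of modulations of \<open>u\<close>: this turns the
  system of translates into a system of exponentials.\<close>

lemma fourier_modulate: "fourier (\<lambda>t. u t * wave a t) x = fourier u (x - a)"
  by (simp only: fourier_wave wave_minus_add mult.assoc)

lemma norm_fourier_le:
  assumes "u \<in> test_functions" "\<forall>t. R \<le> \<bar>t\<bar> \<longrightarrow> u t = 0" "R \<ge> 0" "\<And>t. cmod (u t) \<le> B"
  shows "cmod (fourier u x) \<le> 2 * R * B"
proof -
  have "cmod (integral (cbox (- R) R) (\<lambda>t. u t * wave (- x) t)) \<le> B * measure lborel (cbox (-R) R)"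
  proof (rule has_integral_bound)
    show "0 \<le> B" using norm_ge_zero assms(4) by (rule order_trans)
    show "((\<lambda>t. u t * wave (- x) t) has_integral
        integral (cbox (- R) R) (\<lambda>t. u t * wave (- x) t)) (cbox (- R) R)"
      by (intro integrable_integral integrable_continuous continuous_on_times_wave assms(1))
  qed (use assms(4) in \<open>auto simp: norm_mult\<close>)
  then show ?thesis
    using fourier_integral[OF assms(1,2), of x] assms(3) by (simp add: algebra_simps)
qed

lemma fourier_has_vector_derivative:
  assumes "u \<in> test_functions"
  shows "(fourier u has_vector_derivative
           fourier (\<lambda>t. (- 2 * of_real pi * \<i>) * of_real t * u t) x) (at x)"
proof -
  obtain R where R: "R > 0" "\<forall>t. R \<le> \<bar>t\<bar> \<longrightarrow> u t = 0" using test_functions_vanish[OF assms] by blast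
  let ?v = "\<lambda>t. (- 2 * of_real pi * \<i>) * of_real t * u t"
  have v: "?v \<in> test_functions"
    by (intro test_functions_mult assms smooth_intros)
  have cu: "continuous_on A u" for A
    using assms by (intro smooth_continuous test_functions_smooth)
  have "((\<lambda>x. integral (cbox (- R) R) (\<lambda>t. u t * wave (- x) t)) has_vector_derivative
      integral (cbox (- R) R) (\<lambda>t. ?v t * wave (- x) t)) (at x within UNIV)"
  proof (rule leibniz_rule_vector_derivative)
    show "((\<lambda>x. u t * wave (- x) t) has_vector_derivative ?v t * wave (- x) t) (at x within UNIV)" for x t
    proof -
      have "((\<lambda>z. u t * exp (2 * of_real pi * \<i> * (- z) * of_real t)) has_field_derivative
         ?v t * exp (2 * of_real pi * \<i> * (- of_real x) * of_real t)) (at (of_real x))"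
        by (auto intro!: derivative_eq_intros)
      from has_vector_derivative_real_field[OF this] show ?thesis by (simp add: wave_def)
    qed
    show "(\<lambda>t. u t * wave (- x) t) integrable_on cbox (- R) R" for x
      by (intro integrable_continuous continuous_on_times_wave assms)
    show "continuous_on (UNIV \<times> cbox (- R) R) (\<lambda>(x, t). ?v t * wave (- x) t)"
      unfolding wave_def split_beta
      by (intro continuous_intros continuous_on_compose2[OF cu[of UNIV]]) auto
  qed auto
  moreover have "fourier u = (\<lambda>x. integral (cbox (- R) R) (\<lambda>t. u t * wave (- x) t))"
    using fourier_integral[OF assms R(2)] by auto
  moreover have "fourier ?v x = integral (cbox (- R) R) (\<lambda>t. ?v t * wave (- x) t)"
    using fourier_integral[OF v, of R x] R(2) by simp
  ultimately show ?thesis by simp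
qed

lemma fourier_vd:
  assumes "u \<in> test_functions"
  shows "fourier (vd u) x = 2 * of_real pi * \<i> * of_real x * fourier u x"
proof -
  obtain R where R: "R > 0" "\<forall>t. R \<le> \<bar>t\<bar> \<longrightarrow> u t = 0" using test_functions_vanish[OF assms] by blast
  let ?c = "2 * of_real pi * \<i> * of_real x"
  have z: "\<forall>t. R \<le> \<bar>t\<bar> \<longrightarrow> vd u t = 0"
  proof (intro allI impI)
    fix t assume that: "R \<le> \<bar>t\<bar>"
    have "continuous_on UNIV (vd u)"
      using assms by (intro smooth_continuous smooth_vd test_functions_smooth)
    then have "closed {t. vd u t = 0}" by (intro closed_Collect_eq continuous_intros) auto
    moreover have "{t. R < \<bar>t\<bar>} \<subseteq> {t. vd u t = 0}"
      using vd_zero_off_closed[of "{-R..R}" u] R(2) by force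
    ultimately have "closure {t. R < \<bar>t\<bar>} \<subseteq> {t. vd u t = 0}" by (rule closure_minimal[rotated])
    \<comment> \<open>The derivative also vanishes at \<open>t = \<plusminus> R\<close>, by continuity.\<close>
    moreover have "t \<in> closure {t. R < \<bar>t\<bar>}"
    proof -
      have "t \<in> closure {R<..} \<or> t \<in> closure {..<-R}" using that by auto
      moreover have "closure {R<..} \<subseteq> closure {t. R < \<bar>t\<bar>}" "closure {..<-R} \<subseteq> closure {t. R < \<bar>t\<bar>}"
        by (intro closure_mono; force)+
      ultimately show ?thesis by blast
    qed
    ultimately show "vd u t = 0" by blast
  qed
  have d: "((\<lambda>t. u t * wave (- x) t) has_vector_derivative
     u t * (2 * of_real pi * \<i> * of_real (- x) * wave (- x) t) + vd u t * wave (- x) t) (at t)" for t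
    by (rule has_vector_derivative_mult[OF smooth_has_vd[OF test_functions_smooth[OF assms]]
          has_vector_derivative_wave])
  have "((\<lambda>t. u t * (2 * of_real pi * \<i> * of_real (- x) * wave (- x) t) + vd u t * wave (- x) t)
      has_integral u R * wave (- x) R - u (- R) * wave (- x) (- R)) {-R..R}"
    using R(1) by (intro fundamental_theorem_of_calculus has_vector_derivative_at_within[OF d]) auto
  then have *: "((\<lambda>t. vd u t * wave (- x) t - ?c * (u t * wave (- x) t)) has_integral 0) {-R..R}"
    using R by (simp add: algebra_simps)
  have i1: "((\<lambda>t. vd u t * wave (- x) t) has_integral fourier (vd u) x) {-R..R}"
    unfolding fourier_integral[OF test_functions_vd[OF assms] z]
    using integrable_continuous_interval[OF continuous_on_times_wave[OF test_functions_vd[OF assms]]]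
    by (rule integrable_integral)
  have i2: "((\<lambda>t. u t * wave (- x) t) has_integral fourier u x) {-R..R}"
    unfolding fourier_integral[OF assms R(2)]
    using integrable_continuous_interval[OF continuous_on_times_wave[OF assms]]
    by (rule integrable_integral)
  from has_integral_unique[OF * has_integral_diff[OF i1 has_integral_mult_right[OF i2, of ?c]]]
  show ?thesis by simp
qed

lemma fourier_higher_vderiv:
  "u \<in> test_functions \<Longrightarrow>
   fourier (higher_vderiv n u) x = (2 * of_real pi * \<i> * of_real x) ^ n * fourier u x"
  by (induction n) (auto simp: higher_vderiv_Suc fourier_vd test_functions_higher_vderiv)

lemma higher_vderiv_fourier:
  assumes "u \<in> test_functions"
  shows "higher_vderiv k (fourier u) = fourier (\<lambda>t. (- 2 * of_real pi * \<i> * of_real t) ^ k * u t)"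
proof (induction k)
  case (Suc k)
  let ?w = "\<lambda>t. (- 2 * of_real pi * \<i> * of_real t) ^ k * u t"
  have "?w \<in> test_functions"
    by (intro test_functions_mult assms smooth_intros)
  from fourier_has_vector_derivative[OF this]
  have "vd (fourier ?w) = fourier (\<lambda>t. - 2 * of_real pi * \<i> * of_real t * ?w t)"
    by (intro ext vector_derivative_at)
  then show ?case by (simp add: higher_vderiv_Suc Suc mult.assoc)
qed simp

lemma smooth_fourier:
  assumes "u \<in> test_functions"
  shows "smooth (fourier u)"
  unfolding smooth_def
proof (intro allI)
  fix k x
  have "(\<lambda>t. (- 2 * of_real pi * \<i> * of_real t) ^ k * u t) \<in> test_functions"
    by (intro test_functions_mult assms smooth_intros)
  from fourier_has_vector_derivative[OF this, of x]
  show "higher_vderiv k (fourier u) differentiable at x"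
    unfolding higher_vderiv_fourier[OF assms] by (rule differentiableI_vector)
qed

lemma schwartz_seminorm_le:
  "(\<And>x. (1 + \<bar>x\<bar>) ^ n * cmod (higher_vderiv k f x) \<le> B) \<Longrightarrow> schwartz_seminorm n k f \<le> B"
  unfolding schwartz_seminorm_def by (rule cSUP_least) auto

lemma schwartz_seminorm_upper:
  "f \<in> schwartz \<Longrightarrow> (1 + \<bar>x\<bar>) ^ n * cmod (higher_vderiv k f x) \<le> schwartz_seminorm n k f"
  unfolding schwartz_seminorm_def by (rule cSUP_upper) (auto simp: schwartz_def)

lemma schwartzI:
  assumes "smooth f" "\<And>n k. \<exists>B. \<forall>x. (1 + \<bar>x\<bar>) ^ n * cmod (higher_vderiv k f x) \<le> B"
  shows "f \<in> schwartz"
  unfolding schwartz_def mem_Collect_eq bdd_above_def using assms by fastforce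

lemma schwartz_smooth: "f \<in> schwartz \<Longrightarrow> smooth f"
  by (simp add: schwartz_def)

lemma schwartz_seminorm_nonneg:
  assumes "f \<in> schwartz" shows "0 \<le> schwartz_seminorm n k f"
  by (rule order_trans[OF _ schwartz_seminorm_upper[OF assms, of 0]]) simp

text \<open>The continuity of the Fourier transform, quantified: a power of \<open>x\<close> becomes a derivative of the
  transformed function and a derivative becomes multiplication by a power of \<open>t\<close>, which is absorbed
  into the fixed factor \<open>u\<close>. The remaining integrals run over the compact set \<open>K\<close>.\<close>

lemma fourier_weighted_bound:
  assumes "compact K" "smooth u" "\<forall>x. x \<notin> K \<longrightarrow> u x = 0"
  shows "\<exists>C\<ge>0. \<forall>g \<eta>. smooth g \<longrightarrow> \<eta> \<ge> 0 \<longrightarrow>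
     (\<forall>i\<le>n. \<forall>x\<in>K. cmod (higher_vderiv i g x) \<le> \<eta>) \<longrightarrow>
     (\<forall>x. (1 + \<bar>x\<bar>) ^ n * cmod (higher_vderiv k (fourier (\<lambda>t. u t * g t)) x) \<le> C * \<eta>)"
proof -
  define w where "w = (\<lambda>t. (- 2 * of_real pi * \<i> * of_real t) ^ k * u t)"
  have w: "smooth w" "\<forall>x. x \<notin> K \<longrightarrow> w x = 0"
    unfolding w_def by (intro smooth_intros assms(2)) (simp add: assms(3))
  obtain R' where R': "\<forall>x\<in>K. \<bar>x\<bar> \<le> R'"
    using compact_imp_bounded[OF assms(1)] unfolding bounded_iff by auto
  define R where "R = max R' 0 + 1"
  have R: "R > 0" "\<And>t. R \<le> \<bar>t\<bar> \<Longrightarrow> t \<notin> K" using R' by (force simp: R_def)+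
  obtain C0 where C0: "C0 \<ge> 0" "\<forall>g \<eta>. smooth g \<longrightarrow> \<eta> \<ge> 0 \<longrightarrow>
     (\<forall>i\<le>0. \<forall>x\<in>K. cmod (higher_vderiv i g x) \<le> \<eta>) \<longrightarrow>
     (\<forall>x. cmod (higher_vderiv 0 (\<lambda>x. w x * g x) x) \<le> C0 * \<eta>)"
    using higher_vderiv_mult_bound[OF assms(1) w, of 0] by (elim exE conjE) (rule that)
  obtain C1 where C1: "C1 \<ge> 0" "\<forall>g \<eta>. smooth g \<longrightarrow> \<eta> \<ge> 0 \<longrightarrow>
     (\<forall>i\<le>n. \<forall>x\<in>K. cmod (higher_vderiv i g x) \<le> \<eta>) \<longrightarrow>
     (\<forall>x. cmod (higher_vderiv n (\<lambda>x. w x * g x) x) \<le> C1 * \<eta>)"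
    using higher_vderiv_mult_bound[OF assms(1) w, of n] by (elim exE conjE) (rule that)
  define C where "C = 2 ^ n * (2 * R * C0 + 2 * R * C1)"
  show ?thesis
  proof (intro exI[of _ C] conjI allI impI)
    show "C \<ge> 0" using C0(1) C1(1) R(1) by (simp add: C_def)
    fix g \<eta> x
    assume g: "smooth g" "(0::real) \<le> \<eta>" "\<forall>i\<le>n. \<forall>x\<in>K. cmod (higher_vderiv i g x) \<le> \<eta>"
    let ?h = "\<lambda>t. w t * g t"
    have h: "?h \<in> test_functions"
      by (rule test_functionsI[OF _ assms(1)]) (use g w in \<open>auto intro: smooth_mult\<close>)
    have hz: "higher_vderiv i ?h t = 0" if "R \<le> \<bar>t\<bar>" for t i
      by (rule higher_vderiv_zero_off_closed[OF compact_imp_closed[OF assms(1)]])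
         (use that R w in auto)
    have ug: "(\<lambda>t. u t * g t) \<in> test_functions"
      by (rule test_functionsI[OF _ assms(1)]) (use g assms in \<open>auto intro: smooth_mult\<close>)
    have F: "higher_vderiv k (fourier (\<lambda>t. u t * g t)) = fourier ?h"
      unfolding higher_vderiv_fourier[OF ug] by (simp add: w_def mult.assoc)
    have b0: "cmod (fourier ?h x) \<le> 2 * R * (C0 * \<eta>)"
      by (rule norm_fourier_le[OF h]) (use hz[of _ 0] C0(2)[rule_format, OF g(1,2)] g(3) R in auto)
    have "cmod (fourier (higher_vderiv n ?h) x) \<le> 2 * R * (C1 * \<eta>)"
      by (rule norm_fourier_le[OF test_functions_higher_vderiv[OF h]])
         (use hz[of _ n] C1(2)[rule_format, OF g(1,2)] g(3) R in auto)
    then have b1: "(2 * pi * \<bar>x\<bar>) ^ n * cmod (fourier ?h x) \<le> 2 * R * (C1 * \<eta>)"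
      by (simp add: fourier_higher_vderiv[OF h] norm_mult norm_power)
    have "(1 + \<bar>x\<bar>) ^ n \<le> (2 * max 1 (2 * pi * \<bar>x\<bar>)) ^ n"
    proof (intro power_mono)
      have "\<bar>x\<bar> \<le> 2 * pi * \<bar>x\<bar>" using pi_ge_two by (simp add: mult_le_cancel_right1)
      then show "1 + \<bar>x\<bar> \<le> 2 * max 1 (2 * pi * \<bar>x\<bar>)" by linarith
    qed simp
    also have "\<dots> \<le> 2 ^ n * (1 + (2 * pi * \<bar>x\<bar>) ^ n)"
      by (auto simp: power_mult_distrib max_def)
    finally have "(1 + \<bar>x\<bar>) ^ n * cmod (fourier ?h x)
        \<le> 2 ^ n * (1 + (2 * pi * \<bar>x\<bar>) ^ n) * cmod (fourier ?h x)"
      by (rule mult_right_mono) simp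
    also have "\<dots> = 2 ^ n * (cmod (fourier ?h x) + (2 * pi * \<bar>x\<bar>) ^ n * cmod (fourier ?h x))"
      by (simp add: algebra_simps)
    also have "\<dots> \<le> 2 ^ n * (2 * R * (C0 * \<eta>) + 2 * R * (C1 * \<eta>))"
      by (intro mult_left_mono add_mono b0 b1) simp
    also have "\<dots> = C * \<eta>" by (simp add: C_def algebra_simps)
    finally show "(1 + \<bar>x\<bar>) ^ n * cmod (higher_vderiv k (fourier (\<lambda>t. u t * g t)) x) \<le> C * \<eta>"
      unfolding F .
  qed
qed

lemma higher_vderiv_one: "cmod (higher_vderiv i (\<lambda>_. 1) x) \<le> 1"
  by (cases i) (auto simp: higher_vderiv_Suc' higher_vderiv_zero)

lemma fourier_test_in_schwartz:
  assumes "u \<in> test_functions" shows "fourier u \<in> schwartz"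
proof (rule schwartzI)
  show "smooth (fourier u)" by (rule smooth_fourier[OF assms])
  obtain R where "R > 0" "\<forall>t. R \<le> \<bar>t\<bar> \<longrightarrow> u t = 0" using test_functions_vanish[OF assms] by blast
  then have z: "\<forall>x. x \<notin> {-R..R} \<longrightarrow> u x = 0" by auto
  show "\<exists>B. \<forall>x. (1 + \<bar>x\<bar>) ^ n * cmod (higher_vderiv k (fourier u) x) \<le> B" for n k
  proof -
    obtain C where C: "\<forall>g \<eta>. smooth g \<longrightarrow> \<eta> \<ge> 0 \<longrightarrow>
     (\<forall>i\<le>n. \<forall>x\<in>{-R..R}. cmod (higher_vderiv i g x) \<le> \<eta>) \<longrightarrow>
     (\<forall>x. (1 + \<bar>x\<bar>) ^ n * cmod (higher_vderiv k (fourier (\<lambda>t. u t * g t)) x) \<le> C * \<eta>)"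
      using fourier_weighted_bound[OF compact_Icc test_functions_smooth[OF assms] z, of n k]
      by (elim exE conjE) (rule that)
    from C[rule_format, of "\<lambda>_. 1" 1] show ?thesis by (auto simp: higher_vderiv_one)
  qed
qed

section \<open>Approximation with derivatives\<close>

definition jet_le :: "nat \<Rightarrow> real set \<Rightarrow> real \<Rightarrow> (real \<Rightarrow> complex) \<Rightarrow> bool" where
  "jet_le k K \<eta> g \<longleftrightarrow> (\<forall>i\<le>k. \<forall>x\<in>K. cmod (higher_vderiv i g x) \<le> \<eta>)"

lemma jet_le_add:
  assumes "jet_le k K a f" "jet_le k K b g" "smooth f" "smooth g"
  shows "jet_le k K (a + b) (\<lambda>x. f x + g x)"
  using assms by (auto simp: jet_le_def higher_vderiv_add intro!: norm_triangle_mono)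

lemma jet_le_mono: "jet_le k K a f \<Longrightarrow> a \<le> b \<Longrightarrow> jet_le k K b f"
  unfolding jet_le_def by (meson order_trans)

lemma jet_le_subset: "jet_le k K a f \<Longrightarrow> k' \<le> k \<Longrightarrow> K' \<subseteq> K \<Longrightarrow> jet_le k' K' a f"
  unfolding jet_le_def by (meson order_trans subsetD)

lemma all_le_Suc: "(\<forall>i\<le>Suc k. P i) \<longleftrightarrow> P 0 \<and> (\<forall>i\<le>k. P (Suc i))"
  by (metis Suc_le_mono le0 not0_implies_Suc)

lemma jet_le_Suc:
  "jet_le (Suc k) K \<eta> g \<longleftrightarrow> (\<forall>x\<in>K. cmod (g x) \<le> \<eta>) \<and> jet_le k K \<eta> (vd g)"
  unfolding jet_le_def all_le_Suc higher_vderiv_Suc' higher_vderiv_0 ..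

lemma pderiv_sum: "pderiv (\<Sum>i\<in>A. f i) = (\<Sum>i\<in>A. pderiv (f i))"
  by (induction A rule: infinite_finite_induct) (auto simp: pderiv_add)

lemma poly_antiderivative: "\<exists>P :: complex poly. pderiv P = q \<and> poly P 0 = c"
proof (intro exI conjI)
  let ?P = "[:c:] + (\<Sum>i\<le>degree q. monom (coeff q i / of_nat (Suc i)) (Suc i))"
  have "pderiv ?P = (\<Sum>i\<le>degree q. monom (coeff q i) i)"
    by (simp add: pderiv_add pderiv_sum pderiv_monom pderiv_pCons del: of_nat_Suc)
  then show "pderiv ?P = q" by (simp add: poly_as_sum_of_monoms)
  show "poly ?P 0 = c" by (simp add: poly_sum poly_monom)
qed

lemma continuous_poly_approx:
  fixes g :: "real \<Rightarrow> complex"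
  assumes "continuous_on {-R..R} g" "\<eta> > 0"
  shows "\<exists>p. \<forall>x\<in>{-R..R}. cmod (g x - poly p (of_real x)) \<le> \<eta>"
proof -
  obtain h where h: "polynomial_function h" "\<forall>x\<in>{-R..R}. cmod (g x - h x) < \<eta>"
    using Stone_Weierstrass_polynomial_function[OF compact_Icc assms] by blast
  have "real_polynomial_function (\<lambda>x. Re (h x))" "real_polynomial_function (\<lambda>x. Im (h x))"
    using h(1) bounded_linear_Re bounded_linear_Im
    unfolding polynomial_function_def by (auto simp: o_def)
  then obtain a n b m where ab:
    "(\<lambda>x. Re (h x)) = (\<lambda>x. \<Sum>i\<le>n. a i * x ^ i)" "(\<lambda>x. Im (h x)) = (\<lambda>x. \<Sum>i\<le>m. b i * x ^ i)"
    unfolding real_polynomial_function_iff_sum by blast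
  let ?p = "(\<Sum>i\<le>n. monom (of_real (a i)) i) + smult \<i> (\<Sum>i\<le>m. monom (of_real (b i)) i)"
  have "h x = poly ?p (of_real x)" for x
    using fun_cong[OF ab(1), of x] fun_cong[OF ab(2), of x]
    by (simp add: complex_eq_iff poly_sum poly_monom flip: of_real_power of_real_mult of_real_sum)
  then show ?thesis using h(2) by (intro exI[of _ ?p]) (auto intro: less_imp_le)
qed

text \<open>Weierstrass' theorem with derivatives: approximate \<open>vd g\<close> with \<open>k\<close> derivatives and integrate the
  polynomial from \<open>0\<close>.\<close>

lemma smooth_poly_approx:
  assumes "R \<ge> 0"
  shows "smooth g \<Longrightarrow> \<eta> > 0 \<Longrightarrow> \<exists>p. jet_le k {-R..R} \<eta> (\<lambda>x. g x - poly p (of_real x))"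
proof (induction k arbitrary: g \<eta>)
  case 0
  from continuous_poly_approx[OF smooth_continuous[OF 0(1)] 0(2)]
  show ?case by (simp add: jet_le_def)
next
  case (Suc k)
  define \<eta>' where "\<eta>' = \<eta> / (1 + R)"
  have \<eta>': "\<eta>' > 0" "\<eta>' \<le> \<eta>" "\<eta>' * R \<le> \<eta>"
    using assms Suc.prems by (auto simp: \<eta>'_def field_simps)
  from Suc.IH[OF smooth_vd[OF Suc.prems(1)] \<eta>'(1)]
  obtain q where q: "jet_le k {-R..R} \<eta>' (\<lambda>x. vd g x - poly q (of_real x))" by (elim exE)
  obtain P where P: "pderiv P = q" "poly P 0 = g 0" using poly_antiderivative by blast
  let ?h = "\<lambda>x. g x - poly P (of_real x)"
  have dh: "(?h has_vector_derivative vd g x - poly q (of_real x)) (at x)" for x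
    using has_vector_derivative_diff[OF smooth_has_vd[OF Suc.prems(1)] has_vector_derivative_poly_of_real[of P x]]
    by (simp add: P)
  then have vdh: "vd ?h = (\<lambda>x. vd g x - poly q (of_real x))"
    by (intro ext vector_derivative_at)
  have qb: "cmod (vd g x - poly q (of_real x)) \<le> \<eta>'" if "x \<in> {-R..R}" for x
    using q that unfolding jet_le_def by (metis higher_vderiv_0 le0)
  have "cmod (?h x) \<le> \<eta>" if x: "x \<in> {-R..R}" for x
  proof -
    have "cmod (?h x - ?h 0) \<le> \<eta>' * norm (x - 0)"
    proof (rule differentiable_bound[of "{-R..R}"])
      show "(?h has_derivative (\<lambda>s. s *\<^sub>R (vd g y - poly q (of_real y)))) (at y within {-R..R})" for y
        using dh[of y] unfolding has_vector_derivative_def by (rule has_derivative_at_withinI)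
      show "onorm (\<lambda>s. s *\<^sub>R (vd g y - poly q (of_real y))) \<le> \<eta>'" if "y \<in> {-R..R}" for y
        using mult_right_mono[OF qb[OF that], of "\<bar>s\<bar>" for s]
        by (intro onorm_le) (simp add: mult.commute)
    qed (use x assms in auto)
    also have "\<dots> \<le> \<eta>' * R" using x \<eta>' by (intro mult_left_mono) auto
    finally show ?thesis using \<eta>' P by simp
  qed
  moreover have "jet_le k {-R..R} \<eta> (vd ?h)" unfolding vdh using q \<eta>'(2) by (rule jet_le_mono)
  ultimately show ?case unfolding jet_le_Suc by blast
qed

definition jet_conv ::
    "nat \<Rightarrow> real set \<Rightarrow> (nat \<Rightarrow> real \<Rightarrow> complex) \<Rightarrow> (real \<Rightarrow> complex) \<Rightarrow> bool" where
  "jet_conv k K f g \<longleftrightarrow>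
     (\<forall>i\<le>k. uniform_limit K (\<lambda>l. higher_vderiv i (f l)) (higher_vderiv i g) sequentially)"

lemma jet_conv_Suc:
  "jet_conv (Suc k) K f g \<longleftrightarrow>
     uniform_limit K f g sequentially \<and> jet_conv k K (\<lambda>l. vd (f l)) (vd g)"
  unfolding jet_conv_def all_le_Suc higher_vderiv_Suc' higher_vderiv_0 ..

lemma jet_conv_0: "jet_conv 0 K f g \<longleftrightarrow> uniform_limit K f g sequentially"
  by (simp add: jet_conv_def)

lemma jet_conv_SucD: "jet_conv (Suc k) K f g \<Longrightarrow> jet_conv k K f g"
  by (simp add: jet_conv_def)

lemma jet_conv_add:
  assumes "jet_conv k K f f'" "jet_conv k K g g'"
    "\<And>l. smooth (f l)" "\<And>l. smooth (g l)" "smooth f'" "smooth g'"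
  shows "jet_conv k K (\<lambda>l x. f l x + g l x) (\<lambda>x. f' x + g' x)"
  using assms by (simp add: jet_conv_def higher_vderiv_add uniform_limit_add)

lemma jet_conv_const: "jet_conv k K (\<lambda>l. f) f"
  by (simp add: jet_conv_def uniform_limit_const)

lemma bounded_smooth_image: "smooth f \<Longrightarrow> compact K \<Longrightarrow> bounded (f ` K)"
  by (intro compact_imp_bounded compact_continuous_image smooth_continuous)

lemma jet_conv_mult:
  assumes "compact K"
  shows "jet_conv k K f f' \<Longrightarrow> jet_conv k K g g' \<Longrightarrow>
    (\<And>l. smooth (f l)) \<Longrightarrow> (\<And>l. smooth (g l)) \<Longrightarrow> smooth f' \<Longrightarrow> smooth g' \<Longrightarrow>
    jet_conv k K (\<lambda>l x. f l x * g l x) (\<lambda>x. f' x * g' x)"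
proof (induction k arbitrary: f f' g g')
  case 0
  then show ?case unfolding jet_conv_0
    by (intro uniform_lim_mult bounded_smooth_image assms)
next
  case (Suc k)
  have u: "uniform_limit K f f' sequentially" "uniform_limit K g g' sequentially"
    and d: "jet_conv k K (\<lambda>l. vd (f l)) (vd f')" "jet_conv k K (\<lambda>l. vd (g l)) (vd g')"
    using Suc.prems(1,2) unfolding jet_conv_Suc by auto
  have c: "jet_conv k K f f'" "jet_conv k K g g'"
    using Suc.prems(1,2) by (auto dest: jet_conv_SucD)
  note s = Suc.prems(3-6)
  have "jet_conv k K (\<lambda>l x. f l x * vd (g l) x + vd (f l) x * g l x)
      (\<lambda>x. f' x * vd g' x + vd f' x * g' x)"
    by (rule jet_conv_add[OF Suc.IH[OF c(1) d(2)] Suc.IH[OF d(1) c(2)]])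
       (intro smooth_mult smooth_vd s)+
  then show ?case unfolding jet_conv_Suc
    using u s by (auto simp: vd_mult intro!: uniform_lim_mult bounded_smooth_image assms)
qed

lemma jet_conv_eventually:
  assumes "jet_conv k K f g" "\<eta> > 0" "\<And>l. smooth (f l)" "smooth g"
  shows "\<forall>\<^sub>F l in sequentially. jet_le k K \<eta> (\<lambda>x. f l x - g x)"
proof -
  have "\<forall>\<^sub>F l in sequentially. \<forall>i\<in>{..k}. \<forall>x\<in>K. cmod (higher_vderiv i (\<lambda>x. f l x - g x) x) \<le> \<eta>"
  proof (rule eventually_ball_finite, simp, intro ballI)
    fix i assume "i \<in> {..k}"
    then have "uniform_limit K (\<lambda>l. higher_vderiv i (f l)) (higher_vderiv i g) sequentially"
      using assms(1) by (simp add: jet_conv_def)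
    from uniform_limitD[OF this assms(2)]
    show "\<forall>\<^sub>F l in sequentially. \<forall>x\<in>K. cmod (higher_vderiv i (\<lambda>x. f l x - g x) x) \<le> \<eta>"
      by eventually_elim (use assms(3,4) in \<open>auto simp: higher_vderiv_diff dist_norm less_imp_le\<close>)
  qed
  then show ?thesis by (rule eventually_mono) (auto simp: jet_le_def)
qed

lemma power_times_geometric_tendsto_0:
  assumes "0 < \<theta>" "\<theta> < (1::real)"
  shows "(\<lambda>l. of_nat l ^ a * \<theta> ^ l) \<longlonglongrightarrow> 0"
  using assms
proof (induction a arbitrary: \<theta>)
  case (Suc a)
  have q: "0 < sqrt \<theta>" "sqrt \<theta> < 1" using Suc.prems by auto
  have eq: "\<theta> ^ l = sqrt \<theta> ^ l * sqrt \<theta> ^ l" for l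
    using Suc.prems by (simp flip: power_mult_distrib)
  have "(\<lambda>l. (of_nat l * sqrt \<theta> ^ l) * (of_nat l ^ a * sqrt \<theta> ^ l)) \<longlonglongrightarrow> 0 * 0"
    by (intro tendsto_mult Suc.IH q powser_times_n_limit_0) (use q in auto)
  then show ?case by (simp add: eq mult_ac)
qed (simp add: LIMSEQ_realpow_zero)

text \<open>The factor \<open>l ^ a\<close> and the shift \<open>b\<close> of the exponent are what differentiation of \<open>\<rho> ^ l\<close> produces.\<close>

lemma jet_conv_powers_zero:
  assumes "compact K" "smooth \<rho>" "0 < \<theta>" "\<theta> < 1" "\<And>t. t \<in> K \<Longrightarrow> cmod (\<rho> t) \<le> \<theta>"
  shows "smooth w \<Longrightarrow> jet_conv k K (\<lambda>l t. of_nat l ^ a * \<rho> t ^ (l - b) * w t) (\<lambda>t. 0)"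
proof (induction k arbitrary: w a b)
  case 0
  show ?case unfolding jet_conv_0
  proof (rule uniform_limitI)
    fix e :: real assume e: "e > 0"
    have "bounded (w ` K)" using 0 assms(1) by (rule bounded_smooth_image)
    then obtain W where W: "W > 0" "\<forall>y\<in>w ` K. cmod y \<le> W" unfolding bounded_pos by auto
    have "(\<lambda>l. (of_nat l ^ a * \<theta> ^ l) * (W / \<theta> ^ b)) \<longlonglongrightarrow> 0 * (W / \<theta> ^ b)"
      by (intro tendsto_intros power_times_geometric_tendsto_0 assms)
    then have "\<forall>\<^sub>F l in sequentially. (of_nat l ^ a * \<theta> ^ l) * (W / \<theta> ^ b) < e"
      using e by (auto dest: order_tendstoD(2))
    then show "\<forall>\<^sub>F l in sequentially. \<forall>t\<in>K. dist (of_nat l ^ a * \<rho> t ^ (l - b) * w t) 0 < e"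
      using eventually_ge_at_top[of b]
    proof eventually_elim
      case (elim l)
      have "cmod (of_nat l ^ a * \<rho> t ^ (l - b) * w t) \<le> of_nat l ^ a * \<theta> ^ (l - b) * W" if "t \<in> K" for t
        unfolding norm_mult norm_power using that assms W
        by (intro mult_mono power_mono) auto
      moreover have "of_nat l ^ a * \<theta> ^ (l - b) * W = (of_nat l ^ a * \<theta> ^ l) * (W / \<theta> ^ b)"
        using assms(3) elim(2) by (simp add: power_diff)
      ultimately show ?case using elim(1) by fastforce
    qed
  qed
next
  case (Suc k)
  let ?f = "\<lambda>a b w l t. of_nat l ^ a * \<rho> t ^ (l - b) * w t :: complex"
  have sm: "smooth (?f a b w l)" if "smooth w" for a b w l
    by (intro smooth_intros assms that)
  let ?g = "\<lambda>l t. ?f (Suc a) (Suc b) (\<lambda>t. vd \<rho> t * w t) l t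
     + (?f a (Suc b) (\<lambda>t. - of_nat b * (vd \<rho> t * w t)) l t + ?f a b (vd w) l t)"
  have s1: "smooth (\<lambda>t. vd \<rho> t * w t)" and s2: "smooth (\<lambda>t. - of_nat b * (vd \<rho> t * w t))"
    and s3: "smooth (vd w)"
    by (intro smooth_intros smooth_vd assms Suc.prems)+
  have g: "jet_conv k K ?g (\<lambda>t. 0 + (0 + 0))"
    by (intro jet_conv_add Suc.IH s1 s2 s3 sm smooth_add smooth_const)
  have vdf: "vd (?f a b w l) = ?g l" if "b < l" for l
  proof
    fix t
    have "((\<lambda>z. z ^ (l - b)) has_field_derivative of_nat (l - b) * \<rho> t ^ (l - b - 1)) (at (\<rho> t))"
      by (auto intro!: derivative_eq_intros)
    from field_vector_diff_chain_at[OF smooth_has_vd[OF assms(2)] this]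
    have "((\<lambda>t. \<rho> t ^ (l - b)) has_vector_derivative vd \<rho> t * (of_nat (l - b) * \<rho> t ^ (l - b - 1))) (at t)"
      by (simp add: o_def)
    from has_vector_derivative_mult[OF has_vector_derivative_mult_right[OF this, of "of_nat l ^ a"]
        smooth_has_vd[OF Suc.prems]]
    have "vd (?f a b w l) t = of_nat l ^ a * \<rho> t ^ (l - b) * vd w t
        + of_nat l ^ a * (vd \<rho> t * (of_nat (l - b) * \<rho> t ^ (l - b - 1))) * w t"
      by (rule vector_derivative_at)
    also have "\<dots> = ?g l t"
      using that by (simp add: of_nat_diff algebra_simps)
    finally show "vd (?f a b w l) t = ?g l t" .
  qed
  have "jet_conv k K (\<lambda>l. vd (?f a b w l)) (vd (\<lambda>t. 0))"
    unfolding jet_conv_def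
  proof (intro allI impI)
    fix i assume "i \<le> k"
    then have *: "uniform_limit K (\<lambda>l. higher_vderiv i (?g l)) (higher_vderiv i (\<lambda>t. 0)) sequentially"
      using g by (simp add: jet_conv_def)
    have "\<forall>\<^sub>F l in sequentially. \<forall>x\<in>K. higher_vderiv i (vd (?f a b w l)) x = higher_vderiv i (?g l) x"
      using eventually_gt_at_top[of b] by eventually_elim (simp only: vdf simp_thms ball_triv)
    from uniform_limit_cong[OF this, of "higher_vderiv i (\<lambda>t. 0)" "higher_vderiv i (\<lambda>t. 0)"] *
    show "uniform_limit K (\<lambda>l. higher_vderiv i (vd (?f a b w l))) (higher_vderiv i (vd (\<lambda>t. 0))) sequentially"
      by simp
  qed
  moreover have "uniform_limit K (?f a b w) (\<lambda>t. 0) sequentially"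
    using Suc.IH[OF Suc.prems, of a b] by (auto simp: jet_conv_def dest: spec[of _ 0])
  ultimately show ?case unfolding jet_conv_Suc by blast
qed

section \<open>Trigonometric polynomials with high frequencies\<close>

text \<open>Expanding the square of the geometric sum produces the Fejer kernel. Read from right to left, it
  exhibits an analytic polynomial without constant term whose real part on the circle is a positive
  kernel minus a large constant.\<close>

lemma norm_geometric_sum_squared:
  assumes "cmod z = 1"
  shows "(cmod (\<Sum>k<n. z ^ k))\<^sup>2 = of_nat n + 2 * Re (\<Sum>m<n. \<Sum>k=1..m. z ^ k)"
proof (induction n)
  case (Suc n)
  have zc: "z * cnj z = 1" using assms by (simp add: complex_norm_square[symmetric])
  have "z ^ n * cnj (\<Sum>k<n. z ^ k) = (\<Sum>k<n. z ^ (n - k))"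
  proof -
    have "z ^ n * cnj z ^ k = z ^ (n - k)" if "k < n" for k
    proof -
      have "z ^ n = z ^ (n - k) * z ^ k" using that by (simp flip: power_add)
      then have "z ^ n * cnj z ^ k = z ^ (n - k) * (z * cnj z) ^ k" by (simp add: power_mult_distrib mult.assoc)
      then show ?thesis by (simp add: zc)
    qed
    then show ?thesis by (simp add: sum_distrib_left)
  qed
  also have "\<dots> = (\<Sum>k=1..n. z ^ k)"
    by (rule sum.reindex_bij_witness[of _ "\<lambda>k. n - k" "\<lambda>k. n - k"]) auto
  finally have zn: "z ^ n * cnj (\<Sum>k<n. z ^ k) = (\<Sum>k=1..n. z ^ k)" .
  have "(cmod (a + b))\<^sup>2 = (cmod a)\<^sup>2 + (cmod b)\<^sup>2 + 2 * Re (b * cnj a)" for a b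
    unfolding cmod_power2 by (simp add: power2_eq_square algebra_simps)
  from this[of "\<Sum>k<n. z ^ k" "z ^ n"]
  have "(cmod (\<Sum>k<Suc n. z ^ k))\<^sup>2 = (cmod (\<Sum>k<n. z ^ k))\<^sup>2 + 1 + 2 * Re (\<Sum>k=1..n. z ^ k)"
    unfolding zn using assms by (simp add: norm_power)
  then show ?case using Suc.IH by simp
qed simp

lemma wave_1_eq_1_iff: "wave 1 t = 1 \<longleftrightarrow> t \<in> \<int>"
proof
  assume "wave 1 t = 1"
  then obtain n :: int where "2 * pi * t = of_int (2 * n) * pi"
    unfolding wave_def exp_eq_1 by auto
  then have "t = of_int n" by simp
  then show "t \<in> \<int>" by simp
next
  assume "t \<in> \<int>"
  then obtain n where "t = of_int n" by (auto elim: Ints_cases)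
  then show "wave 1 t = 1"
    unfolding wave_def exp_eq_1 by (auto intro!: exI[of _ n])
qed

text \<open>A polynomial \<open>r\<close> with \<open>r 0 = 1\<close> cannot be smaller than \<open>1\<close> on the whole circle, but it can be on a
  closed arc that avoids the point \<open>1\<close>. There the Fejer kernel is bounded, so the analytic polynomial \<open>W\<close>
  of the preceding identity has real part at most \<open>-1\<close> once \<open>n\<close> is large, and \<open>1 + W / B\<close> has modulus
  less than \<open>1\<close> there for large \<open>B\<close>.\<close>

lemma contracting_polynomial:
  assumes "compact K" "K \<inter> \<int> = {}"
  shows "\<exists>(r :: complex poly) \<theta>. poly r 0 = 1 \<and> 0 < \<theta> \<and> \<theta> < 1 \<and>
     (\<forall>t\<in>K. cmod (poly r (wave 1 t)) \<le> \<theta>)"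
proof (cases "K = {}")
  case True
  then show ?thesis by (intro exI[of _ 1] exI[of _ "1/2"]) auto
next
  case False
  have cw: "continuous_on A (wave 1)" for A by (intro smooth_continuous smooth_wave)
  have "continuous_on K (\<lambda>t. cmod (1 - wave 1 t))" by (intro continuous_intros cw)
  then obtain t0 where t0: "t0 \<in> K" "\<And>t. t \<in> K \<Longrightarrow> cmod (1 - wave 1 t0) \<le> cmod (1 - wave 1 t)"
    using continuous_attains_inf[OF assms(1) False] by blast
  define d where "d = cmod (1 - wave 1 t0)"
  have d: "d > 0" using t0(1) assms(2) wave_1_eq_1_iff[of t0] by (auto simp: d_def)
  \<comment> \<open>On \<open>K\<close> the geometric sum is at most \<open>2 / d\<close>, so this \<open>n\<close> outweighs the kernel.\<close>
  obtain n :: nat where n: "2 + 4 / d\<^sup>2 \<le> of_nat n" using real_arch_simple by blast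
  define W where "W = (\<Sum>m<n. \<Sum>k=1..m. monom (1::complex) k)"
  have W: "poly W z = (\<Sum>m<n. \<Sum>k=1..m. z ^ k)" for z
    by (simp add: W_def poly_sum poly_monom)
  have ReW: "Re (poly W (wave 1 t)) \<le> -1" if "t \<in> K" for t
  proof -
    let ?z = "wave 1 t"
    have "(1 - ?z) * (\<Sum>k<n. ?z ^ k) = 1 - ?z ^ n" by (simp add: one_diff_power_eq)
    then have "cmod (1 - ?z) * cmod (\<Sum>k<n. ?z ^ k) = cmod (1 - ?z ^ n)"
      by (metis norm_mult)
    also have "\<dots> \<le> 2" using norm_triangle_ineq4[of 1 "?z ^ n"] by (simp add: norm_power)
    finally have "d * cmod (\<Sum>k<n. ?z ^ k) \<le> 2"
      using t0(2)[OF that] by (smt (verit) d_def mult_right_mono norm_ge_zero)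
    then have "cmod (\<Sum>k<n. ?z ^ k) \<le> 2 / d" using d by (simp add: field_simps)
    then have "(cmod (\<Sum>k<n. ?z ^ k))\<^sup>2 \<le> (2 / d)\<^sup>2" by (intro power_mono) auto
    then have "of_nat n + 2 * Re (poly W ?z) \<le> 4 / d\<^sup>2"
      unfolding W using norm_geometric_sum_squared[of ?z n] by (simp add: power_divide)
    then show ?thesis using n by linarith
  qed
  have "bounded ((\<lambda>t. poly W (wave 1 t)) ` K)"
    by (intro compact_imp_bounded compact_continuous_image assms continuous_intros cw)
  then obtain C where C: "C > 0" "\<forall>y\<in>(\<lambda>t. poly W (wave 1 t)) ` K. cmod y \<le> C"
    unfolding bounded_pos by auto
  define B where "B = C\<^sup>2 + 2"
  have B: "B \<ge> 2" "C\<^sup>2 \<le> B" by (auto simp: B_def)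
  let ?r = "1 + smult (1 / of_real B) W"
  have "cmod (poly ?r (wave 1 t)) \<le> sqrt (1 - 1 / B)" if "t \<in> K" for t
  proof -
    let ?y = "poly W (wave 1 t)"
    have "(cmod (poly ?r (wave 1 t)))\<^sup>2 = 1 + 2 * Re ?y / B + (cmod ?y)\<^sup>2 / B\<^sup>2"
      using B(1) unfolding cmod_power2 by (simp add: power2_eq_square field_simps)
    also have "\<dots> \<le> 1 + 2 * (-1) / B + C\<^sup>2 / B\<^sup>2"
      using ReW[OF that] C that B(1) by (intro add_mono divide_right_mono power_mono) auto
    also have "\<dots> \<le> 1 + 2 * (-1) / B + B / B\<^sup>2"
      using B by (intro add_mono divide_right_mono) auto
    also have "\<dots> = 1 - 1 / B" using B by (simp add: power2_eq_square field_simps)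
    finally show ?thesis by (rule real_le_rsqrt)
  qed
  moreover have "poly ?r 0 = 1" by (simp add: W power_0_left)
  moreover have "0 < sqrt (1 - 1 / B)" "sqrt (1 - 1 / B) < 1" using B(1) by auto
  ultimately show ?thesis by blast
qed

lemma smooth_poly_wave: "smooth (\<lambda>t. poly p (wave a t))"
  unfolding poly_altdef by (intro smooth_intros smooth_wave)

text \<open>Since \<open>r 0 = 1\<close>, the polynomial \<open>1 - r ^ l\<close> has no constant term, while \<open>r ^ l\<close> tends to zero with all
  derivatives. A product of \<open>N\<close> such factors therefore has only frequencies from \<open>N\<close> on and is close
  to \<open>1\<close>. The smooth weight \<open>w\<close> makes the induction on \<open>N\<close> go through: the next factor is applied to
  the weight \<open>poly Q (wave 1 t) * w t\<close>.\<close>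

lemma high_frequency_unit:
  assumes "compact K" "K \<inter> \<int> = {}" "smooth w" "\<eta> > 0"
  shows "\<exists>Q. [:0, 1:] ^ N dvd Q \<and> jet_le k K \<eta> (\<lambda>t. poly Q (wave 1 t) * w t - w t)"
proof -
  obtain r \<theta> where r: "poly r (0::complex) = 1" "0 < \<theta>" "\<theta> < 1"
     "\<And>t. t \<in> K \<Longrightarrow> cmod (poly r (wave 1 t)) \<le> \<theta>"
    using contracting_polynomial[OF assms(1,2)] by blast
  show ?thesis using assms(4)
  proof (induction N arbitrary: \<eta>)
    case 0
    have "jet_le k K \<eta> (\<lambda>t. poly 1 (wave 1 t) * w t - w t)"
      using 0 by (simp add: jet_le_def higher_vderiv_zero)
    then show ?case by (intro exI[of _ 1]) simp
  next
    case (Suc N)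
    obtain Q where Q: "[:0, 1:] ^ N dvd Q" "jet_le k K (\<eta> / 2) (\<lambda>t. poly Q (wave 1 t) * w t - w t)"
      using Suc.IH[OF half_gt_zero[OF Suc.prems]] by (elim exE conjE) (rule that)
    let ?v = "\<lambda>t. - poly Q (wave 1 t) * w t"
    have v: "smooth ?v"
      using smooth_cmult[OF smooth_mult[OF smooth_poly_wave[of Q 1] assms(3)], of "-1"] by simp
    have sr: "smooth (\<lambda>t. poly r (wave 1 t))" by (rule smooth_poly_wave)
    have "jet_conv k K (\<lambda>l t. of_nat l ^ 0 * poly r (wave 1 t) ^ (l - 0) * ?v t) (\<lambda>t. 0)"
      by (rule jet_conv_powers_zero[OF assms(1) sr r(2,3) _ v]) (rule r(4))
    then have "jet_conv k K (\<lambda>l t. poly r (wave 1 t) ^ l * ?v t) (\<lambda>t. 0)" by simp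
    from jet_conv_eventually[OF this half_gt_zero[OF Suc.prems]
        smooth_mult[OF smooth_power[OF sr] v] smooth_const]
    have "\<forall>\<^sub>F l in sequentially. jet_le k K (\<eta> / 2) (\<lambda>t. poly r (wave 1 t) ^ l * ?v t)"
      by (simp only: diff_zero)
    from eventually_happens'[OF sequentially_bot this]
    obtain l where l: "jet_le k K (\<eta> / 2) (\<lambda>t. poly r (wave 1 t) ^ l * ?v t)" by (elim exE)
    let ?Q = "Q * (1 - r ^ l)"
    have "[:0, 1:] dvd 1 - r ^ l"
      using poly_eq_0_iff_dvd[of "1 - r ^ l" 0] r(1) by (simp add: poly_power)
    with Q(1) have "[:0, 1:] ^ N * [:0, 1:] dvd ?Q" by (rule mult_dvd_mono)
    moreover have "jet_le k K (\<eta> / 2 + \<eta> / 2)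
       (\<lambda>t. (poly Q (wave 1 t) * w t - w t) + poly r (wave 1 t) ^ l * ?v t)"
      by (rule jet_le_add[OF Q(2) l]) (intro smooth_intros smooth_poly_wave assms v sr)+
    moreover have "(\<lambda>t. (poly Q (wave 1 t) * w t - w t) + poly r (wave 1 t) ^ l * ?v t)
       = (\<lambda>t. poly ?Q (wave 1 t) * w t - w t)"
      by (auto simp: poly_power algebra_simps)
    ultimately show ?case by (intro exI[of _ ?Q]) (simp add: mult.commute)
  qed
qed

section \<open>Perturbed integer frequencies\<close>

text \<open>The block \<open>{N<..M}\<close> may start at any \<open>N\<close>, which allows sums to be formed by concatenating blocks
  and, later on, countably many approximation tasks to be served by disjoint blocks.\<close>

definition block_approximable :: "nat \<Rightarrow> real set \<Rightarrow> real \<Rightarrow> (real \<Rightarrow> complex) \<Rightarrow> bool" where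
  "block_approximable k K \<epsilon> h \<longleftrightarrow>
     (\<forall>N. \<forall>\<eta>>0. \<exists>M\<ge>N. \<exists>lam c. (\<forall>n\<in>{N<..M}. \<bar>lam n - of_nat n\<bar> \<le> \<epsilon>) \<and>
        jet_le k K \<eta> (\<lambda>t. (\<Sum>n\<in>{N<..M}. c n * wave (lam n) t) - h t))"

lemma smooth_wave_sum: "smooth (\<lambda>t. \<Sum>n\<in>A. c n * wave (lam n) t)"
  by (intro smooth_intros smooth_wave)

lemma block_approximable_add:
  assumes g: "block_approximable k K \<epsilon> g" and h: "block_approximable k K \<epsilon> h"
    and s: "smooth g" "smooth h"
  shows "block_approximable k K \<epsilon> (\<lambda>t. g t + h t)"
  unfolding block_approximable_def
proof (intro allI impI)
  fix N and \<eta> :: real assume \<eta>: "\<eta> > 0"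
  from g[unfolded block_approximable_def, rule_format, OF half_gt_zero[OF \<eta>], of N]
  obtain M lam c where 1: "N \<le> M" "\<forall>n\<in>{N<..M}. \<bar>lam n - of_nat n\<bar> \<le> \<epsilon>"
    "jet_le k K (\<eta> / 2) (\<lambda>t. (\<Sum>n\<in>{N<..M}. c n * wave (lam n) t) - g t)"
    by (elim exE conjE) (rule that)
  from h[unfolded block_approximable_def, rule_format, OF half_gt_zero[OF \<eta>], of M]
  obtain M' lam' c' where 2: "M \<le> M'" "\<forall>n\<in>{M<..M'}. \<bar>lam' n - of_nat n\<bar> \<le> \<epsilon>"
    "jet_le k K (\<eta> / 2) (\<lambda>t. (\<Sum>n\<in>{M<..M'}. c' n * wave (lam' n) t) - h t)"
    by (elim exE conjE) (rule that)
  let ?lam = "\<lambda>n. if n \<le> M then lam n else lam' n" and ?c = "\<lambda>n. if n \<le> M then c n else c' n"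
  have un: "{N<..M'} = {N<..M} \<union> {M<..M'}" using 1(1) 2(1) by auto
  have sum: "(\<Sum>n\<in>{N<..M'}. ?c n * wave (?lam n) t)
     = (\<Sum>n\<in>{N<..M}. c n * wave (lam n) t) + (\<Sum>n\<in>{M<..M'}. c' n * wave (lam' n) t)" for t
    unfolding un by (subst sum.union_disjoint) (auto intro!: arg_cong2[of _ _ _ _ "(+)"] sum.cong)
  have "jet_le k K (\<eta> / 2 + \<eta> / 2) (\<lambda>t. ((\<Sum>n\<in>{N<..M}. c n * wave (lam n) t) - g t)
      + ((\<Sum>n\<in>{M<..M'}. c' n * wave (lam' n) t) - h t))"
    by (rule jet_le_add[OF 1(3) 2(3)]) (intro smooth_diff smooth_wave_sum s)+
  then have "jet_le k K \<eta> (\<lambda>t. (\<Sum>n\<in>{N<..M'}. ?c n * wave (?lam n) t) - (g t + h t))"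
    unfolding sum by (simp add: algebra_simps)
  moreover have "\<forall>n\<in>{N<..M'}. \<bar>?lam n - of_nat n\<bar> \<le> \<epsilon>" using 1(2) 2(2) by auto
  moreover have "N \<le> M'" using 1(1) 2(1) by simp
  ultimately show "\<exists>M\<ge>N. \<exists>lam c. (\<forall>n\<in>{N<..M}. \<bar>lam n - of_nat n\<bar> \<le> \<epsilon>) \<and>
        jet_le k K \<eta> (\<lambda>t. (\<Sum>n\<in>{N<..M}. c n * wave (lam n) t) - (g t + h t))"
    by (intro exI conjI)
qed

lemma block_approximable_zero: "block_approximable k K \<epsilon> (\<lambda>t. 0)"
  unfolding block_approximable_def
proof (intro allI impI)
  fix N and \<eta> :: real assume "\<eta> > 0"
  then show "\<exists>M\<ge>N. \<exists>lam c. (\<forall>n\<in>{N<..M}. \<bar>lam n - of_nat n\<bar> \<le> \<epsilon>) \<and>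
        jet_le k K \<eta> (\<lambda>t. (\<Sum>n\<in>{N<..M}. c n * wave (lam n) t) - 0)"
    by (intro exI[of _ N]) (auto simp: jet_le_def higher_vderiv_zero)
qed

lemma block_approximable_sum:
  "finite A \<Longrightarrow> (\<And>i. i \<in> A \<Longrightarrow> block_approximable k K \<epsilon> (g i)) \<Longrightarrow> (\<And>i. i \<in> A \<Longrightarrow> smooth (g i)) \<Longrightarrow>
   block_approximable k K \<epsilon> (\<lambda>t. \<Sum>i\<in>A. g i t)"
proof (induction A rule: finite_induct)
  case empty
  show ?case using block_approximable_zero by simp
next
  case (insert a A)
  have "block_approximable k K \<epsilon> (\<lambda>t. g a t + (\<Sum>i\<in>A. g i t))"
    using insert by (intro block_approximable_add smooth_sum) auto
  then show ?case using insert by simp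
qed

lemma block_approximable_limit:
  assumes "smooth h"
    and lim: "\<And>\<eta>. \<eta> > 0 \<Longrightarrow>
      \<exists>h'. smooth h' \<and> block_approximable k K \<epsilon> h' \<and> jet_le k K \<eta> (\<lambda>t. h' t - h t)"
  shows "block_approximable k K \<epsilon> h"
  unfolding block_approximable_def
proof (intro allI impI)
  fix N and \<eta> :: real assume \<eta>: "\<eta> > 0"
  from lim[OF half_gt_zero[OF \<eta>]] obtain h' where h': "smooth h'" "block_approximable k K \<epsilon> h'"
    "jet_le k K (\<eta> / 2) (\<lambda>t. h' t - h t)" by (elim exE conjE) (rule that)
  from h'(2)[unfolded block_approximable_def, rule_format, OF half_gt_zero[OF \<eta>], of N]
  obtain M lam c where 1: "N \<le> M" "\<forall>n\<in>{N<..M}. \<bar>lam n - of_nat n\<bar> \<le> \<epsilon>"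
    "jet_le k K (\<eta> / 2) (\<lambda>t. (\<Sum>n\<in>{N<..M}. c n * wave (lam n) t) - h' t)"
    by (elim exE conjE) (rule that)
  have "jet_le k K (\<eta> / 2 + \<eta> / 2)
     (\<lambda>t. ((\<Sum>n\<in>{N<..M}. c n * wave (lam n) t) - h' t) + (h' t - h t))"
    by (rule jet_le_add[OF 1(3) h'(3)]) (intro smooth_diff smooth_wave_sum h'(1) assms(1))+
  then have "jet_le k K \<eta> (\<lambda>t. (\<Sum>n\<in>{N<..M}. c n * wave (lam n) t) - h t)" by simp
  with 1(1,2) show "\<exists>M\<ge>N. \<exists>lam c. (\<forall>n\<in>{N<..M}. \<bar>lam n - of_nat n\<bar> \<le> \<epsilon>) \<and>
        jet_le k K \<eta> (\<lambda>t. (\<Sum>n\<in>{N<..M}. c n * wave (lam n) t) - h t)"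
    by (intro exI conjI)
qed

text \<open>A polynomial with frequencies in a block that is close to \<open>1\<close>, multiplied by \<open>wave \<delta>\<close>: all its
  frequencies are shifted by \<open>\<delta>\<close>.\<close>

lemma block_approximable_wave:
  assumes "compact K" "K \<inter> \<int> = {}" "\<bar>\<delta>\<bar> \<le> \<epsilon>"
  shows "block_approximable k K \<epsilon> (\<lambda>t. a * wave \<delta> t)"
  unfolding block_approximable_def
proof (intro allI impI)
  fix N and \<eta> :: real assume \<eta>: "\<eta> > 0"
  have "smooth (\<lambda>t. a * wave \<delta> t)" by (intro smooth_intros smooth_wave)
  from high_frequency_unit[OF assms(1,2) this \<eta>, of "Suc N" k]
  obtain Q where Q: "[:0, 1:] ^ Suc N dvd Q"
     "jet_le k K \<eta> (\<lambda>t. poly Q (wave 1 t) * (a * wave \<delta> t) - a * wave \<delta> t)"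
    by (elim exE conjE) (rule that)
  have Q0: "coeff Q i = 0" if "i \<le> N" for i
  proof -
    obtain T where "Q = [:0, 1:] ^ Suc N * T" using Q(1) by (rule dvdE)
    then have "Q = monom 1 (Suc N) * T" by (simp add: monom_altdef)
    then show ?thesis using that by (simp add: coeff_monom_mult)
  qed
  define M where "M = max N (degree Q)"
  have eq: "(\<Sum>n\<in>{N<..M}. (a * coeff Q n) * wave (of_nat n + \<delta>) t) = poly Q (wave 1 t) * (a * wave \<delta> t)" for t
  proof -
    have "poly Q (wave 1 t) = (\<Sum>i\<le>M. coeff Q i * wave 1 t ^ i)"
      unfolding poly_altdef by (rule sum.mono_neutral_left) (auto simp: M_def coeff_eq_0)
    also have "\<dots> = (\<Sum>n\<in>{N<..M}. coeff Q n * wave 1 t ^ n)"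
      by (rule sum.mono_neutral_right) (auto simp: Q0 not_less)
    finally show ?thesis
      by (simp add: sum_distrib_left sum_distrib_right wave_add wave_of_nat mult_ac)
  qed
  show "\<exists>M\<ge>N. \<exists>lam c. (\<forall>n\<in>{N<..M}. \<bar>lam n - of_nat n\<bar> \<le> \<epsilon>) \<and>
        jet_le k K \<eta> (\<lambda>t. (\<Sum>n\<in>{N<..M}. c n * wave (lam n) t) - a * wave \<delta> t)"
    by (rule exI[of _ M], rule conjI, simp add: M_def,
        rule exI[of _ "\<lambda>n. of_nat n + \<delta>"], rule exI[of _ "\<lambda>n. a * coeff Q n"])
       (use Q(2) assms(3) in \<open>simp add: eq\<close>)
qed

lemma block_approximable_poly_wave:
  assumes "compact K" "K \<inter> \<int> = {}" "0 \<le> \<delta>" "of_nat (degree p) * \<delta> \<le> \<epsilon>"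
  shows "block_approximable k K \<epsilon> (\<lambda>t. poly p (wave \<delta> t))"
proof -
  have w: "wave \<delta> t ^ i = wave (of_nat i * \<delta>) t" for i t
    by (simp add: wave_def mult_ac flip: exp_of_nat_mult)
  have "block_approximable k K \<epsilon> (\<lambda>t. coeff p i * wave (of_nat i * \<delta>) t)" if "i \<le> degree p" for i
  proof (rule block_approximable_wave[OF assms(1,2)])
    have "of_nat i * \<delta> \<le> of_nat (degree p) * \<delta>" using that assms(3) by (intro mult_right_mono) auto
    then show "\<bar>of_nat i * \<delta>\<bar> \<le> \<epsilon>" using assms(3,4) by simp
  qed
  then show ?thesis unfolding poly_altdef w
    by (intro block_approximable_sum smooth_intros smooth_wave) auto
qed

text \<open>Polynomials in \<open>wave 1\<close> are periodic; perturbing the frequencies removes this restriction because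
  the difference quotient of \<open>\<delta> \<mapsto> wave \<delta> t\<close> at \<open>0\<close> tends to a multiple of \<open>t\<close>.\<close>

definition wave_quotient :: "real \<Rightarrow> real \<Rightarrow> complex" where
  "wave_quotient \<delta> t = (wave \<delta> t - 1) / (2 * of_real pi * \<i> * of_real \<delta>)"

lemma wave_quotient_has_vector_derivative:
  assumes "\<delta> \<noteq> 0"
  shows "(wave_quotient \<delta> has_vector_derivative wave \<delta> t) (at t)"
proof -
  have "((\<lambda>t. 1 / (2 * of_real pi * \<i> * of_real \<delta>) * (wave \<delta> t - 1)) has_vector_derivative
      1 / (2 * of_real pi * \<i> * of_real \<delta>) * (2 * of_real pi * \<i> * of_real \<delta> * wave \<delta> t - 0)) (at t)"
    by (rule has_vector_derivative_mult_right[OF has_vector_derivative_diff[OF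
            has_vector_derivative_wave has_vector_derivative_const]])
  then show ?thesis using assms by (simp add: wave_quotient_def[abs_def])
qed

lemma smooth_wave_quotient: "smooth (wave_quotient \<delta>)"
proof -
  have "smooth (\<lambda>t. 1 / (2 * of_real pi * \<i> * of_real \<delta>) * (wave \<delta> t - 1))"
    by (intro smooth_intros smooth_wave)
  then show ?thesis by (simp add: wave_quotient_def[abs_def])
qed

lemma wave_minus_1_bound:
  assumes "0 \<le> \<delta>" "\<bar>t\<bar> \<le> R"
  shows "cmod (wave \<delta> t - 1 - 2 * of_real pi * \<i> * of_real \<delta> * of_real t) \<le> (2 * pi * R * \<delta>)\<^sup>2"
proof -
  let ?z = "2 * of_real pi * \<i> * of_real \<delta> * of_real t :: complex"
  have nz: "cmod ?z = 2 * pi * \<delta> * \<bar>t\<bar>" using assms by (simp add: norm_mult)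
  have "cmod (exp ?z - (\<Sum>i\<le>1. ?z ^ i / fact i)) \<le> exp \<bar>Re ?z\<bar> * cmod ?z ^ Suc 1 / fact 1"
    by (rule Taylor_exp)
  then have "cmod (wave \<delta> t - 1 - ?z) \<le> (cmod ?z)\<^sup>2"
    by (simp add: wave_def algebra_simps power2_eq_square)
  also have "\<dots> \<le> (2 * pi * R * \<delta>)\<^sup>2"
    unfolding nz using assms mult_left_mono[OF assms(2), of "2 * pi * \<delta>"]
    by (intro power_mono) (auto simp: mult_ac)

  finally show ?thesis .
qed

lemma jet_conv_const_functions:
  assumes "c \<longlonglongrightarrow> d"
  shows "jet_conv k K (\<lambda>l t. c l) (\<lambda>t. d)"
  unfolding jet_conv_def
proof (intro allI impI)
  fix i
  show "uniform_limit K (\<lambda>l. higher_vderiv i (\<lambda>t. c l)) (higher_vderiv i (\<lambda>t. d)) sequentially"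
  proof (cases i)
    case 0
    show ?thesis unfolding 0 higher_vderiv_0
      by (rule uniform_limitI) (use assms in \<open>auto dest: tendstoD\<close>)
  qed (simp add: higher_vderiv_Suc' higher_vderiv_zero uniform_limit_const)
qed

lemma uniform_limit_bound:
  fixes f :: "nat \<Rightarrow> 'a \<Rightarrow> complex"
  assumes "\<And>l t. t \<in> K \<Longrightarrow> cmod (f l t - g t) \<le> b l" "b \<longlonglongrightarrow> 0"
  shows "uniform_limit K f g sequentially"
proof (rule uniform_limitI)
  fix e :: real assume "e > 0"
  then have "\<forall>\<^sub>F l in sequentially. b l < e" using assms(2) by (auto dest: order_tendstoD(2))
  then show "\<forall>\<^sub>F l in sequentially. \<forall>t\<in>K. dist (f l t) (g t) < e"
    by eventually_elim (auto simp: dist_norm intro: le_less_trans[OF assms(1)])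
qed

abbreviation small_freq :: "nat \<Rightarrow> real" where "small_freq l \<equiv> inverse (of_nat (Suc l))"

lemma jet_conv_wave_small:
  assumes "R \<ge> 0"
  shows "jet_conv k {-R..R} (\<lambda>l. wave (small_freq l)) (\<lambda>t. 1)"
proof (induction k)
  case 0
  show ?case unfolding jet_conv_0
  proof (rule uniform_limit_bound)
    show "cmod (wave (small_freq l) t - 1) \<le> (2 * pi * R * small_freq l)\<^sup>2 + 2 * pi * R * small_freq l"
      if "t \<in> {-R..R}" for l t
    proof -
      let ?z = "2 * of_real pi * \<i> * of_real (small_freq l) * of_real t :: complex"
      have t: "\<bar>t\<bar> \<le> R" using that by auto
      have "cmod ?z = 2 * pi * \<bar>t\<bar> * small_freq l"
        by (simp add: norm_mult norm_inverse mult_ac del: of_nat_Suc)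
      also have "\<dots> \<le> 2 * pi * R * small_freq l" using t by (intro mult_right_mono) auto
      finally have z: "cmod ?z \<le> 2 * pi * R * small_freq l" .
      have "cmod ((wave (small_freq l) t - 1 - ?z) + ?z) \<le> (2 * pi * R * small_freq l)\<^sup>2 + 2 * pi * R * small_freq l"
        by (rule norm_triangle_mono[OF wave_minus_1_bound[OF _ t] z]) simp
      then show ?thesis by simp
    qed
    have "(\<lambda>l. (2 * pi * R * small_freq l)\<^sup>2 + 2 * pi * R * small_freq l) \<longlonglongrightarrow> (2 * pi * R * 0)\<^sup>2 + 2 * pi * R * 0"
      by (intro tendsto_intros LIMSEQ_inverse_real_of_nat)
    then show "(\<lambda>l. (2 * pi * R * small_freq l)\<^sup>2 + 2 * pi * R * small_freq l) \<longlonglongrightarrow> 0" by simp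
  qed
next
  case (Suc k)
  have "(\<lambda>l. 2 * of_real pi * \<i> * complex_of_real (small_freq l)) \<longlonglongrightarrow> 2 * of_real pi * \<i> * of_real 0"
    by (intro tendsto_intros LIMSEQ_inverse_real_of_nat)
  then have c: "jet_conv k {-R..R} (\<lambda>l t. 2 * of_real pi * \<i> * complex_of_real (small_freq l)) (\<lambda>t. 0)"
    by (intro jet_conv_const_functions) simp
  have "jet_conv k {-R..R} (\<lambda>l t. 2 * of_real pi * \<i> * of_real (small_freq l) * wave (small_freq l) t) (\<lambda>t. 0 * 1)"
    by (rule jet_conv_mult[OF compact_Icc c Suc]) (auto intro: smooth_wave)
  moreover have "uniform_limit {-R..R} (\<lambda>l. wave (small_freq l)) (\<lambda>t. 1) sequentially"
    using Suc by (auto simp: jet_conv_def dest: spec[of _ 0])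
  ultimately show ?case unfolding jet_conv_Suc vd_wave by simp
qed

lemma jet_conv_wave_quotient:
  assumes "R \<ge> 0"
  shows "jet_conv k {-R..R} (\<lambda>l. wave_quotient (small_freq l)) complex_of_real"
proof (rule jet_conv_SucD, unfold jet_conv_Suc, rule conjI)
  show "uniform_limit {-R..R} (\<lambda>l. wave_quotient (small_freq l)) complex_of_real sequentially"
  proof (rule uniform_limit_bound)
    show "cmod (wave_quotient (small_freq l) t - of_real t) \<le> 2 * pi * R\<^sup>2 * small_freq l"
      if "t \<in> {-R..R}" for l t
    proof -
      let ?d = "small_freq l"
      let ?c = "2 * of_real pi * \<i> * of_real ?d :: complex"
      have c: "?c \<noteq> 0" "cmod ?c = 2 * pi * ?d" by (auto simp: norm_mult norm_inverse simp del: of_nat_Suc)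
      have "wave_quotient ?d t - of_real t = (wave ?d t - 1 - ?c * of_real t) / ?c"
        using c(1) unfolding wave_quotient_def diff_divide_distrib[of _ "?c * of_real t"] by simp
      then have "cmod (wave_quotient ?d t - of_real t) = cmod (wave ?d t - 1 - ?c * of_real t) / (2 * pi * ?d)"
        unfolding c(2)[symmetric] by (simp only: norm_divide)
      also have "\<dots> \<le> (2 * pi * R * ?d)\<^sup>2 / (2 * pi * ?d)"
        using that by (intro divide_right_mono wave_minus_1_bound) auto
      also have "\<dots> = 2 * pi * R\<^sup>2 * ?d" by (simp add: power2_eq_square field_simps del: of_nat_Suc)
      finally show ?thesis .
    qed
    have "(\<lambda>l. 2 * pi * R\<^sup>2 * small_freq l) \<longlonglongrightarrow> 2 * pi * R\<^sup>2 * 0"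
      by (intro tendsto_intros LIMSEQ_inverse_real_of_nat)
    then show "(\<lambda>l. 2 * pi * R\<^sup>2 * small_freq l) \<longlonglongrightarrow> 0" by simp
  qed
  have "vd (wave_quotient (small_freq l)) = wave (small_freq l)" for l
    by (intro ext vector_derivative_at wave_quotient_has_vector_derivative) simp
  moreover have "vd complex_of_real = (\<lambda>t. 1)"
    by (intro ext vector_derivative_at) (auto intro!: derivative_eq_intros has_vector_derivative_of_real)
  ultimately show "jet_conv k {-R..R} (\<lambda>l. vd (wave_quotient (small_freq l))) (vd complex_of_real)"
    using jet_conv_wave_small[OF assms] by simp
qed

lemma smooth_poly_comp: "smooth f \<Longrightarrow> smooth (\<lambda>t. poly p (f t))"
  unfolding poly_altdef by (intro smooth_intros)

lemma jet_conv_poly: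
  assumes "compact K" "jet_conv k K f g" "\<And>l. smooth (f l)" "smooth g"
  shows "jet_conv k K (\<lambda>l t. poly p (f l t)) (\<lambda>t. poly p (g t))"
proof (induction p)
  case (pCons a p)
  have "jet_conv k K (\<lambda>l t. a + f l t * poly p (f l t)) (\<lambda>t. a + g t * poly p (g t))"
    by (intro jet_conv_add jet_conv_const jet_conv_mult assms pCons smooth_const smooth_mult smooth_poly_comp)
  then show ?case by simp
qed (simp add: jet_conv_const)

text \<open>A polynomial in \<open>t\<close> is a limit of the same polynomial in \<open>wave_quotient \<delta> t\<close>, which is a polynomial in
  \<open>wave \<delta> t\<close> of fixed degree and hence approximable for small \<open>\<delta>\<close>. Weierstrass' theorem with
  derivatives does the rest.\<close>

lemma block_approximable_smooth:
  assumes "compact K" "K \<inter> \<int> = {}" "\<epsilon> > 0" "smooth h"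
  shows "block_approximable k K \<epsilon> h"
proof -
  obtain R' where R': "\<forall>x\<in>K. \<bar>x\<bar> \<le> R'"
    using compact_imp_bounded[OF assms(1)] unfolding bounded_iff by auto
  define R where "R = max R' 0"
  have R: "R \<ge> 0" "K \<subseteq> {-R..R}" using R' by (force simp: R_def)+
  have poly: "block_approximable k K \<epsilon> (\<lambda>t. poly p (of_real t))" for p
  proof (rule block_approximable_limit[OF smooth_poly])
    fix \<eta> :: real assume \<eta>: "\<eta> > 0"
    have "\<forall>\<^sub>F l in sequentially. jet_le k {-R..R} \<eta> (\<lambda>t. poly p (wave_quotient (small_freq l) t) - poly p (of_real t))"
      by (intro jet_conv_eventually jet_conv_poly jet_conv_wave_quotient smooth_poly_comp
          smooth_wave_quotient smooth_ident compact_Icc R \<eta>)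
    moreover have "(\<lambda>l. of_nat (degree p) * small_freq l) \<longlonglongrightarrow> of_nat (degree p) * 0"
      by (intro tendsto_intros LIMSEQ_inverse_real_of_nat)
    then have "\<forall>\<^sub>F l in sequentially. of_nat (degree p) * small_freq l < \<epsilon>"
      using assms(3) by (intro order_tendstoD(2)) simp_all
    ultimately have "\<forall>\<^sub>F l in sequentially.
       jet_le k {-R..R} \<eta> (\<lambda>t. poly p (wave_quotient (small_freq l) t) - poly p (of_real t))
       \<and> of_nat (degree p) * small_freq l < \<epsilon>" by (rule eventually_conj)
    from eventually_happens'[OF sequentially_bot this] obtain l
      where l: "jet_le k {-R..R} \<eta> (\<lambda>t. poly p (wave_quotient (small_freq l) t) - poly p (of_real t))"
       "of_nat (degree p) * small_freq l < \<epsilon>"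
      by (elim exE conjE) (rule that)
    let ?d = "small_freq l"
    let ?c = "2 * of_real pi * \<i> * of_real ?d :: complex"
    let ?q = "pcompose p [:- (1 / ?c), 1 / ?c:]"
    have q: "poly p (wave_quotient ?d t) = poly ?q (wave ?d t)" for t
      by (simp add: poly_pcompose wave_quotient_def diff_divide_distrib)
    have "?c \<noteq> 0" by (simp del: of_nat_Suc)
    then have dq: "degree ?q = degree p" by (simp add: degree_pcompose del: of_nat_Suc)
    have "block_approximable k K \<epsilon> (\<lambda>t. poly ?q (wave ?d t))"
      using l(2) by (intro block_approximable_poly_wave assms(1,2)) (simp_all only: dq, simp_all)
    then have "block_approximable k K \<epsilon> (\<lambda>t. poly p (wave_quotient ?d t))" unfolding q .
    moreover have "jet_le k K \<eta> (\<lambda>t. poly p (wave_quotient ?d t) - poly p (of_real t))"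
      using l(1) order_refl R(2) by (rule jet_le_subset)
    ultimately show "\<exists>h'. smooth h' \<and> block_approximable k K \<epsilon> h' \<and> jet_le k K \<eta> (\<lambda>t. h' t - poly p (of_real t))"
      using smooth_poly_comp[OF smooth_wave_quotient] by (intro exI conjI)
  qed
  show ?thesis
  proof (rule block_approximable_limit[OF assms(4)])
    fix \<eta> :: real assume "\<eta> > 0"
    from smooth_poly_approx[OF R(1) assms(4) this, of k]
    obtain p where p: "jet_le k {-R..R} \<eta> (\<lambda>x. h x - poly p (of_real x))" by (elim exE)
    have "jet_le k K \<eta> (\<lambda>t. poly p (of_real t) - h t)"
      using jet_le_subset[OF p order_refl R(2)] assms(4) smooth_poly[of p]
      by (simp add: jet_le_def higher_vderiv_diff norm_minus_commute)
    with poly[of p] smooth_poly[of p]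
    show "\<exists>h'. smooth h' \<and> block_approximable k K \<epsilon> h' \<and> jet_le k K \<eta> (\<lambda>t. h' t - h t)"
      by (intro exI conjI)
  qed
qed

section \<open>Bumps exhausting the complement of the integers\<close>

definition flat :: "nat \<Rightarrow> real \<Rightarrow> real" where
  "flat n y = (if y > 0 then exp (- 1 / y) / y ^ n else 0)"

lemma flat_tendsto_0: "(flat n \<longlongrightarrow> 0) (at 0)"
proof (rule filterlim_split_at)
  show "(flat n \<longlongrightarrow> 0) (at_left 0)"
    by (rule tendsto_eventually) (auto simp: flat_def eventually_at_filter)
  have "((\<lambda>y. inverse y ^ n / exp (inverse y)) \<longlongrightarrow> (0::real)) (at_right 0)"
    by (rule filterlim_compose[OF tendsto_power_div_exp_0 filterlim_inverse_at_top_right])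
  then show "(flat n \<longlongrightarrow> 0) (at_right 0)"
    by (rule Lim_transform_eventually)
       (auto simp: flat_def eventually_at_filter exp_minus field_simps)
qed

lemma DERIV_flat: "(flat n has_real_derivative (flat (n + 2) y - of_nat n * flat (n + 1) y)) (at y)"
proof (rule linorder_cases[of y 0])
  assume y: "y < 0"
  have "((\<lambda>_. 0) has_real_derivative 0) (at y)" by simp
  then have "(flat n has_real_derivative 0) (at y)"
    by (rule has_field_derivative_transform_within_open[of _ _ _ "{..<0}"]) (use y in \<open>auto simp: flat_def\<close>)
  then show ?thesis using y by (simp add: flat_def)
next
  assume y: "y = 0"
  have "(flat n (0 + h) - flat n 0) / h = flat (Suc n) h" for h
    by (simp add: flat_def)
  then have "(flat n has_real_derivative 0) (at 0)"
    unfolding DERIV_def using flat_tendsto_0[of "Suc n"] by simp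
  then show ?thesis using y by (simp add: flat_def)
next
  assume y: "0 < y"
  have eq: "exp (- 1 / y) * (1 / y\<^sup>2) / y ^ n - exp (- 1 / y) * (of_nat n * y ^ (n - 1)) / (y ^ n * y ^ n)
      = flat (n + 2) y - of_nat n * flat (n + 1) y"
    using y by (cases n) (auto simp: flat_def field_simps power_add power2_eq_square)
  have "((\<lambda>y. exp (- 1 / y) / y ^ n) has_real_derivative
     exp (- 1 / y) * (1 / y\<^sup>2) / y ^ n - exp (- 1 / y) * (of_nat n * y ^ (n - 1)) / (y ^ n * y ^ n)) (at y)"
    using y by (auto intro!: derivative_eq_intros simp: field_simps power2_eq_square)
  then have "(flat n has_real_derivative
     exp (- 1 / y) * (1 / y\<^sup>2) / y ^ n - exp (- 1 / y) * (of_nat n * y ^ (n - 1)) / (y ^ n * y ^ n)) (at y)"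
    by (rule has_field_derivative_transform_within_open[of _ _ _ "{0<..}"]) (use y in \<open>auto simp: flat_def\<close>)
  then show ?thesis unfolding eq .
qed

text \<open>The class of the functions \<open>flat n\<close> is closed under differentiation up to linear combinations, so the
  number of derivatives can be raised for all \<open>n\<close> at once.\<close>

lemma smooth_flat:
  assumes "smooth W" "\<And>x. Im (W x) = 0"
  shows "smooth (\<lambda>x. of_real (flat n (Re (W x))))"
proof -
  have dRe: "((\<lambda>x. Re (W x)) has_real_derivative Re (vd W x)) (at x)" for x
    using has_derivative_Re[OF smooth_has_vd[OF assms(1), unfolded has_vector_derivative_def], of x]
    by (simp add: has_field_derivative_def mult_commute_abs)
  have "((\<lambda>x. Im (W x)) has_real_derivative Im (vd W x)) (at x)" for x
    using has_derivative_Im[OF smooth_has_vd[OF assms(1), unfolded has_vector_derivative_def], of x]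
    by (simp add: has_field_derivative_def mult_commute_abs)
  then have dIm: "((\<lambda>x. 0) has_real_derivative Im (vd W x)) (at x)" for x
    by (simp add: assms(2))
  have "Im (vd W x) = 0" for x
    by (rule DERIV_unique[OF dIm DERIV_const])
  then have vdW: "vd W x = of_real (Re (vd W x))" for x by (simp add: complex_eq_iff)
  have "diff_times k (\<lambda>x. of_real (flat n (Re (W x))))" for k
  proof (induction k arbitrary: n)
    case (Suc k)
    let ?d = "\<lambda>x. (of_real (flat (n + 2) (Re (W x))) + - of_nat n * of_real (flat (n + 1) (Re (W x)))) * vd W x"
    have "((\<lambda>x. complex_of_real (flat n (Re (W x)))) has_vector_derivative ?d x) (at x)" for x
    proof -
      have "((\<lambda>x. flat n (Re (W x))) has_real_derivative
         (flat (n + 2) (Re (W x)) - of_nat n * flat (n + 1) (Re (W x))) * Re (vd W x)) (at x)"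
        by (rule DERIV_chain2[OF DERIV_flat dRe])
      from has_vector_derivative_of_real[OF this] show ?thesis by (subst vdW) simp
    qed
    moreover have "diff_times k ?d"
      using smooth_vd[OF assms(1)] unfolding smooth_iff
      by (intro diff_times_mult diff_times_add diff_times_const Suc) blast
    ultimately show ?case by (rule diff_times_SucI)
  qed simp
  then show ?thesis by (simp add: smooth_iff)
qed

text \<open>This is \<open>sin\<^sup>2 (\<pi> x)\<close>.\<close>

definition integer_gap :: "real \<Rightarrow> real" where
  "integer_gap x = (1 - cos (2 * pi * x)) / 2"

lemma wave_cis: "wave a t = cis (2 * pi * a * t)"
  by (simp add: wave_def cis_conv_exp mult_ac)

lemma integer_gap_wave: "complex_of_real (integer_gap x) = 1 / 2 + (- 1 / 4) * (wave 1 x + wave (- 1) x)"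
  by (simp add: integer_gap_def wave_cis complex_eq_iff)

lemma integer_gap_bounds: "0 \<le> integer_gap x" "integer_gap x \<le> 1"
  by (auto simp: integer_gap_def)

lemma integer_gap_eq_0_iff: "integer_gap x = 0 \<longleftrightarrow> x \<in> \<int>"
proof -
  have "integer_gap x = 0 \<longleftrightarrow> cos (2 * pi * x) = 1" by (simp add: integer_gap_def)
  also have "\<dots> \<longleftrightarrow> wave 1 x = 1"
  proof
    assume c: "cos (2 * pi * x) = 1"
    then have "sin (2 * pi * x) = 0" using sin_cos_squared_add[of "2 * pi * x"] by simp
    with c show "wave 1 x = 1" by (simp add: wave_cis complex_eq_iff)
  qed (simp add: wave_cis complex_eq_iff)
  finally show ?thesis by (simp add: wave_1_eq_1_iff)
qed

text \<open>The \<open>j\<close>-th bump is supported where \<open>(1 + x\<^sup>2) / integer_gap x\<close> lies between \<open>j + 1\<close> and \<open>j + 3\<close>. That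
  quotient exceeds \<open>1\<close> off the integers and tends to infinity at the integers and at infinity, so the
  supports are compact subsets of the complement of the integers, the bumps cover it, and only
  neighbours overlap. The product of two factors expresses the condition without dividing by
  \<open>integer_gap\<close>.\<close>

definition bump :: "nat \<Rightarrow> real \<Rightarrow> complex" where
  "bump j x = of_real (flat 0 (((of_nat j + 3) * integer_gap x - (1 + x\<^sup>2))
                              * ((1 + x\<^sup>2) - (of_nat j + 1) * integer_gap x)))"

definition bump_core :: "nat \<Rightarrow> real set" where
  "bump_core j = {x. 1 + x\<^sup>2 \<le> (of_nat j + 3) * integer_gap x}"

lemma smooth_bump: "smooth (bump j)"
proof -
  let ?S = "\<lambda>x. 1 / 2 + (- 1 / 4) * (wave 1 x + wave (- 1) x)"
  let ?T = "\<lambda>x. 1 + complex_of_real x ^ 2"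
  let ?W = "\<lambda>x. ((of_nat j + 3) * ?S x - ?T x) * (?T x - (of_nat j + 1) * ?S x)"
  have W: "?W x = of_real (((of_nat j + 3) * integer_gap x - (1 + x\<^sup>2))
                              * ((1 + x\<^sup>2) - (of_nat j + 1) * integer_gap x))" for x
    unfolding integer_gap_wave[symmetric] by simp
  have "smooth (\<lambda>x. of_real (flat 0 (Re (?W x))))"
  proof (rule smooth_flat)
    show "smooth ?W" by (intro smooth_intros smooth_wave)
    show "Im (?W x) = 0" for x unfolding W Im_complex_of_real ..
  qed
  then show ?thesis unfolding W Re_complex_of_real by (simp add: bump_def[abs_def])
qed

lemma bump_nonneg: "0 \<le> Re (bump j x)" "Im (bump j x) = 0"
  by (auto simp: bump_def flat_def)

lemma bump_nonzero_iff:
  "bump j x \<noteq> 0 \<longleftrightarrow> (of_nat j + 1) * integer_gap x < 1 + x\<^sup>2 \<and> 1 + x\<^sup>2 < (of_nat j + 3) * integer_gap x"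
proof -
  have "(of_nat j + 1) * integer_gap x \<le> (of_nat j + 3) * integer_gap x"
    using integer_gap_bounds(1) by (intro mult_right_mono) auto
  then show ?thesis by (auto simp: bump_def flat_def zero_less_mult_iff)
qed

lemma bump_zero_off_core: "x \<notin> bump_core j \<Longrightarrow> bump j x = 0"
  using bump_nonzero_iff[of j x] by (auto simp: bump_core_def)

lemma bump_core_mono: "i \<le> j \<Longrightarrow> bump_core i \<subseteq> bump_core j"
  unfolding bump_core_def using integer_gap_bounds(1)
  by (auto elim!: order_trans intro!: mult_right_mono)

lemma continuous_integer_gap: "continuous_on A integer_gap"
  unfolding integer_gap_def[abs_def] by (auto intro!: continuous_intros)

lemma compact_bump_core: "compact (bump_core j)"
proof -
  have "closed (bump_core j)"
    unfolding bump_core_def by (intro closed_Collect_le continuous_intros continuous_integer_gap)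
  moreover have "bump_core j \<subseteq> {- (of_nat j + 3)..of_nat j + 3}"
  proof
    fix x assume "x \<in> bump_core j"
    then have "1 + x\<^sup>2 \<le> (of_nat j + 3) * integer_gap x" by (simp add: bump_core_def)
    also have "\<dots> \<le> of_nat j + 3" using integer_gap_bounds[of x] by (simp add: mult_left_le)
    finally have "x\<^sup>2 \<le> 1 * (of_nat j + 3)" by simp
    also have "\<dots> \<le> (of_nat j + 3) * (of_nat j + 3 :: real)"
      by (intro mult_right_mono) auto
    finally have "x\<^sup>2 \<le> (of_nat j + 3) * (of_nat j + 3)" .
    then have "\<bar>x\<bar> \<le> of_nat j + 3"
      using abs_le_square_iff[of x "of_nat j + 3"] by (simp add: power2_eq_square)
    then show "x \<in> {- (of_nat j + 3)..of_nat j + 3}" by auto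
  qed
  ultimately show ?thesis by (meson bounded_closed_interval bounded_subset compact_eq_bounded_closed)
qed

lemma bump_core_Ints: "bump_core j \<inter> \<int> = {}"
proof -
  have "x \<notin> bump_core j" if "x \<in> \<int>" for x
  proof -
    have "1 + x\<^sup>2 > 0" by (simp add: add_pos_nonneg)
    then show ?thesis using that integer_gap_eq_0_iff[of x] by (simp add: bump_core_def)
  qed
  then show ?thesis by blast
qed

lemma bump_mult_zero:
  assumes "i + 2 \<le> j" shows "bump i x * bump j x = 0"
proof (rule ccontr)
  assume "bump i x * bump j x \<noteq> 0"
  then have "(of_nat j + 1) * integer_gap x < 1 + x\<^sup>2" "1 + x\<^sup>2 < (of_nat i + 3) * integer_gap x"
    using bump_nonzero_iff by auto
  moreover have "(of_nat i + 3) * integer_gap x \<le> (of_nat j + 1) * integer_gap x"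
    using assms integer_gap_bounds(1) by (intro mult_right_mono) auto
  ultimately show False by linarith
qed

lemma bumps_cover:
  assumes "x \<notin> \<int>" shows "\<exists>j. bump j x \<noteq> 0"
proof -
  have g: "0 < integer_gap x" using integer_gap_bounds(1)[of x] integer_gap_eq_0_iff[of x] assms by auto
  have x2: "0 < x\<^sup>2" using assms by auto
  define r where "r = (1 + x\<^sup>2) / integer_gap x"
  have "integer_gap x < 1 + x\<^sup>2" using integer_gap_bounds(2)[of x] x2 by linarith
  then have r: "1 < r" using g by (simp add: r_def)
  define j where "j = nat (\<lceil>r\<rceil> - 2)"
  have "2 \<le> \<lceil>r\<rceil>" using r by linarith
  then have j: "real j = of_int \<lceil>r\<rceil> - 2" by (simp add: j_def)
  have "of_nat j + 1 < r" "r < of_nat j + 3" unfolding j by linarith+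
  then have "bump j x \<noteq> 0" unfolding bump_nonzero_iff using g by (simp add: r_def field_simps)
  then show ?thesis ..
qed

lemma bump_in_test_functions: "bump j \<in> test_functions"
  by (rule test_functionsI[OF smooth_bump compact_bump_core]) (rule bump_zero_off_core)

section \<open>Series and limits in the Schwartz space\<close>

lemma schwartz_add:
  assumes "f \<in> schwartz" "g \<in> schwartz"
  shows "(\<lambda>x. f x + g x) \<in> schwartz"
    and "schwartz_seminorm n k (\<lambda>x. f x + g x) \<le> schwartz_seminorm n k f + schwartz_seminorm n k g"
proof -
  have s: "smooth f" "smooth g" using assms by (auto intro: schwartz_smooth)
  have b: "(1 + \<bar>x\<bar>) ^ n * cmod (higher_vderiv k (\<lambda>x. f x + g x) x)
       \<le> schwartz_seminorm n k f + schwartz_seminorm n k g" for n k x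
  proof -
    have "(1 + \<bar>x\<bar>) ^ n * cmod (higher_vderiv k (\<lambda>x. f x + g x) x)
       \<le> (1 + \<bar>x\<bar>) ^ n * (cmod (higher_vderiv k f x) + cmod (higher_vderiv k g x))"
      unfolding higher_vderiv_add[OF s] by (intro mult_left_mono norm_triangle_ineq) simp
    then show ?thesis
      using schwartz_seminorm_upper[OF assms(1), of x n k] schwartz_seminorm_upper[OF assms(2), of x n k]
      by (simp add: distrib_left)
  qed
  show "(\<lambda>x. f x + g x) \<in> schwartz" using s b by (intro schwartzI smooth_add) blast+
  show "schwartz_seminorm n k (\<lambda>x. f x + g x) \<le> schwartz_seminorm n k f + schwartz_seminorm n k g"
    by (rule schwartz_seminorm_le[OF b])
qed

lemma schwartz_cmult:
  assumes "f \<in> schwartz"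
  shows "(\<lambda>x. c * f x) \<in> schwartz"
    and "schwartz_seminorm n k (\<lambda>x. c * f x) \<le> cmod c * schwartz_seminorm n k f"
proof -
  have s: "smooth f" using assms by (rule schwartz_smooth)
  have b: "(1 + \<bar>x\<bar>) ^ n * cmod (higher_vderiv k (\<lambda>x. c * f x) x) \<le> cmod c * schwartz_seminorm n k f" for n k x
    using mult_left_mono[OF schwartz_seminorm_upper[OF assms, of x n k], of "cmod c"]
    by (simp add: higher_vderiv_cmult[OF s] norm_mult mult_ac)
  show "(\<lambda>x. c * f x) \<in> schwartz" using s b by (intro schwartzI smooth_cmult) blast+
  show "schwartz_seminorm n k (\<lambda>x. c * f x) \<le> cmod c * schwartz_seminorm n k f"
    by (rule schwartz_seminorm_le[OF b])
qed

lemma schwartz_zero: "(\<lambda>x. 0) \<in> schwartz"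
  by (rule schwartzI) (auto simp: higher_vderiv_zero)

lemma schwartz_sum: "(\<And>i. i \<in> A \<Longrightarrow> f i \<in> schwartz) \<Longrightarrow> (\<lambda>x. \<Sum>i\<in>A. f i x) \<in> schwartz"
  by (induction A rule: infinite_finite_induct) (auto intro: schwartz_add schwartz_zero)

lemma schwartz_diff:
  assumes "f \<in> schwartz" "g \<in> schwartz" shows "(\<lambda>x. f x - g x) \<in> schwartz"
  using schwartz_add(1)[OF assms(1) schwartz_cmult(1)[OF assms(2), of "-1"]] by simp

lemma schwartz_shift:
  assumes "f \<in> schwartz" shows "(\<lambda>x. f (x - a)) \<in> schwartz"
proof (rule schwartzI)
  have s: "smooth f" using assms by (rule schwartz_smooth)
  then show "smooth (\<lambda>x. f (x - a))" by (rule smooth_shift)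
  show "\<exists>B. \<forall>x. (1 + \<bar>x\<bar>) ^ n * cmod (higher_vderiv k (\<lambda>x. f (x - a)) x) \<le> B" for n k
  proof (intro exI allI)
    fix x
    have "1 + \<bar>x\<bar> \<le> 1 + (\<bar>x - a\<bar> + \<bar>a\<bar>)" by simp
    also have "\<dots> \<le> (1 + \<bar>a\<bar>) * (1 + \<bar>x - a\<bar>)" by (simp add: algebra_simps)
    finally have "(1 + \<bar>x\<bar>) ^ n \<le> ((1 + \<bar>a\<bar>) * (1 + \<bar>x - a\<bar>)) ^ n" by (intro power_mono) auto
    then have "(1 + \<bar>x\<bar>) ^ n * cmod (higher_vderiv k f (x - a))
       \<le> ((1 + \<bar>a\<bar>) * (1 + \<bar>x - a\<bar>)) ^ n * cmod (higher_vderiv k f (x - a))"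
      by (intro mult_right_mono) auto
    also have "\<dots> = (1 + \<bar>a\<bar>) ^ n * ((1 + \<bar>x - a\<bar>) ^ n * cmod (higher_vderiv k f (x - a)))"
      by (simp add: power_mult_distrib)
    also have "\<dots> \<le> (1 + \<bar>a\<bar>) ^ n * schwartz_seminorm n k f"
      by (intro mult_left_mono schwartz_seminorm_upper[OF assms]) simp
    finally show "(1 + \<bar>x\<bar>) ^ n * cmod (higher_vderiv k (\<lambda>x. f (x - a)) x)
       \<le> (1 + \<bar>a\<bar>) ^ n * schwartz_seminorm n k f"
      unfolding higher_vderiv_shift[OF s] .
  qed
qed

text \<open>Completeness of the Schwartz space, in the form needed for absolutely convergent series.\<close>

lemma schwartz_series:
  assumes g: "\<And>j. g j \<in> schwartz" and sum: "\<And>n k. summable (\<lambda>j. schwartz_seminorm n k (g j))"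
  shows "(\<lambda>x. \<Sum>j. g j x) \<in> schwartz"
    and "schwartz_seminorm n k (\<lambda>x. \<Sum>j. g j x) \<le> (\<Sum>j. schwartz_seminorm n k (g j))"
    and "summable (\<lambda>j. g j x)"
proof -
  define F where "F = (\<lambda>k x. \<Sum>j. higher_vderiv k (g j) x)"
  have sm: "smooth (g j)" for j using g by (rule schwartz_smooth)
  have bnd: "cmod (higher_vderiv k (g j) x) \<le> schwartz_seminorm 0 k (g j)" for k j x
    using schwartz_seminorm_upper[OF g, of x 0 k j] by simp
  have summ: "summable (\<lambda>j. higher_vderiv k (g j) x)" for k x
    by (rule summable_comparison_test'[OF sum[of 0 k], of 0]) (rule bnd)
  show "summable (\<lambda>j. g j x)" using summ[of 0 x] by simp
  have unif: "uniform_limit UNIV (\<lambda>n x. \<Sum>j<n. higher_vderiv k (g j) x) (F k) sequentially" for k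
    unfolding F_def by (rule Weierstrass_m_test[OF bnd sum])
  have dF: "(F k has_vector_derivative F (Suc k) x) (at x)" for k x
  proof -
    have "\<exists>G. \<forall>x\<in>UNIV. (\<lambda>n. higher_vderiv k (g n) x) sums G x \<and>
        (G has_derivative (\<lambda>h. h *\<^sub>R F (Suc k) x)) (at x within UNIV)"
    proof (rule has_derivative_series)
      show "(higher_vderiv k (g n) has_derivative (\<lambda>h. h *\<^sub>R higher_vderiv (Suc k) (g n) x)) (at x within UNIV)" for n x
        unfolding higher_vderiv_Suc has_vector_derivative_def[symmetric]
        by (rule smooth_has_vd[OF smooth_higher_vderiv[OF sm]])
      show "\<forall>\<^sub>F n in sequentially. \<forall>x\<in>UNIV. \<forall>h. norm ((\<Sum>i<n. h *\<^sub>R higher_vderiv (Suc k) (g i) x) - h *\<^sub>R F (Suc k) x) \<le> e * norm h"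
        if "e > 0" for e
        using uniform_limitD[OF unif[of "Suc k"] that]
      proof eventually_elim
        case (elim n)
        show ?case
        proof (intro ballI allI)
          fix x and h :: real
          have "cmod ((\<Sum>i<n. higher_vderiv (Suc k) (g i) x) - F (Suc k) x) \<le> e"
            using elim by (simp add: dist_norm less_imp_le)
          then have "\<bar>h\<bar> * cmod ((\<Sum>i<n. higher_vderiv (Suc k) (g i) x) - F (Suc k) x) \<le> \<bar>h\<bar> * e"
            by (rule mult_left_mono) simp
          then show "norm ((\<Sum>i<n. h *\<^sub>R higher_vderiv (Suc k) (g i) x) - h *\<^sub>R F (Suc k) x) \<le> e * norm h"
            by (simp add: mult.commute flip: scaleR_sum_right scaleR_diff_right)
        qed
      qed
      show "(\<lambda>n. higher_vderiv k (g n) 0) sums F k 0"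
        unfolding F_def by (rule summable_sums[OF summ])
    qed auto
    then obtain G where G: "\<And>x. (\<lambda>n. higher_vderiv k (g n) x) sums G x"
      "\<And>x. (G has_derivative (\<lambda>h. h *\<^sub>R F (Suc k) x)) (at x)" by auto
    have "G = F k" using G(1) unfolding F_def by (auto dest: sums_unique)
    with G(2) show ?thesis by (simp add: has_vector_derivative_def)
  qed
  have hF: "higher_vderiv k (\<lambda>x. \<Sum>j. g j x) = F k" for k
  proof (induction k)
    case (Suc k)
    show ?case unfolding higher_vderiv_Suc Suc by (intro ext vector_derivative_at dF)
  qed (simp add: F_def)
  have bound: "(1 + \<bar>x\<bar>) ^ n * cmod (higher_vderiv k (\<lambda>x. \<Sum>j. g j x) x) \<le> (\<Sum>j. schwartz_seminorm n k (g j))"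
    for n k x
  proof -
    have s: "summable (\<lambda>j. cmod (higher_vderiv k (g j) x))"
      by (rule summable_comparison_test'[OF sum[of 0 k], of 0]) (simp add: bnd)
    have "(1 + \<bar>x\<bar>) ^ n * cmod (F k x) \<le> (1 + \<bar>x\<bar>) ^ n * (\<Sum>j. cmod (higher_vderiv k (g j) x))"
      unfolding F_def by (intro mult_left_mono summable_norm s) simp
    also have "\<dots> = (\<Sum>j. (1 + \<bar>x\<bar>) ^ n * cmod (higher_vderiv k (g j) x))"
      by (rule suminf_mult[OF s, symmetric])
    also have "\<dots> \<le> (\<Sum>j. schwartz_seminorm n k (g j))"
      by (intro suminf_le schwartz_seminorm_upper g summable_mult s sum)
    finally show ?thesis unfolding hF .
  qed
  show "(\<lambda>x. \<Sum>j. g j x) \<in> schwartz"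
  proof (rule schwartzI)
    show "smooth (\<lambda>x. \<Sum>j. g j x)"
      unfolding smooth_def hF using dF by (blast intro: differentiableI_vector)
  qed (use bound in blast)
  show "schwartz_seminorm n k (\<lambda>x. \<Sum>j. g j x) \<le> (\<Sum>j. schwartz_seminorm n k (g j))"
    by (rule schwartz_seminorm_le[OF bound])
qed

text \<open>It suffices to treat the subbasic open sets, and for them the triangle inequality.\<close>

lemma eventually_in_schwartz_open:
  assumes "generate_topology_on
      {{g \<in> schwartz. p (g - f) < e} | f p e. f \<in> schwartz \<and> p \<in> {schwartz_seminorm n k | n k. True} \<and> e > 0} U"
    and g: "\<And>l. g l \<in> schwartz" "h \<in> schwartz" "h \<in> U"
    and lim: "\<And>n k. (\<lambda>l. schwartz_seminorm n k (\<lambda>x. g l x - h x)) \<longlonglongrightarrow> 0"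
  shows "\<forall>\<^sub>F l in sequentially. g l \<in> U"
  using assms(1) g(3)
proof (induction rule: generate_topology_on.induct)
  case (Int a b)
  then show ?case by (auto intro: eventually_conj)
next
  case (UN K)
  then obtain k where "k \<in> K" "h \<in> k" by blast
  with UN.IH have "\<forall>\<^sub>F l in sequentially. g l \<in> k" by blast
  then show ?case by eventually_elim (use \<open>k \<in> K\<close> in blast)
next
  case (Basis s)
  then obtain f n k e where s: "s = {g \<in> schwartz. schwartz_seminorm n k (g - f) < e}" "f \<in> schwartz" "e > 0"
    by auto
  have "schwartz_seminorm n k (h - f) < e" using Basis s by simp
  then have "\<forall>\<^sub>F l in sequentially. schwartz_seminorm n k (\<lambda>x. g l x - h x) < e - schwartz_seminorm n k (h - f)"
    using lim[of n k] by (intro order_tendstoD(2)) auto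
  then show ?case
  proof eventually_elim
    case (elim l)
    have "g l - f = (\<lambda>x. (g l x - h x) + (h - f) x)" by (simp add: fun_eq_iff)
    moreover have "h - f \<in> schwartz" using schwartz_diff[OF g(2) s(2)] by (simp add: fun_diff_def)
    ultimately have "schwartz_seminorm n k (g l - f) < e"
      using schwartz_add(2)[OF schwartz_diff[OF g(1,2)], of "h - f" n k l] elim by simp
    then show ?case using s(1) g(1) by simp
  qed
qed auto

lemma temperate_distribution_sequential:
  assumes \<alpha>: "temperate_distribution \<alpha>" and g: "\<And>l. g l \<in> schwartz" "h \<in> schwartz"
    and lim: "\<And>n k. (\<lambda>l. schwartz_seminorm n k (\<lambda>x. g l x - h x)) \<longlonglongrightarrow> 0"
  shows "(\<lambda>l. \<alpha> (g l)) \<longlonglongrightarrow> \<alpha> h"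
proof (rule topological_tendstoI)
  fix S assume S: "open S" "\<alpha> h \<in> S"
  let ?U = "{f \<in> topspace schwartz_topology. \<alpha> f \<in> S}"
  have top: "schwartz \<subseteq> topspace schwartz_topology"
  proof
    fix f assume f: "f \<in> schwartz"
    have "schwartz_seminorm 0 0 (f - f) \<le> 0"
      by (rule schwartz_seminorm_le) (simp add: fun_diff_def)
    then have "f \<in> {g \<in> schwartz. schwartz_seminorm 0 0 (g - f) < 1}" using f by simp
    then show "f \<in> topspace schwartz_topology"
      unfolding schwartz_topology_def seminorm_topology_def topology_generated_by_topspace
      using f zero_less_one by blast
  qed
  have "openin schwartz_topology ?U"
    using \<alpha> S(1) unfolding temperate_distribution_def continuous_map_def by (simp add: open_openin[symmetric])
  then have U: "generate_topology_on
      {{g \<in> schwartz. p (g - f) < e} | f p e. f \<in> schwartz \<and> p \<in> {schwartz_seminorm n k | n k. True} \<and> e > 0} ?U"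
    unfolding schwartz_topology_def seminorm_topology_def by (rule openin_topology_generated_by)
  have "\<forall>\<^sub>F l in sequentially. g l \<in> ?U"
    by (rule eventually_in_schwartz_open[OF U g _ lim]) (use S(2) g(2) top in auto)
  then show "\<forall>\<^sub>F l in sequentially. \<alpha> (g l) \<in> S" by eventually_elim simp
qed

lemma linear_functional_sum:
  assumes "linear_functional_on schwartz \<alpha>" "finite A" "\<And>i. i \<in> A \<Longrightarrow> f i \<in> schwartz"
  shows "\<alpha> (\<lambda>x. \<Sum>i\<in>A. c i * f i x) = (\<Sum>i\<in>A. c i * \<alpha> (f i))"
proof -
  have add: "\<alpha> (\<lambda>x. f x + g x) = \<alpha> f + \<alpha> g" if "f \<in> schwartz" "g \<in> schwartz" for f g
    using assms(1) that unfolding linear_functional_on_def plus_fun_def by blast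
  have scale: "\<alpha> (\<lambda>x. c * f x) = c * \<alpha> f" if "f \<in> schwartz" for f c
    using assms(1) that unfolding linear_functional_on_def cscale_def by blast
  have zero: "\<alpha> (\<lambda>x. 0) = 0" using scale[OF schwartz_zero, of 0] by simp
  show ?thesis using assms(2,3)
  proof (induction A rule: finite_induct)
    case (insert a A)
    have "(\<lambda>x. \<Sum>i\<in>A. c i * f i x) \<in> schwartz"
      using insert by (intro schwartz_sum schwartz_cmult) auto
    then show ?case using insert by (simp add: add scale schwartz_cmult)
  qed (simp add: zero)
qed

section \<open>Separation in a seminormed space\<close>

text \<open>Homogeneity refers to nonnegative real scalars. The Hahn-Banach theorem is obtained from the fact
  that a minimal sublinear functional is linear; in this form Zorn's lemma applies to functionals on all
  of \<open>V\<close>, and no extension of partially defined functionals occurs.\<close>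

definition sublinear_on :: "(real \<Rightarrow> complex) set \<Rightarrow> ((real \<Rightarrow> complex) \<Rightarrow> real) \<Rightarrow> bool" where
  "sublinear_on V q \<longleftrightarrow>
     (\<forall>x\<in>V. \<forall>y\<in>V. q (x + y) \<le> q x + q y) \<and>
     (\<forall>r\<ge>0. \<forall>x\<in>V. q (cscale (of_real r) x) = r * q x)"

context
  fixes V :: "(real \<Rightarrow> complex) set"
  assumes V: "cfun.subspace V"
begin

lemma V_closed:
  "x \<in> V \<Longrightarrow> y \<in> V \<Longrightarrow> x + y \<in> V" "x \<in> V \<Longrightarrow> cscale c x \<in> V" "0 \<in> V"
  "x \<in> V \<Longrightarrow> - x \<in> V" "x \<in> V \<Longrightarrow> y \<in> V \<Longrightarrow> x - y \<in> V"
  using V by (auto intro: cfun.subspace_add cfun.subspace_scale cfun.subspace_0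
      cfun.subspace_neg cfun.subspace_diff)

lemma sublinear_0: "sublinear_on V q \<Longrightarrow> q 0 = 0"
proof -
  assume "sublinear_on V q"
  then have "q (cscale (of_real 0) 0) = 0 * q 0"
    using V_closed(3) unfolding sublinear_on_def by blast
  then show ?thesis by simp
qed

lemma sublinear_minus:
  assumes "sublinear_on V q" "x \<in> V"
  shows "- q (- x) \<le> q x"
proof -
  have "q (x + - x) \<le> q x + q (- x)"
    using assms V_closed(4)[OF assms(2)] unfolding sublinear_on_def by blast
  then show ?thesis using sublinear_0[OF assms(1)] by simp
qed

text \<open>Applied to \<open>1 / r\<close>, the inequality for positive scalars gives its own converse.\<close>

lemma sublinear_onI:
  assumes "\<And>x y. x \<in> V \<Longrightarrow> y \<in> V \<Longrightarrow> q (x + y) \<le> q x + q y" "q 0 = 0"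
    "\<And>r x. r > 0 \<Longrightarrow> x \<in> V \<Longrightarrow> q (cscale (of_real r) x) \<le> r * q x"
  shows "sublinear_on V q"
  unfolding sublinear_on_def
proof (intro conjI ballI allI impI)
  fix r :: real and x assume r: "0 \<le> r" and x: "x \<in> V"
  show "q (cscale (of_real r) x) = r * q x"
  proof (cases "r = 0")
    case False
    then have r: "r > 0" using r by simp
    have "q x = q (cscale (of_real (1 / r)) (cscale (of_real r) x))"
      using r by (simp add: cfun.scale_scale)
    also have "\<dots> \<le> 1 / r * q (cscale (of_real r) x)"
      using r by (intro assms(3) V_closed x) auto
    finally have "r * q x \<le> q (cscale (of_real r) x)" using r by (simp add: field_simps)
    with assms(3)[OF r x] show ?thesis by simp
  qed (simp add: assms(2))
qed (rule assms(1))

text \<open>The largest sublinear functional below \<open>q\<close> whose value at \<open>- y\<close> is at most \<open>- q y\<close>. It shows that a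
  minimal functional is odd, and it prescribes the value of the separating functional at one point.\<close>

definition lower_along :: "(real \<Rightarrow> complex) \<Rightarrow> ((real \<Rightarrow> complex) \<Rightarrow> real) \<Rightarrow> (real \<Rightarrow> complex) \<Rightarrow> real" where
  "lower_along y q x = (if x \<in> V then INF t\<in>{0..}. q (x + cscale (of_real t) y) - t * q y else 0)"

lemma lower_along:
  assumes q: "sublinear_on V q" and y: "y \<in> V"
  shows "sublinear_on V (lower_along y q)"
    and "x \<in> V \<Longrightarrow> lower_along y q x \<le> q x"
    and "lower_along y q (- y) \<le> - q y"
proof -
  let ?S = "\<lambda>x. (\<lambda>t. q (x + cscale (of_real t) y) - t * q y) ` {0..}"
  have add: "q (x + z) \<le> q x + q z" if "x \<in> V" "z \<in> V" for x z
    using q that by (simp add: sublinear_on_def)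
  have hom: "q (cscale (of_real r) x) = r * q x" if "x \<in> V" "r \<ge> 0" for x r
    using q that by (simp add: sublinear_on_def)
  have bdd: "bdd_below (?S x)" if "x \<in> V" for x
  proof (rule bdd_belowI2)
    fix t :: real assume "t \<in> {0..}"
    then have "t * q y = q (cscale (of_real t) y)" using hom y by simp
    also have "cscale (of_real t) y = (x + cscale (of_real t) y) + - x" by simp
    also have "q \<dots> \<le> q (x + cscale (of_real t) y) + q (- x)"
      by (rule add; intro V_closed that y)
    finally show "- q (- x) \<le> q (x + cscale (of_real t) y) - t * q y" by simp
  qed
  have le: "lower_along y q x \<le> q (x + cscale (of_real t) y) - t * q y" if "x \<in> V" "t \<ge> 0" for x t
    unfolding lower_along_def using that bdd by (auto intro!: cINF_lower)
  have ge: "c \<le> lower_along y q x"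
    if "x \<in> V" "\<And>t. t \<ge> 0 \<Longrightarrow> c \<le> q (x + cscale (of_real t) y) - t * q y" for x c
    unfolding lower_along_def using that by (auto intro!: cINF_greatest)
  show "lower_along y q x \<le> q x" if "x \<in> V" for x using le[OF that, of 0] by simp
  show "lower_along y q (- y) \<le> - q y"
    using le[of "- y" 1] y sublinear_0[OF q] by (simp add: V_closed)
  show "sublinear_on V (lower_along y q)"
  proof (rule sublinear_onI)
    fix x z assume xz: "x \<in> V" "z \<in> V"
    have "lower_along y q (x + z) - (q (z + cscale (of_real s) y) - s * q y)
       \<le> q (x + cscale (of_real t) y) - t * q y" if "t \<ge> 0" "s \<ge> 0" for s t
    proof -
      have "lower_along y q (x + z) \<le> q (x + z + cscale (of_real (t + s)) y) - (t + s) * q y"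
        using that xz by (intro le V_closed) auto
      also have "x + z + cscale (of_real (t + s)) y = (x + cscale (of_real t) y) + (z + cscale (of_real s) y)"
        by (simp add: cfun.scale_left_distrib)
      also have "q \<dots> \<le> q (x + cscale (of_real t) y) + q (z + cscale (of_real s) y)"
        by (rule add; intro V_closed xz y)
      finally show ?thesis by (simp only: distrib_right) linarith
    qed
    then have "lower_along y q (x + z) - (q (z + cscale (of_real s) y) - s * q y) \<le> lower_along y q x"
      if "s \<ge> 0" for s using that xz by (intro ge) auto
    then have "lower_along y q (x + z) - lower_along y q x \<le> lower_along y q z"
      using xz by (intro ge) (auto simp: algebra_simps)
    then show "lower_along y q (x + z) \<le> lower_along y q x + lower_along y q z" by simp
  next
    have "0 \<le> lower_along y q 0" by (rule ge) (auto simp: V_closed hom y)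
    moreover have "lower_along y q 0 \<le> 0" using le[of 0 0] sublinear_0[OF q] by (simp add: V_closed)
    ultimately show "lower_along y q 0 = 0" by simp
  next
    fix r :: real and x assume r: "r > 0" and x: "x \<in> V"
    have "lower_along y q (cscale (of_real r) x) / r \<le> lower_along y q x"
    proof (rule ge[OF x])
      fix t :: real assume t: "t \<ge> 0"
      have "lower_along y q (cscale (of_real r) x)
          \<le> q (cscale (of_real r) x + cscale (of_real (r * t)) y) - (r * t) * q y"
        using r t by (intro le V_closed x) auto
      also have "cscale (of_real r) x + cscale (of_real (r * t)) y = cscale (of_real r) (x + cscale (of_real t) y)"
        by (simp add: cfun.scale_right_distrib cfun.scale_scale)
      also have "q \<dots> = r * q (x + cscale (of_real t) y)"
        using r by (intro hom V_closed x y) auto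
      finally show "lower_along y q (cscale (of_real r) x) / r \<le> q (x + cscale (of_real t) y) - t * q y"
        using r by (simp add: field_simps)
    qed
    then show "lower_along y q (cscale (of_real r) x) \<le> r * lower_along y q x"
      using r by (simp add: field_simps)
  qed
qed

text \<open>Along a chain the pointwise infimum is again sublinear, and it is finite because every member is
  bounded below at \<open>x\<close> by \<open>- q (- x)\<close>. For the order to be antisymmetric the functionals are normalised to
  vanish outside \<open>V\<close>.\<close>

lemma minimal_sublinear:
  assumes q: "sublinear_on V q"
  shows "\<exists>m. sublinear_on V m \<and> (\<forall>x\<in>V. m x \<le> q x) \<and>
    (\<forall>a. sublinear_on V a \<longrightarrow> (\<forall>x\<in>V. a x \<le> m x) \<longrightarrow> (\<forall>x\<in>V. a x = m x))"
proof -
  define S where "S = {Q. sublinear_on V Q \<and> (\<forall>x\<in>V. Q x \<le> q x) \<and> (\<forall>x. x \<notin> V \<longrightarrow> Q x = 0)}"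
  define P where "P = (\<lambda>a b :: (real \<Rightarrow> complex) \<Rightarrow> real. \<forall>x. b x \<le> a x)"
  have cong: "sublinear_on V (\<lambda>x. if x \<in> V then a x else 0)" if "sublinear_on V a" for a
    using that by (simp add: sublinear_on_def V_closed)
  have lower: "- q (- x) \<le> Q x" if "Q \<in> S" "x \<in> V" for Q x
  proof -
    have "- Q (- x) \<le> Q x" using that by (intro sublinear_minus) (auto simp: S_def)
    moreover have "Q (- x) \<le> q (- x)" using that V_closed(4) by (auto simp: S_def)
    ultimately show ?thesis by linarith
  qed
  have "\<exists>m\<in>S. \<forall>a\<in>S. P m a \<longrightarrow> a = m"
  proof (rule predicate_Zorn)
    show "partial_order_on S (relation_of P S)"
      by (rule partial_order_on_relation_ofI) (auto simp: P_def fun_eq_iff intro: order_trans antisym)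
  next
    fix C assume C: "C \<in> Chains (relation_of P S)"
    have CS: "C \<subseteq> S" using C unfolding Chains_def relation_of_def by auto
    have chain: "(\<forall>x. a x \<le> b x) \<or> (\<forall>x. b x \<le> a x)" if "a \<in> C" "b \<in> C" for a b
      using C that unfolding Chains_def relation_of_def P_def by auto
    show "\<exists>u\<in>S. \<forall>a\<in>C. P a u"
    proof (cases "C = {}")
      case True
      have "(\<lambda>x. if x \<in> V then q x else 0) \<in> S" using cong[OF q] by (simp add: S_def)
      with True show ?thesis by blast
    next
      case False
      define u where "u = (\<lambda>x. if x \<in> V then INF Q\<in>C. Q x else 0)"
      have bdd: "bdd_below ((\<lambda>Q. Q x) ` C)" if "x \<in> V" for x
        using lower[OF _ that] CS by (intro bdd_belowI2[of _ "- q (- x)"]) auto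
      have le: "u x \<le> Q x" if "x \<in> V" "Q \<in> C" for x Q
        unfolding u_def using that bdd by (auto intro!: cINF_lower)
      have ge: "c \<le> u x" if "x \<in> V" "\<And>Q. Q \<in> C \<Longrightarrow> c \<le> Q x" for x c
        unfolding u_def using that False by (auto intro!: cINF_greatest)
      have add: "Q (x + z) \<le> Q x + Q z" if "Q \<in> C" "x \<in> V" "z \<in> V" for Q x z
        using that CS by (auto simp: S_def sublinear_on_def)
      have hom: "Q (cscale (of_real r) x) = r * Q x" if "Q \<in> C" "x \<in> V" "r \<ge> 0" for Q x r
        using that CS by (auto simp: S_def sublinear_on_def)
      have "sublinear_on V u"
      proof (rule sublinear_onI)
        fix x z assume xz: "x \<in> V" "z \<in> V"
        have "u (x + z) - b z \<le> a x" if "a \<in> C" "b \<in> C" for a b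
        proof -
          have "\<exists>Q\<in>C. (\<forall>x. Q x \<le> a x) \<and> (\<forall>x. Q x \<le> b x)"
            using chain[OF \<open>a \<in> C\<close> \<open>b \<in> C\<close>] that by blast
          then obtain Q where Q: "Q \<in> C" "\<And>x. Q x \<le> a x" "\<And>x. Q x \<le> b x" by blast
          have "u (x + z) \<le> Q (x + z)" using Q xz by (intro le V_closed)
          also have "\<dots> \<le> Q x + Q z" using Q xz by (intro add)
          also have "\<dots> \<le> a x + b z" by (intro add_mono Q)
          finally show ?thesis by simp
        qed
        then have "u (x + z) - b z \<le> u x" if "b \<in> C" for b using that xz by (intro ge) auto
        then have "u (x + z) - u x \<le> u z" using xz by (intro ge) (auto simp: algebra_simps)
        then show "u (x + z) \<le> u x + u z" by simp
      next
        have z: "Q 0 = 0" if "Q \<in> C" for Q using that CS by (intro sublinear_0) (auto simp: S_def)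
        obtain Q where Q: "Q \<in> C" using False by blast
        have "u 0 \<le> 0" using le[OF V_closed(3) Q] z[OF Q] by simp
        moreover have "0 \<le> u 0" by (rule ge[OF V_closed(3)]) (simp add: z)
        ultimately show "u 0 = 0" by simp
      next
        fix r :: real and x assume r: "r > 0" and x: "x \<in> V"
        have "u (cscale (of_real r) x) / r \<le> u x"
        proof (rule ge[OF x])
          fix Q assume Q: "Q \<in> C"
          have "u (cscale (of_real r) x) \<le> Q (cscale (of_real r) x)" by (intro le V_closed x Q)
          also have "\<dots> = r * Q x" using hom[OF Q x] r by simp
          finally show "u (cscale (of_real r) x) / r \<le> Q x" using r by (simp add: field_simps)
        qed
        then show "u (cscale (of_real r) x) \<le> r * u x" using r by (simp add: field_simps)
      qed
      moreover have "u x \<le> q x" if "x \<in> V" for x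
      proof -
        obtain Q where Q: "Q \<in> C" using False by blast
        then have "Q \<in> S" using CS by blast
        then have "Q x \<le> q x" using that by (simp add: S_def)
        with le[OF that Q] show ?thesis by simp
      qed
      ultimately have "u \<in> S" by (simp add: S_def u_def)
      moreover have "P a u" if "a \<in> C" for a
        unfolding P_def
      proof
        fix x
        show "u x \<le> a x"
        proof (cases "x \<in> V")
          case False
          have "a \<in> S" using CS that by (rule subsetD)
          with False have "a x = 0" by (simp add: S_def)
          with False show ?thesis by (simp add: u_def)
        qed (use le that in auto)
      qed
      ultimately show ?thesis by (intro bexI[of _ u] ballI)
    qed
  qed
  then obtain m where m: "m \<in> S" "\<forall>a\<in>S. P m a \<longrightarrow> a = m" by (elim bexE) (rule that)
  have "\<forall>x\<in>V. a x = m x" if a: "sublinear_on V a" "\<forall>x\<in>V. a x \<le> m x" for a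
  proof -
    let ?a = "\<lambda>x. if x \<in> V then a x else 0"
    have "?a x \<le> m x" for x using a(2) m(1) by (cases "x \<in> V") (simp_all add: S_def)
    then have "P m ?a" by (simp add: P_def)
    moreover have "?a \<in> S"
    proof -
      have "a x \<le> q x" if "x \<in> V" for x
      proof -
        have "a x \<le> m x" using a(2) that by (rule bspec)
        also have "m x \<le> q x" using m(1) that by (simp add: S_def)
        finally show ?thesis .
      qed
      then show ?thesis using cong[OF a(1)] by (simp add: S_def)
    qed
    ultimately have eq: "?a = m" by (intro m(2)[rule_format])
    show ?thesis
    proof
      fix x assume "x \<in> V"
      then show "a x = m x" using fun_cong[OF eq, of x] by simp
    qed
  qed
  note min = this
  have "sublinear_on V m" "\<forall>x\<in>V. m x \<le> q x" using m(1) by (simp_all add: S_def)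
  then show ?thesis by (intro exI[of _ m] conjI allI impI min)
qed

text \<open>A minimal \<open>m\<close> coincides with \<open>lower_along y m\<close>, so \<open>m (- y) \<le> - m y\<close> for every \<open>y\<close>: a sublinear functional
  that is odd is linear.\<close>

lemma hahn_banach_sublinear:
  assumes q: "sublinear_on V q"
  shows "\<exists>L. (\<forall>x\<in>V. \<forall>y\<in>V. L (x + y) = L x + L y) \<and>
    (\<forall>r. \<forall>x\<in>V. L (cscale (of_real r) x) = r * L x) \<and> (\<forall>x\<in>V. L x \<le> q x)"
proof -
  obtain m where m: "sublinear_on V m" "\<forall>x\<in>V. m x \<le> q x"
    "\<forall>a. sublinear_on V a \<longrightarrow> (\<forall>x\<in>V. a x \<le> m x) \<longrightarrow> (\<forall>x\<in>V. a x = m x)"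
    using minimal_sublinear[OF q] by (elim exE conjE) (rule that)
  have add: "m (x + z) \<le> m x + m z" if "x \<in> V" "z \<in> V" for x z
    using m(1) that by (simp add: sublinear_on_def)
  have hom: "m (cscale (of_real r) x) = r * m x" if "x \<in> V" "r \<ge> 0" for x r
    using m(1) that by (simp add: sublinear_on_def)
  have neg: "m (- y) = - m y" if y: "y \<in> V" for y
  proof -
    have "\<forall>x\<in>V. lower_along y m x = m x"
      by (intro m(3)[rule_format] ballI lower_along[OF m(1) y])
    then have "lower_along y m (- y) = m (- y)" using V_closed(4)[OF y] by (rule bspec)
    then have "m (- y) \<le> - m y" using lower_along(3)[OF m(1) y] by simp
    moreover have "- m y \<le> m (- y)" using sublinear_minus[OF m(1), of "- y"] y by (simp add: V_closed)
    ultimately show ?thesis by simp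
  qed
  show ?thesis
  proof (intro exI[of _ m] conjI ballI allI)
    fix x y assume xy: "x \<in> V" "y \<in> V"
    have "m x \<le> m (x + y) + m (- y)" using add[of "x + y" "- y"] xy by (simp add: V_closed)
    then show "m (x + y) = m x + m y" using add[OF xy] neg[OF xy(2)] by simp
  next
    fix r :: real and x assume x: "x \<in> V"
    show "m (cscale (of_real r) x) = r * m x"
    proof (cases "r \<ge> 0")
      case False
      have "m (- cscale (of_real (- r)) x) = - ((- r) * m x)"
        using False hom[OF x, of "- r"] neg[OF V_closed(2)[OF x]] by simp
      moreover have "- cscale (of_real (- r)) x = cscale (of_real r) x"
        by (simp add: cscale_def fun_eq_iff)
      ultimately show ?thesis by simp
    qed (use hom x in auto)
  qed (use m(2) in auto)
qed

text \<open>The real functional \<open>L\<close> lies below the distance \<open>d\<close> to \<open>M\<close>, which is sublinear and vanishes on \<open>M\<close>;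
  starting from \<open>lower_along x0 d\<close> forces \<open>L x0 \<ge> d x0\<close>. The complex functional is \<open>L x - \<i> L (\<i> x)\<close>, as usual.\<close>

lemma separating_functional:
  assumes p0: "\<And>f. f \<in> V \<Longrightarrow> 0 \<le> p f"
    and padd: "\<And>f g. f \<in> V \<Longrightarrow> g \<in> V \<Longrightarrow> p (f + g) \<le> p f + p g"
    and pscale: "\<And>c f. f \<in> V \<Longrightarrow> p (cscale c f) = cmod c * p f"
    and M: "cfun.subspace M" "M \<subseteq> V" and x0: "x0 \<in> V"
    and e: "e > 0" "\<And>g. g \<in> M \<Longrightarrow> e \<le> p (x0 - g)"
  shows "\<exists>\<alpha>. linear_functional_on V \<alpha> \<and> (\<forall>f\<in>V. cmod (\<alpha> f) \<le> 2 * p f) \<and>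
     (\<forall>g\<in>M. \<alpha> g = 0) \<and> \<alpha> x0 \<noteq> 0"
proof -
  note Mc = cfun.subspace_add[OF M(1)] cfun.subspace_scale[OF M(1)] cfun.subspace_0[OF M(1)]
    cfun.subspace_neg[OF M(1)]
  have MV: "g \<in> V" if "g \<in> M" for g using that M(2) by blast
  define d where "d = (\<lambda>x. INF g\<in>M. p (x - g))"
  have dle: "d x \<le> p (x - g)" if "x \<in> V" "g \<in> M" for x g
    unfolding d_def using that p0 MV
    by (intro cINF_lower bdd_belowI2[of _ 0]) (auto simp: V_closed)
  have dge: "c \<le> d x" if "\<And>g. g \<in> M \<Longrightarrow> c \<le> p (x - g)" for c x
    unfolding d_def using that Mc(3) by (intro cINF_greatest) auto
  have d: "sublinear_on V d"
  proof (rule sublinear_onI)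
    fix x z assume xz: "x \<in> V" "z \<in> V"
    have "d (x + z) - p (z - h) \<le> p (x - g)" if "g \<in> M" "h \<in> M" for g h
    proof -
      have "d (x + z) \<le> p ((x + z) - (g + h))" by (rule dle[OF V_closed(1)[OF xz] Mc(1)[OF that]])
      also have "(x + z) - (g + h) = (x - g) + (z - h)" by simp
      also have "p \<dots> \<le> p (x - g) + p (z - h)"
        by (rule padd[OF V_closed(5)[OF xz(1) MV[OF that(1)]] V_closed(5)[OF xz(2) MV[OF that(2)]]])
      finally show ?thesis by linarith
    qed
    then have "d (x + z) - p (z - h) \<le> d x" if "h \<in> M" for h using that by (intro dge) auto
    then have "d (x + z) - d x \<le> d z" by (intro dge) (auto simp: algebra_simps)
    then show "d (x + z) \<le> d x + d z" by simp
  next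
    have "p 0 = 0" using pscale[of 0 0] by (simp add: V_closed)
    then have "d 0 \<le> 0" using dle[of 0 0] by (simp add: V_closed Mc)
    moreover have "0 \<le> d 0" using MV by (intro dge p0 V_closed) auto
    ultimately show "d 0 = 0" by simp
  next
    fix r :: real and x assume r: "r > 0" and x: "x \<in> V"
    have "d (cscale (of_real r) x) / r \<le> d x"
    proof (rule dge)
      fix g assume g: "g \<in> M"
      have "d (cscale (of_real r) x) \<le> p (cscale (of_real r) x - cscale (of_real r) g)"
        using x g by (intro dle V_closed Mc)
      also have "cscale (of_real r) x - cscale (of_real r) g = cscale (of_real r) (x - g)"
        by (simp add: cscale_def fun_eq_iff algebra_simps)
      also have "p \<dots> = r * p (x - g)" using r x g by (subst pscale) (auto simp: V_closed MV)
      finally show "d (cscale (of_real r) x) / r \<le> p (x - g)" using r by (simp add: field_simps)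
    qed
    then show "d (cscale (of_real r) x) \<le> r * d x" using r by (simp add: field_simps)
  qed
  have dx0: "e \<le> d x0" by (intro dge e)
  have dp: "d x \<le> p x" if "x \<in> V" for x using dle[OF that Mc(3)] by simp
  note low = lower_along[OF d x0]
  obtain L where L': "\<forall>x\<in>V. \<forall>y\<in>V. L (x + y) = L x + L y"
    "\<forall>r. \<forall>x\<in>V. L (cscale (of_real r) x) = r * L x"
    "\<forall>x\<in>V. L x \<le> lower_along x0 d x"
    using hahn_banach_sublinear[OF low(1)] by (elim exE conjE) (rule that)
  note L = L'(1)[rule_format] L'(2)[rule_format] L'(3)[rule_format]
  have Ld: "L x \<le> d x" if "x \<in> V" for x using L(3)[OF that] low(2)[OF that] by simp
  have Lneg: "L (- x) = - L x" if "x \<in> V" for x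
    using L(2)[OF that, of "- 1"] by simp
  have Lp: "\<bar>L x\<bar> \<le> p x" if x: "x \<in> V" for x
  proof -
    have "p (- x) = p x" using pscale[OF x, of "- 1"] by simp
    then have "- L x \<le> p x"
      using Ld[OF V_closed(4)[OF x]] dp[OF V_closed(4)[OF x]] Lneg[OF x] by simp
    moreover have "L x \<le> p x" using Ld[OF x] dp[OF x] by simp
    ultimately show ?thesis by simp
  qed
  have LM: "L g = 0" if g: "g \<in> M" for g
  proof -
    have "p 0 = 0" using pscale[of 0 0] by (simp add: V_closed)
    then have "d h \<le> 0" if "h \<in> M" for h using dle[OF MV[OF that] that] by simp
    then have "L g \<le> 0" "L (- g) \<le> 0" using Ld MV Mc(4) g by (meson order_trans)+
    then show ?thesis using Lneg MV[OF g] by simp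
  qed
  have Lx0: "L x0 > 0"
    using L(3)[OF V_closed(4)[OF x0]] low(3) Lneg[OF x0] dx0 e(1) by simp
  define \<alpha> where "\<alpha> = (\<lambda>x. Complex (L x) (- L (cscale \<i> x)))"
  have "\<alpha> (cscale c x) = c * \<alpha> x" if x: "x \<in> V" for c x
  proof -
    have 1: "cscale c x = cscale (of_real (Re c)) x + cscale (of_real (Im c)) (cscale \<i> x)"
      by (auto simp: cscale_def fun_eq_iff complex_eq_iff)
    have 2: "cscale \<i> (cscale c x) = cscale (of_real (Re c)) (cscale \<i> x) + cscale (of_real (- Im c)) x"
      by (auto simp: cscale_def fun_eq_iff complex_eq_iff)
    have "L (cscale c x) = Re c * L x + Im c * L (cscale \<i> x)"
      unfolding 1 using x by (simp only: L V_closed)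
    moreover have "L (cscale \<i> (cscale c x)) = Re c * L (cscale \<i> x) + - Im c * L x"
      unfolding 2 using x by (simp only: L V_closed)
    ultimately show ?thesis by (simp add: \<alpha>_def complex_eq_iff algebra_simps)
  qed
  moreover have "\<alpha> (x + y) = \<alpha> x + \<alpha> y" if "x \<in> V" "y \<in> V" for x y
    using that by (simp add: \<alpha>_def L V_closed cfun.scale_right_distrib complex_eq_iff)
  ultimately have "linear_functional_on V \<alpha>" by (simp add: linear_functional_on_def)
  moreover have "cmod (\<alpha> x) \<le> 2 * p x" if x: "x \<in> V" for x
  proof -
    have "cmod (\<alpha> x) \<le> \<bar>L x\<bar> + \<bar>L (cscale \<i> x)\<bar>"
      using cmod_le[of "\<alpha> x"] by (simp add: \<alpha>_def)
    also have "\<dots> \<le> p x + p (cscale \<i> x)" by (intro add_mono Lp V_closed x)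
    also have "p (cscale \<i> x) = p x" using pscale[OF x] by simp
    finally show ?thesis by simp
  qed
  moreover have "\<alpha> g = 0" if "g \<in> M" for g
    using LM[OF that] LM[OF Mc(2)[OF that]] by (simp add: \<alpha>_def complex_eq_iff)
  moreover have "\<alpha> x0 \<noteq> 0" using Lx0 by (simp add: \<alpha>_def complex_eq_iff)
  ultimately show ?thesis by (intro exI[of _ \<alpha>] conjI ballI)
qed

end

lemma topspace_seminorm_topology:
  assumes "\<And>f. f \<in> V \<Longrightarrow> p (f - f) = 0"
  shows "topspace (seminorm_topology V {p}) = V"
proof
  show "V \<subseteq> topspace (seminorm_topology V {p})"
  proof
    fix f assume f: "f \<in> V"
    then have "f \<in> {g \<in> V. p (g - f) < 1}" using assms[OF f] by simp
    then show "f \<in> topspace (seminorm_topology V {p})"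
      unfolding seminorm_topology_def topology_generated_by_topspace
      using f zero_less_one by blast
  qed
qed (auto simp: seminorm_topology_def topology_generated_by_topspace)

lemma openin_seminorm_ball:
  "f \<in> V \<Longrightarrow> e > 0 \<Longrightarrow> openin (seminorm_topology V {p}) {g \<in> V. p (g - f) < e}"
  unfolding seminorm_topology_def by (rule topology_generated_by_Basis) blast

lemma seminorm_ball_subset_open:
  assumes U: "openin (seminorm_topology V {p}) U" and h: "h \<in> U"
    and tri: "\<And>f g k. f \<in> V \<Longrightarrow> g \<in> V \<Longrightarrow> k \<in> V \<Longrightarrow> p (f - k) \<le> p (f - g) + p (g - k)"
  shows "\<exists>e>0. {g \<in> V. p (g - h) < e} \<subseteq> U"
proof -
  have "generate_topology_on {{g \<in> V. p (g - f) < e} | f p' e. f \<in> V \<and> p' \<in> {p} \<and> e > 0} U"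
    using U unfolding seminorm_topology_def openin_topology_generated_by_iff by simp
  then show ?thesis using h
  proof (induction rule: generate_topology_on.induct)
    case (Int a b)
    then obtain e1 e2 where "e1 > 0" "{g \<in> V. p (g - h) < e1} \<subseteq> a"
      "e2 > 0" "{g \<in> V. p (g - h) < e2} \<subseteq> b" by blast
    then have "0 < min e1 e2" "{g \<in> V. p (g - h) < min e1 e2} \<subseteq> a \<inter> b"
      unfolding min_less_iff_conj by auto
    then show ?case by (intro exI conjI)
  next
    case (UN K)
    then obtain k where "k \<in> K" "h \<in> k" by blast
    with UN.IH obtain e where "e > 0" "{g \<in> V. p (g - h) < e} \<subseteq> k" by blast
    then show ?case using \<open>k \<in> K\<close> by (intro exI[of _ e]) blast
  next
    case (Basis s)
    then obtain f e where s: "s = {g \<in> V. p (g - f) < e}" "f \<in> V" by auto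
    then have h: "h \<in> V" "p (h - f) < e" using Basis by auto
    have "{g \<in> V. p (g - h) < e - p (h - f)} \<subseteq> s"
      unfolding s(1) using tri[OF _ h(1) s(2)] by force
    moreover have "0 < e - p (h - f)" using h(2) by simp
    ultimately show ?case by (intro exI conjI)
  qed auto
qed

lemma banach_function_spaceD:
  assumes "banach_function_space V p"
  shows "cfun.subspace V" "\<And>f. f \<in> V \<Longrightarrow> 0 \<le> p f"
    "\<And>f g. f \<in> V \<Longrightarrow> g \<in> V \<Longrightarrow> p (f + g) \<le> p f + p g"
    "\<And>c f. f \<in> V \<Longrightarrow> p (cscale c f) = cmod c * p f"
  using assms unfolding banach_function_space_def by blast+

lemma incomplete_system_functional:
  assumes B: "banach_function_space V p" and A: "A \<subseteq> V"
    and inc: "\<not> complete_system (seminorm_topology V {p}) A"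
  shows "\<exists>\<alpha>\<in>dual_space V p. (\<forall>f\<in>A. \<alpha> f = 0) \<and> (\<exists>g\<in>V. \<alpha> g \<noteq> 0)"
proof -
  note D = banach_function_spaceD[OF B]
  note sub = cfun.subspace_diff[OF D(1)]
  have p0: "p (f - f) = 0" if "f \<in> V" for f
    using D(4)[OF that, of 0] by simp
  have tri: "p (f - k) \<le> p (f - g) + p (g - k)" if "f \<in> V" "g \<in> V" "k \<in> V" for f g k
  proof -
    have "f - k = (f - g) + (g - k)" by simp
    then show ?thesis using D(3)[OF sub[OF that(1,2)] sub[OF that(2,3)]] by simp
  qed
  have sym: "p (f - g) = p (g - f)" if "f \<in> V" "g \<in> V" for f g
  proof -
    have "f - g = cscale (- 1) (g - f)" by (simp add: cscale_def fun_eq_iff)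
    then show ?thesis using D(4)[OF sub[OF that(2,1)], of "- 1"] by simp
  qed
  have top: "topspace (seminorm_topology V {p}) = V" by (rule topspace_seminorm_topology) (rule p0)
  let ?M = "cfun.span A"
  have M: "cfun.subspace ?M" "?M \<subseteq> V"
    by (rule cfun.subspace_span) (rule cfun.span_minimal[OF A D(1)])
  have "(seminorm_topology V {p}) closure_of ?M \<noteq> V"
    using inc A top by (simp add: complete_system_def)
  moreover have "(seminorm_topology V {p}) closure_of ?M \<subseteq> V"
    using closure_of_subset_topspace[of "seminorm_topology V {p}" ?M] top by simp
  ultimately obtain x0 where x0: "x0 \<in> V" "x0 \<notin> (seminorm_topology V {p}) closure_of ?M" by blast
  then obtain U where U: "openin (seminorm_topology V {p}) U" "x0 \<in> U" "\<forall>y\<in>?M. y \<notin> U"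
    unfolding in_closure_of top by blast
  obtain e where e: "e > 0" "{g \<in> V. p (g - x0) < e} \<subseteq> U"
    using seminorm_ball_subset_open[OF U(1,2) tri] by blast
  have far: "e \<le> p (x0 - g)" if "g \<in> ?M" for g
  proof -
    have "g \<in> V" using that M(2) by blast
    moreover have "g \<notin> U" using U(3) that by blast
    ultimately have "\<not> p (g - x0) < e" using e(2) by blast
    then show ?thesis using sym[OF \<open>g \<in> V\<close> x0(1)] by simp
  qed
  have "\<exists>\<alpha>. linear_functional_on V \<alpha> \<and> (\<forall>f\<in>V. cmod (\<alpha> f) \<le> 2 * p f) \<and>
     (\<forall>g\<in>?M. \<alpha> g = 0) \<and> \<alpha> x0 \<noteq> 0"
    by (rule separating_functional[OF D(1) _ _ _ M x0(1) e(1)]) (fact D(2) D(3) D(4) far)+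
  then obtain \<alpha> where \<alpha>: "linear_functional_on V \<alpha>" "\<forall>f\<in>V. cmod (\<alpha> f) \<le> 2 * p f"
     "\<forall>g\<in>?M. \<alpha> g = 0" "\<alpha> x0 \<noteq> 0"
    by (elim exE conjE) (rule that)
  have \<alpha>diff: "\<alpha> g - \<alpha> f = \<alpha> (g - f)" if "f \<in> V" "g \<in> V" for f g
  proof -
    have "\<alpha> ((g - f) + f) = \<alpha> (g - f) + \<alpha> f"
      using \<alpha>(1) sub[OF that(2,1)] that(1) unfolding linear_functional_on_def by blast
    then have "\<alpha> g = \<alpha> (g - f) + \<alpha> f" unfolding diff_add_cancel .
    then show ?thesis by (simp only: add_diff_cancel_right')
  qed
  have "continuous_map (seminorm_topology V {p}) euclidean \<alpha>"
    unfolding continuous_map_def top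
  proof (intro conjI allI impI)
    fix U :: "complex set" assume "openin euclidean U"
    then have U: "open U" by simp
    show "openin (seminorm_topology V {p}) {x \<in> V. \<alpha> x \<in> U}"
    proof (subst openin_subopen, intro ballI)
      fix f assume f: "f \<in> {x \<in> V. \<alpha> x \<in> U}"
      then obtain d where d: "d > 0" "ball (\<alpha> f) d \<subseteq> U" using U open_contains_ball by blast
      have "{g \<in> V. p (g - f) < d / 2} \<subseteq> {x \<in> V. \<alpha> x \<in> U}"
      proof
        fix g assume g: "g \<in> {g \<in> V. p (g - f) < d / 2}"
        have "dist (\<alpha> f) (\<alpha> g) = cmod (\<alpha> g - \<alpha> f)" by (simp only: dist_norm norm_minus_commute)
        also have "\<alpha> g - \<alpha> f = \<alpha> (g - f)" using f g by (intro \<alpha>diff) auto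
        also have "cmod \<dots> \<le> 2 * p (g - f)" using \<alpha>(2) sub[of g f] f g by blast
        also have "\<dots> < d" using g by simp
        finally show "g \<in> {x \<in> V. \<alpha> x \<in> U}" using d(2) g by auto
      qed
      moreover have "f \<in> {g \<in> V. p (g - f) < d / 2}" using f p0[of f] d(1) by simp
      moreover have "openin (seminorm_topology V {p}) {g \<in> V. p (g - f) < d / 2}"
        using f d(1) by (intro openin_seminorm_ball) auto
      ultimately show "\<exists>T. openin (seminorm_topology V {p}) T \<and> f \<in> T \<and> T \<subseteq> {x \<in> V. \<alpha> x \<in> U}"
        by (intro exI conjI)
    qed
  qed simp
  with \<alpha>(1) have "\<alpha> \<in> dual_space V p" by (simp add: dual_space_def)
  moreover have "\<alpha> f = 0" if "f \<in> A" for f using \<alpha>(3) cfun.span_base[OF that] by blast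
  ultimately show ?thesis using x0(1) \<alpha>(4) by (intro bexI[of _ \<alpha>] conjI ballI bexI[of _ x0])
qed

lemma dual_restricts_to_temperate:
  assumes "schwartz_embedded V p" "\<alpha> \<in> dual_space V p"
  shows "temperate_distribution \<alpha>"
proof -
  have "schwartz \<subseteq> V" using assms(1) by (simp add: schwartz_embedded_def)
  then have "linear_functional_on schwartz \<alpha>"
    using assms(2) unfolding dual_space_def linear_functional_on_def by blast
  moreover have "continuous_map schwartz_topology euclidean (\<alpha> \<circ> (\<lambda>\<phi>. \<phi>))"
    by (rule continuous_map_compose[of _ "seminorm_topology V {p}"])
       (use assms in \<open>simp_all add: schwartz_embedded_def dual_space_def\<close>)
  ultimately show ?thesis by (simp add: temperate_distribution_def o_def)
qed

section \<open>Choice of the frequencies and amplitudes\<close>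

text \<open>Only finitely many bumps and seminorms are involved, so one bound on the jets of \<open>D\<close> serves them
  all.\<close>

lemma fourier_bump_small:
  assumes "\<eta> > 0"
  shows "\<exists>\<delta>>0. \<forall>D. smooth D \<longrightarrow> jet_le c (bump_core c) \<delta> D \<longrightarrow>
     (\<forall>j\<le>c. \<forall>n\<le>c. \<forall>k\<le>c. schwartz_seminorm n k (fourier (\<lambda>t. bump j t * D t)) \<le> \<eta>)"
proof -
  define ok where "ok = (\<lambda>j n k C. C \<ge> 0 \<and> (\<forall>g \<eta>. smooth g \<longrightarrow> \<eta> \<ge> 0 \<longrightarrow> jet_le n (bump_core j) \<eta> g \<longrightarrow>
     (\<forall>x. (1 + \<bar>x\<bar>) ^ n * cmod (higher_vderiv k (fourier (\<lambda>t. bump j t * g t)) x) \<le> C * \<eta>)))"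
  define C where "C = (\<lambda>j n k. SOME C. ok j n k C)"
  have "\<exists>C. ok j n k C" for j n k
    unfolding ok_def jet_le_def
    by (rule fourier_weighted_bound[OF compact_bump_core smooth_bump]) (simp add: bump_zero_off_core)
  then have C: "ok j n k (C j n k)" for j n k unfolding C_def by (rule someI_ex)
  define T where "T = (\<Sum>j\<le>c. \<Sum>n\<le>c. \<Sum>k\<le>c. C j n k) + 1"
  have C0: "0 \<le> C j n k" for j n k using C by (simp add: ok_def)
  have CT: "C j n k \<le> T" if "j \<le> c" "n \<le> c" "k \<le> c" for j n k
  proof -
    have "C j n k \<le> (\<Sum>k\<le>c. C j n k)" using that C0 by (intro member_le_sum) auto
    also have "\<dots> \<le> (\<Sum>n\<le>c. \<Sum>k\<le>c. C j n k)"
      using that C0 by (intro member_le_sum[of n _ "\<lambda>n. \<Sum>k\<le>c. C j n k"] sum_nonneg) auto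
    also have "\<dots> \<le> (\<Sum>j\<le>c. \<Sum>n\<le>c. \<Sum>k\<le>c. C j n k)"
      using that C0 by (intro member_le_sum[of j _ "\<lambda>j. \<Sum>n\<le>c. \<Sum>k\<le>c. C j n k"] sum_nonneg) auto
    finally show ?thesis by (simp add: T_def)
  qed
  have T: "T > 0" unfolding T_def using C0 by (intro add_nonneg_pos sum_nonneg) auto
  show ?thesis
  proof (intro exI[of _ "\<eta> / T"] conjI allI impI)
    show "\<eta> / T > 0" using assms T by simp
    fix D j n k
    assume D: "smooth D" "jet_le c (bump_core c) (\<eta> / T) D" and jnk: "j \<le> c" "n \<le> c" "k \<le> c"
    have jet: "jet_le n (bump_core j) (\<eta> / T) D"
      using D(2) jnk(2) bump_core_mono[OF jnk(1)] by (rule jet_le_subset)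
    have "(1 + \<bar>x\<bar>) ^ n * cmod (higher_vderiv k (fourier (\<lambda>t. bump j t * D t)) x) \<le> C j n k * (\<eta> / T)" for x
    proof -
      have "0 \<le> \<eta> / T" using assms T by simp
      from C[of j n k, unfolded ok_def, THEN conjunct2, rule_format, OF D(1) this jet]
      show ?thesis .
    qed
    moreover have "C j n k * (\<eta> / T) \<le> T * (\<eta> / T)"
      using CT[OF jnk] assms T by (intro mult_right_mono) auto
    ultimately show "schwartz_seminorm n k (fourier (\<lambda>t. bump j t * D t)) \<le> \<eta>"
      using T by (intro schwartz_seminorm_le) (auto intro: order_trans)
  qed
qed

definition wave_sum :: "nat set \<Rightarrow> (nat \<Rightarrow> complex) \<Rightarrow> (nat \<Rightarrow> real) \<Rightarrow> real \<Rightarrow> complex" where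
  "wave_sum A cf lam t = (\<Sum>n\<in>A. cf n * wave (lam n) t)"

lemma smooth_wave_sum': "smooth (wave_sum A cf lam)"
  unfolding wave_sum_def[abs_def] by (rule smooth_wave_sum)

lemma block_exists:
  assumes "smooth h" "\<epsilon> > 0" "\<eta> > 0"
  shows "\<exists>N'>N. \<exists>lam cf. (\<forall>n\<in>{N<..<N'}. \<bar>lam n - of_nat n\<bar> \<le> \<epsilon>) \<and>
    (\<forall>j\<le>c. \<forall>n\<le>c. \<forall>k\<le>c. schwartz_seminorm n k
       (fourier (\<lambda>t. bump j t * (wave_sum {N<..<N'} cf lam t - h t))) \<le> \<eta>)"
proof -
  obtain \<delta> where \<delta>: "\<delta> > 0" "\<forall>D. smooth D \<longrightarrow> jet_le c (bump_core c) \<delta> D \<longrightarrow>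
     (\<forall>j\<le>c. \<forall>n\<le>c. \<forall>k\<le>c. schwartz_seminorm n k (fourier (\<lambda>t. bump j t * D t)) \<le> \<eta>)"
    using fourier_bump_small[OF assms(3), of c] by (elim exE conjE) (rule that)
  have "block_approximable c (bump_core c) \<epsilon> h"
    by (rule block_approximable_smooth[OF compact_bump_core bump_core_Ints assms(2,1)])
  from this[unfolded block_approximable_def, rule_format, OF \<delta>(1), of N]
  obtain M lam cf where M: "N \<le> M" "\<forall>n\<in>{N<..M}. \<bar>lam n - of_nat n\<bar> \<le> \<epsilon>"
    "jet_le c (bump_core c) \<delta> (\<lambda>t. (\<Sum>n\<in>{N<..M}. cf n * wave (lam n) t) - h t)"
    by (elim exE conjE) (rule that)
  have eq: "{N<..<Suc M} = {N<..M}" by auto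
  have "smooth (\<lambda>t. wave_sum {N<..<Suc M} cf lam t - h t)"
    by (intro smooth_diff smooth_wave_sum' assms(1))
  moreover have "jet_le c (bump_core c) \<delta> (\<lambda>t. wave_sum {N<..<Suc M} cf lam t - h t)"
    unfolding wave_sum_def eq by (rule M(3))
  ultimately have "\<forall>j\<le>c. \<forall>n\<le>c. \<forall>k\<le>c. schwartz_seminorm n k
       (fourier (\<lambda>t. bump j t * (wave_sum {N<..<Suc M} cf lam t - h t))) \<le> \<eta>"
    by (rule \<delta>(2)[THEN spec, THEN mp, THEN mp])
  moreover have "N < Suc M" "\<forall>n\<in>{N<..<Suc M}. \<bar>lam n - of_nat n\<bar> \<le> \<epsilon>"
    using M(1,2) unfolding eq by auto
  ultimately show ?thesis by (intro exI conjI)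
qed

lemma strict_mono_ge_index: "(\<And>c. N c < N (Suc c)) \<Longrightarrow> c \<le> (N c :: nat)"
  by (induction c) (auto intro: le_less_trans Suc_leI)

text \<open>The blocks are chosen one after the other, the \<open>c\<close>-th one with perturbations of size at most
  \<open>1 / (c + 1)\<close>, so that \<open>lam n - real n\<close> tends to zero. Indices outside the blocks keep the unperturbed
  frequency.\<close>

lemma frequencies_exist:
  assumes h: "\<And>c. smooth (h c)"
  shows "\<exists>lam N cf. (\<lambda>n. lam n - real n) \<longlonglongrightarrow> 0 \<and> (\<forall>c. N c < N (Suc c)) \<and>
    (\<forall>c. \<forall>j\<le>c. \<forall>n\<le>c. \<forall>k\<le>c. schwartz_seminorm n k
       (fourier (\<lambda>t. bump j t * (wave_sum {N c<..<N (Suc c)} (cf c) lam t - h c t))) \<le> (1 / 2) ^ c)"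
proof -
  define good where "good = (\<lambda>c N N' lam cf. (\<forall>n\<in>{N<..<N'}. \<bar>lam n - real n\<bar> \<le> inverse (real (Suc c))) \<and>
    (\<forall>j\<le>c. \<forall>n\<le>c. \<forall>k\<le>c. schwartz_seminorm n k
       (fourier (\<lambda>t. bump j t * (wave_sum {N<..<N'} cf lam t - h c t))) \<le> (1 / 2) ^ c))"
  have step: "\<exists>N'. N < N' \<and> (\<exists>lam cf. good c N N' lam cf)" for N c
    using block_exists[OF h[of c], of "inverse (real (Suc c))" "(1 / 2) ^ c" N c]
    unfolding good_def by simp
  have "\<exists>N. \<forall>c. True \<and> (N c < N (Suc c) \<and> (\<exists>lam cf. good c (N c) (N (Suc c)) lam cf))"
    by (rule dependent_nat_choice) (use step in simp_all)
  then obtain N where N: "\<And>c. N c < N (Suc c)" "\<And>c. \<exists>lam cf. good c (N c) (N (Suc c)) lam cf"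
    by (elim exE) blast
  from N(2) have "\<forall>c. \<exists>lc. good c (N c) (N (Suc c)) (fst lc) (snd lc)" by simp
  then obtain lc where lc: "\<And>c. good c (N c) (N (Suc c)) (fst (lc c)) (snd (lc c))"
    using choice[of "\<lambda>c lc. good c (N c) (N (Suc c)) (fst lc) (snd lc)"] by blast
  define inblock where "inblock = (\<lambda>n c. n \<in> {N c<..<N (Suc c)})"
  define lam where "lam = (\<lambda>n. if \<exists>c. inblock n c then fst (lc (THE c. inblock n c)) n else real n)"
  have mono: "N c \<le> N d" if "c \<le> d" for c d
    using lift_Suc_mono_le[of N, OF less_imp_le[OF N(1)] that] .
  have uniq: "c = d" if "inblock n c" "inblock n d" for n c d
  proof (rule ccontr)
    assume "c \<noteq> d"
    then have "Suc c \<le> d \<or> Suc d \<le> c" by auto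
    then show False using mono[of "Suc c" d] mono[of "Suc d" c] that unfolding inblock_def by auto
  qed
  have the: "(THE c. inblock n c) = c" if "inblock n c" for n c
    using that uniq by (blast intro: the_equality)
  have lam: "lam n = fst (lc c) n" if "inblock n c" for n c
    using that the[OF that] by (auto simp: lam_def)
  have ws: "wave_sum {N c<..<N (Suc c)} cf lam t = wave_sum {N c<..<N (Suc c)} cf (fst (lc c)) t" for c cf t
    unfolding wave_sum_def by (intro sum.cong refl) (simp add: lam inblock_def)
  have "(\<lambda>n. lam n - real n) \<longlonglongrightarrow> 0"
  proof (rule LIMSEQ_I)
    fix e :: real assume "e > 0"
    then obtain c0 where c0: "inverse (real (Suc c0)) < e" using reals_Archimedean by blast
    show "\<exists>n0. \<forall>n\<ge>n0. norm (lam n - real n - 0) < e"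
    proof (intro exI[of _ "N c0"] allI impI)
      fix n assume n: "N c0 \<le> n"
      show "norm (lam n - real n - 0) < e"
      proof (cases "\<exists>c. inblock n c")
        case True
        then obtain c where c: "inblock n c" by blast
        have "c0 \<le> c"
        proof (rule ccontr)
          assume "\<not> c0 \<le> c"
          then have "N (Suc c) \<le> N c0" by (intro mono) simp
          then show False using n c by (simp add: inblock_def)
        qed
        have "\<bar>lam n - real n\<bar> \<le> inverse (real (Suc c))"
          unfolding lam[OF c] using lc[of c] c by (simp add: good_def inblock_def)
        also have "\<dots> \<le> inverse (real (Suc c0))" using \<open>c0 \<le> c\<close> by (intro le_imp_inverse_le) auto
        finally show ?thesis using c0 by simp
      next
        case False
        then have "lam n = real n" unfolding lam_def by (rule if_not_P)
        then show ?thesis using \<open>e > 0\<close> by simp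
      qed
    qed
  qed
  moreover have "\<forall>c. \<forall>j\<le>c. \<forall>n\<le>c. \<forall>k\<le>c. schwartz_seminorm n k
       (fourier (\<lambda>t. bump j t * (wave_sum {N c<..<N (Suc c)} (snd (lc c)) lam t - h c t))) \<le> (1 / 2) ^ c"
    unfolding ws using lc unfolding good_def by blast
  ultimately show ?thesis using N(1)
    by (intro exI[of _ lam] exI[of _ N] exI[of _ "\<lambda>c. snd (lc c)"] conjI) auto
qed

lemma small_amplitude:
  assumes "finite S" "(b::real) > 0"
  shows "\<exists>a>0. a \<le> b \<and> (\<forall>x\<in>S. a * x \<le> b)"
proof -
  define T where "T = 1 + (\<Sum>x\<in>S. \<bar>x\<bar>)"
  have T: "T \<ge> 1" by (simp add: T_def sum_nonneg)
  have "x \<le> T" if "x \<in> S" for x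
    using member_le_sum[of x S abs] that assms(1) by (simp add: T_def)
  then have "b / T * x \<le> b" if "x \<in> S" for x
    using that T assms(2) by (simp add: field_simps mult_left_mono)
  moreover have "0 < b / T" "b / T \<le> b" using T assms(2) by (simp_all add: field_simps mult_left_mono)
  ultimately show ?thesis by blast
qed

text \<open>The rate \<open>4\<^sup>-\<^sup>j\<close> is chosen because it is at most \<open>2\<^sup>-\<^sup>c 2\<^sup>-\<^sup>j\<close> for \<open>c < j\<close>, which matches the bound available
  for \<open>j \<le> c\<close>.\<close>

lemma amplitudes_exist:
  fixes D :: "nat \<Rightarrow> real \<Rightarrow> complex"
  shows "\<exists>a. \<forall>j. 0 < a j \<and> a j \<le> (1 / 2) ^ j \<and>
    (\<forall>n\<le>j. \<forall>k\<le>j. a j * schwartz_seminorm n k (fourier (bump j)) \<le> (1 / 4) ^ j) \<and>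
    (\<forall>c<j. \<forall>n\<le>j. \<forall>k\<le>j. a j * schwartz_seminorm n k (fourier (\<lambda>t. bump j t * D c t)) \<le> (1 / 4) ^ j)"
proof (rule choice, rule allI)
  fix j
  let ?S = "(\<lambda>(n, k). schwartz_seminorm n k (fourier (bump j))) ` ({..j} \<times> {..j}) \<union>
    (\<lambda>(c, n, k). schwartz_seminorm n k (fourier (\<lambda>t. bump j t * D c t))) ` ({..<j} \<times> {..j} \<times> {..j})"
  have fin: "finite ?S" by simp
  obtain a :: real where a: "a > 0" "a \<le> (1 / 4) ^ j" "\<forall>x\<in>?S. a * x \<le> (1 / 4) ^ j"
    using small_amplitude[OF fin, of "(1 / 4) ^ j"] by auto
  have "(1 / 4) ^ j \<le> (1 / 2 :: real) ^ j" by (intro power_mono) auto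
  with a show "\<exists>a. 0 < a \<and> a \<le> (1 / 2) ^ j \<and>
    (\<forall>n\<le>j. \<forall>k\<le>j. a * schwartz_seminorm n k (fourier (bump j)) \<le> (1 / 4) ^ j) \<and>
    (\<forall>c<j. \<forall>n\<le>j. \<forall>k\<le>j. a * schwartz_seminorm n k (fourier (\<lambda>t. bump j t * D c t)) \<le> (1 / 4) ^ j)"
    by (intro exI[of _ a]) force
qed

text \<open>By Weierstrass' theorem these functions are rich enough to approximate every test function that is
  supported off the integers, and there are only countably many of them.\<close>

definition target :: "nat \<Rightarrow> nat \<Rightarrow> real \<Rightarrow> complex" where
  "target i m t = bump i t * of_real t ^ m"

lemma smooth_target: "smooth (target i m)"
  unfolding target_def[abs_def] by (intro smooth_intros smooth_bump)

section \<open>The generator and the functionals annihilating its translates\<close>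

text \<open>The outcome of the choices above. The function \<open>D c\<close> is the error with which the exponential sum of
  the \<open>c\<close>-th block approximates the \<open>c\<close>-th target; every target occurs for infinitely many \<open>c\<close>, indexed by \<open>l\<close>.\<close>

locale generator =
  fixes lam :: "nat \<Rightarrow> real" and N :: "nat \<Rightarrow> nat" and cf :: "nat \<Rightarrow> nat \<Rightarrow> complex"
    and a :: "nat \<Rightarrow> real" and h D :: "nat \<Rightarrow> real \<Rightarrow> complex"
  assumes D_def: "\<And>c t. D c t = wave_sum {N c<..<N (Suc c)} (cf c) lam t - h c t"
    and h: "\<And>i m l. h (prod_encode (prod_encode (i, m), l)) = target i m"
    and smooth_h: "\<And>c. smooth (h c)"
    and N: "\<And>c. N c < N (Suc c)"
    and D_small: "\<And>c j n k. j \<le> c \<Longrightarrow> n \<le> c \<Longrightarrow> k \<le> c \<Longrightarrow>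
      schwartz_seminorm n k (fourier (\<lambda>t. bump j t * D c t)) \<le> (1 / 2) ^ c"
    and a_pos: "\<And>j. 0 < a j" and a_le: "\<And>j. a j \<le> (1 / 2) ^ j"
    and a_bump: "\<And>j n k. n \<le> j \<Longrightarrow> k \<le> j \<Longrightarrow> a j * schwartz_seminorm n k (fourier (bump j)) \<le> (1 / 4) ^ j"
    and a_D: "\<And>c j n k. c < j \<Longrightarrow> n \<le> j \<Longrightarrow> k \<le> j \<Longrightarrow>
      a j * schwartz_seminorm n k (fourier (\<lambda>t. bump j t * D c t)) \<le> (1 / 4) ^ j"
begin

definition f :: "real \<Rightarrow> complex" where
  "f x = (\<Sum>j. of_real (a j) * fourier (bump j) x)"

text \<open>This is the Fourier transform of \<open>\<phi> D\<^sub>c\<close> for \<open>\<phi> = \<Sum>j. a\<^sub>j b\<^sub>j\<close>, where \<open>b\<^sub>j\<close> is the \<open>j\<close>-th bump.\<close>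

definition remainder :: "nat \<Rightarrow> real \<Rightarrow> complex" where
  "remainder c x = (\<Sum>j. of_real (a j) * fourier (\<lambda>t. bump j t * D c t) x)"

lemma smooth_D: "smooth (D c)"
  unfolding D_def[abs_def] by (intro smooth_diff smooth_wave_sum' smooth_h)

lemma bump_D_test: "(\<lambda>t. bump j t * D c t) \<in> test_functions"
  by (intro test_functions_mult bump_in_test_functions smooth_D)

lemma quarter_le_half: "(1 / 4 :: real) ^ j \<le> (1 / 2) ^ j"
  by (intro power_mono) auto

lemma scaled_seminorm:
  assumes "u \<in> test_functions"
  shows "schwartz_seminorm n k (\<lambda>x. of_real (a j) * fourier u x) \<le> a j * schwartz_seminorm n k (fourier u)"
  using schwartz_cmult(2)[OF fourier_test_in_schwartz[OF assms], of n k "of_real (a j)"] a_pos[of j] by simp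

lemma f_summable: "summable (\<lambda>j. schwartz_seminorm n k (\<lambda>x. of_real (a j) * fourier (bump j) x))"
proof (rule summable_comparison_test'[of "\<lambda>j. (1 / 2 :: real) ^ j" "max n k"])
  fix j assume j: "max n k \<le> j"
  have "schwartz_seminorm n k (\<lambda>x. of_real (a j) * fourier (bump j) x) \<le> (1 / 4) ^ j"
    by (rule order_trans[OF scaled_seminorm[OF bump_in_test_functions] a_bump]) (use j in auto)
  moreover have "0 \<le> schwartz_seminorm n k (\<lambda>x. of_real (a j) * fourier (bump j) x)"
    by (intro schwartz_seminorm_nonneg schwartz_cmult fourier_test_in_schwartz bump_in_test_functions)
  ultimately show "norm (schwartz_seminorm n k (\<lambda>x. of_real (a j) * fourier (bump j) x)) \<le> (1 / 2) ^ j"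
    using quarter_le_half[of j] by simp
qed (simp add: summable_geometric)

lemma f_term_schwartz: "(\<lambda>x. of_real (a j) * fourier (bump j) x) \<in> schwartz"
  by (intro schwartz_cmult fourier_test_in_schwartz bump_in_test_functions)

lemma f_schwartz: "f \<in> schwartz"
  unfolding f_def[abs_def] by (rule schwartz_series(1)[OF f_term_schwartz f_summable])

lemma f_sums: "(\<lambda>j. of_real (a j) * fourier (bump j) x) sums f x"
  unfolding f_def by (rule summable_sums[OF schwartz_series(3)[OF f_term_schwartz f_summable]])

lemma remainder_term_schwartz: "(\<lambda>x. of_real (a j) * fourier (\<lambda>t. bump j t * D c t) x) \<in> schwartz"
  by (intro schwartz_cmult fourier_test_in_schwartz bump_D_test)

text \<open>For \<open>j \<le> c\<close> the error \<open>D c\<close> is small on the support of the bump; for \<open>j > c\<close> the amplitude was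
  chosen with knowledge of \<open>D c\<close>.\<close>

lemma remainder_term_bound:
  assumes "n \<le> max c j" "k \<le> max c j"
  shows "schwartz_seminorm n k (\<lambda>x. of_real (a j) * fourier (\<lambda>t. bump j t * D c t) x) \<le> (1 / 2) ^ c * (1 / 2) ^ j"
proof (rule order_trans[OF scaled_seminorm[OF bump_D_test]])
  show "a j * schwartz_seminorm n k (fourier (\<lambda>t. bump j t * D c t)) \<le> (1 / 2) ^ c * (1 / 2) ^ j"
  proof (cases "j \<le> c")
    case True
    have "a j * schwartz_seminorm n k (fourier (\<lambda>t. bump j t * D c t)) \<le> (1 / 2) ^ j * (1 / 2) ^ c"
      using True assms a_pos[of j] 
      by (intro mult_mono a_le D_small schwartz_seminorm_nonneg fourier_test_in_schwartz bump_D_test) auto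
    then show ?thesis by (simp add: mult.commute)
  next
    case False
    then have "a j * schwartz_seminorm n k (fourier (\<lambda>t. bump j t * D c t)) \<le> (1 / 4) ^ j"
      using assms by (intro a_D) auto
    also have "(1 / 4 :: real) ^ j = (1 / 2) ^ j * (1 / 2) ^ j" by (simp flip: power_mult_distrib)
    also have "\<dots> \<le> (1 / 2) ^ c * (1 / 2) ^ j"
      using False by (intro mult_right_mono power_decreasing) auto
    finally show ?thesis .
  qed
qed

lemma remainder_summable:
  "summable (\<lambda>j. schwartz_seminorm n k (\<lambda>x. of_real (a j) * fourier (\<lambda>t. bump j t * D c t) x))"
proof (rule summable_comparison_test'[of "\<lambda>j. (1 / 2 :: real) ^ c * (1 / 2) ^ j" "max n k"])
  fix j assume j: "max n k \<le> j"
  show "norm (schwartz_seminorm n k (\<lambda>x. of_real (a j) * fourier (\<lambda>t. bump j t * D c t) x)) \<le> (1 / 2) ^ c * (1 / 2) ^ j"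
  proof -
    have "n \<le> max c j" "k \<le> max c j" using j by auto
    from remainder_term_bound[OF this]
      schwartz_seminorm_nonneg[OF remainder_term_schwartz[of j c], of n k]
    show ?thesis by simp
  qed
qed (intro summable_mult summable_geometric, simp)

lemma remainder_sums:
  "(\<lambda>j. of_real (a j) * fourier (\<lambda>t. bump j t * D c t) x) sums remainder c x"
  unfolding remainder_def
  by (rule summable_sums[OF schwartz_series(3)[OF remainder_term_schwartz remainder_summable]])

lemma remainder_small:
  assumes "n \<le> c" "k \<le> c" shows "schwartz_seminorm n k (remainder c) \<le> 2 * (1 / 2) ^ c"
proof -
  have "schwartz_seminorm n k (remainder c)
     \<le> (\<Sum>j. schwartz_seminorm n k (\<lambda>x. of_real (a j) * fourier (\<lambda>t. bump j t * D c t) x))"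
    unfolding remainder_def[abs_def] by (rule schwartz_series(2)[OF remainder_term_schwartz remainder_summable])
  also have "\<dots> \<le> (\<Sum>j. (1 / 2) ^ c * (1 / 2) ^ j)"
    using assms by (intro suminf_le remainder_term_bound remainder_summable summable_mult summable_geometric) auto
  also have "\<dots> = (1 / 2) ^ c * (\<Sum>j. (1 / 2) ^ j)"
    by (intro suminf_mult summable_geometric) simp
  also have "(\<Sum>j. (1 / 2 :: real) ^ j) = 2" by (subst suminf_geometric) auto
  finally show ?thesis by (simp add: mult.commute)
qed

text \<open>The product of \<open>\<phi> = \<Sum>j. a\<^sub>j b\<^sub>j\<close> and \<open>b\<^sub>i\<close>; only finitely many terms contribute.\<close>

definition cut :: "nat \<Rightarrow> real \<Rightarrow> complex" where
  "cut i t = (\<Sum>j\<le>Suc i. of_real (a j) * (bump j t * bump i t))"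

lemma cut_test: "cut i \<in> test_functions"
  unfolding cut_def[abs_def]
  by (intro test_functions_sum test_functions_cmult test_functions_mult bump_in_test_functions smooth_bump)

lemma cut_power_test: "(\<lambda>t. cut i t * of_real t ^ m) \<in> test_functions"
  by (intro test_functions_mult cut_test smooth_intros)

lemma cut_sums:
  "(\<lambda>j. of_real (a j) * fourier (\<lambda>t. bump j t * target i m t) x) sums fourier (\<lambda>t. cut i t * of_real t ^ m) x"
proof -
  have test: "(\<lambda>t. bump j t * target i m t) \<in> test_functions" for j
    by (intro test_functions_mult bump_in_test_functions smooth_target)
  have z: "fourier (\<lambda>t. bump j t * target i m t) = (\<lambda>x. 0)" if "j \<notin> {..Suc i}" for j
  proof -
    have "(\<lambda>t. bump j t * target i m t) = (\<lambda>t. 0)"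
    proof
      fix t show "bump j t * target i m t = 0"
        using bump_mult_zero[of i j t] that by (auto simp: target_def)
    qed
    then show ?thesis by (simp add: fourier_zero)
  qed
  have "(\<lambda>t. cut i t * of_real t ^ m) = (\<lambda>t. \<Sum>j\<le>Suc i. of_real (a j) * (bump j t * target i m t))"
    by (simp only: cut_def target_def sum_distrib_right mult.assoc)
  then have "fourier (\<lambda>t. cut i t * of_real t ^ m) x = (\<Sum>j\<le>Suc i. of_real (a j) * fourier (\<lambda>t. bump j t * target i m t) x)"
    using fourier_sum[of "{..Suc i}" "\<lambda>j t. of_real (a j) * (bump j t * target i m t)"] test
    by (simp add: test_functions_cmult fourier_cmult)
  moreover have "(\<lambda>j. of_real (a j) * fourier (\<lambda>t. bump j t * target i m t) x) sums
     (\<Sum>j\<le>Suc i. of_real (a j) * fourier (\<lambda>t. bump j t * target i m t) x)"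
    by (rule sums_finite) (use z in auto)
  ultimately show ?thesis by simp
qed

abbreviation stage :: "nat \<Rightarrow> nat \<Rightarrow> nat \<Rightarrow> nat" where
  "stage i m l \<equiv> prod_encode (prod_encode (i, m), l)"

text \<open>A finite linear combination of translates of \<open>f\<close>: the Fourier transform of \<open>\<phi>\<close> times the exponential sum of
  the \<open>c\<close>-th block.\<close>

definition combination :: "nat \<Rightarrow> real \<Rightarrow> complex" where
  "combination c x = (\<Sum>n\<in>{N c<..<N (Suc c)}. cf c n * f (x - lam n))"

lemma combination_schwartz: "combination c \<in> schwartz"
  unfolding combination_def[abs_def] by (intro schwartz_sum schwartz_cmult schwartz_shift f_schwartz)

lemma combination_minus_target:
  "combination (stage i m l) x - fourier (\<lambda>t. cut i t * of_real t ^ m) x = remainder (stage i m l) x"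
proof -
  let ?c = "stage i m l"
  let ?A = "{N ?c<..<N (Suc ?c)}"
  have test: "(\<lambda>t. bump j t * target i m t) \<in> test_functions" for j
    by (intro test_functions_mult bump_in_test_functions smooth_target)
  have test2: "(\<lambda>t. cf ?c n * (bump j t * wave (lam n) t)) \<in> test_functions" for j n
    by (intro test_functions_mult test_functions_cmult bump_in_test_functions smooth_wave)
  have 1: "(\<lambda>j. \<Sum>n\<in>?A. cf ?c n * (of_real (a j) * fourier (bump j) (x - lam n))) sums combination ?c x"
    unfolding combination_def by (intro sums_sum sums_mult f_sums)
  have eq: "(\<Sum>n\<in>?A. cf ?c n * (of_real (a j) * fourier (bump j) (x - lam n)))
     - of_real (a j) * fourier (\<lambda>t. bump j t * target i m t) x
     = of_real (a j) * fourier (\<lambda>t. bump j t * D ?c t) x" for j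
  proof -
    have "(\<lambda>t. bump j t * D ?c t) = (\<lambda>t. (\<Sum>n\<in>?A. cf ?c n * (bump j t * wave (lam n) t)) - bump j t * target i m t)"
      by (auto simp: D_def h wave_sum_def algebra_simps sum_distrib_left)
    then have "fourier (\<lambda>t. bump j t * D ?c t) x
       = (\<Sum>n\<in>?A. cf ?c n * fourier (bump j) (x - lam n)) - fourier (\<lambda>t. bump j t * target i m t) x"
      by (simp only: fourier_diff[OF test_functions_sum[OF test2] test] fourier_sum[OF test2]
          fourier_cmult fourier_modulate)
    moreover have "(\<Sum>n\<in>?A. cf ?c n * (of_real (a j) * fourier (bump j) (x - lam n)))
       = of_real (a j) * (\<Sum>n\<in>?A. cf ?c n * fourier (bump j) (x - lam n))"
      by (simp add: sum_distrib_left mult_ac)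
    ultimately show ?thesis by (simp only: right_diff_distrib)
  qed
  from sums_diff[OF 1 cut_sums[of i m x]]
  have "(\<lambda>j. of_real (a j) * fourier (\<lambda>t. bump j t * D ?c t) x) sums
    (combination ?c x - fourier (\<lambda>t. cut i t * of_real t ^ m) x)" unfolding eq .
  then show ?thesis using remainder_sums[of ?c x] by (rule sums_unique2)
qed

text \<open>Along the stages devoted to the target \<open>b\<^sub>i t\<^sup>m\<close> the combinations of translates converge in the Schwartz
  space to the Fourier transform of \<open>\<phi> b\<^sub>i t\<^sup>m\<close>, and from some stage on they only involve translates that \<open>\<alpha>\<close>
  annihilates.\<close>

lemma annihilates_cut_power:
  assumes \<alpha>: "temperate_distribution \<alpha>" and ann: "\<And>n. n > N0 \<Longrightarrow> \<alpha> (\<lambda>x. f (x - lam n)) = 0"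
  shows "\<alpha> (fourier (\<lambda>t. cut i t * of_real t ^ m)) = 0"
proof -
  have lin: "linear_functional_on schwartz \<alpha>" using \<alpha> by (simp add: temperate_distribution_def)
  let ?F = "fourier (\<lambda>t. cut i t * of_real t ^ m)"
  have F: "?F \<in> schwartz" by (intro fourier_test_in_schwartz cut_power_test)
  have stage_ge: "l \<le> stage i m l" for l by (rule le_prod_encode_2)
  have lim: "(\<lambda>l. \<alpha> (combination (stage i m l))) \<longlonglongrightarrow> \<alpha> ?F"
  proof (rule temperate_distribution_sequential[OF \<alpha> combination_schwartz F])
    fix n k
    have eq: "(\<lambda>x. combination (stage i m l) x - ?F x) = remainder (stage i m l)" for l
      by (rule ext) (rule combination_minus_target)
    have rs: "remainder (stage i m l) \<in> schwartz" for l
      using schwartz_diff[OF combination_schwartz F, of "stage i m l"] unfolding eq .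
    show "(\<lambda>l. schwartz_seminorm n k (\<lambda>x. combination (stage i m l) x - ?F x)) \<longlonglongrightarrow> 0"
      unfolding eq
    proof (rule tendsto_sandwich[where f = "\<lambda>l. 0" and h = "\<lambda>l. 2 * (1 / 2) ^ l"])
      show "\<forall>\<^sub>F l in sequentially. 0 \<le> schwartz_seminorm n k (remainder (stage i m l))"
        by (intro always_eventually allI schwartz_seminorm_nonneg rs)
      show "\<forall>\<^sub>F l in sequentially. schwartz_seminorm n k (remainder (stage i m l)) \<le> 2 * (1 / 2) ^ l"
        using eventually_ge_at_top[of "max n k"]
      proof eventually_elim
        case (elim l)
        have "schwartz_seminorm n k (remainder (stage i m l)) \<le> 2 * (1 / 2) ^ stage i m l"
          using elim stage_ge[of l] by (intro remainder_small) auto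
        also have "\<dots> \<le> 2 * (1 / 2) ^ l"
          using stage_ge[of l] by (intro mult_left_mono power_decreasing) auto
        finally show ?case .
      qed
      have "(\<lambda>l. 2 * (1 / 2 :: real) ^ l) \<longlonglongrightarrow> 2 * 0"
        by (intro tendsto_mult tendsto_const LIMSEQ_realpow_zero) auto
      then show "(\<lambda>l. 2 * (1 / 2 :: real) ^ l) \<longlonglongrightarrow> 0" by simp
    qed simp
  qed
  have "\<forall>\<^sub>F l in sequentially. \<alpha> (combination (stage i m l)) = 0"
    using eventually_ge_at_top[of N0]
  proof eventually_elim
    case (elim l)
    let ?c = "stage i m l"
    have "N0 \<le> N ?c" using elim stage_ge[of l] strict_mono_ge_index[of N ?c] N by (meson order_trans)
    then have "\<alpha> (\<lambda>x. f (x - lam n)) = 0" if "n \<in> {N ?c<..<N (Suc ?c)}" for n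
      using that by (intro ann) auto
    then show ?case
      unfolding combination_def[abs_def]
      by (subst linear_functional_sum[OF lin]) (auto intro: schwartz_shift f_schwartz)
  qed
  then have "(\<lambda>l. \<alpha> (combination (stage i m l))) \<longlonglongrightarrow> 0" by (rule tendsto_eventually)
  with lim show ?thesis by (rule LIMSEQ_unique)
qed

lemma cut_nonneg: "0 \<le> Re (cut i t)" "Im (cut i t) = 0"
  and cut_pos: "bump i t \<noteq> 0 \<Longrightarrow> 0 < Re (cut i t)"
proof -
  have b: "bump j t = of_real (Re (bump j t))" for j using bump_nonneg(2)[of j t] by (simp add: complex_eq_iff)
  have eq: "cut i t = of_real (\<Sum>j\<le>Suc i. a j * (Re (bump j t) * Re (bump i t)))"
    unfolding cut_def by (subst b, subst (2) b) simp
  have nn: "0 \<le> a j * (Re (bump j t) * Re (bump i t))" for j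
    using a_pos[of j] bump_nonneg(1) by (simp add: less_imp_le)
  show "0 \<le> Re (cut i t)" "Im (cut i t) = 0" unfolding eq by (simp_all add: nn sum_nonneg del: sum.atMost_Suc)
  assume "bump i t \<noteq> 0"
  then have "Re (bump i t) \<noteq> 0" using b[of i] by auto
  then have "0 < Re (bump i t)" using bump_nonneg(1)[of i t] by simp
  then have "0 < a i * (Re (bump i t) * Re (bump i t))" using a_pos[of i] by simp
  also have "\<dots> \<le> (\<Sum>j\<le>Suc i. a j * (Re (bump j t) * Re (bump i t)))"
    using nn by (intro member_le_sum) auto
  finally show "0 < Re (cut i t)" unfolding eq by simp
qed

text \<open>By compactness finitely many bumps cover the support of \<open>\<psi>\<close>, and the sum \<open>u\<close> of the corresponding
  functions \<open>\<phi> b\<^sub>i\<close> is positive there. Hence \<open>\<psi> = u g\<close> with \<open>g\<close> smooth, and polynomials approximating \<open>g\<close> on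
  the support of \<open>u\<close> exhibit \<open>fourier \<psi>\<close> as a limit of functions that \<open>\<alpha>\<close> annihilates.\<close>

lemma annihilates_test_off_integers:
  assumes \<alpha>: "temperate_distribution \<alpha>" and ann: "\<And>n. n > N0 \<Longrightarrow> \<alpha> (\<lambda>x. f (x - lam n)) = 0"
    and \<psi>: "smooth \<psi>" and K: "compact K" "K \<inter> \<int> = {}" "\<And>t. t \<notin> K \<Longrightarrow> \<psi> t = 0"
  shows "\<alpha> (fourier \<psi>) = 0"
proof -
  have lin: "linear_functional_on schwartz \<alpha>" using \<alpha> by (simp add: temperate_distribution_def)
  have op: "open {t. bump j t \<noteq> 0}" for j
    using smooth_continuous[OF smooth_bump] by (intro open_Collect_neq continuous_on_const)
  have "K \<subseteq> (\<Union>j\<in>UNIV. {t. bump j t \<noteq> 0})"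
  proof
    fix t assume "t \<in> K"
    then have "t \<notin> \<int>" using K(2) by blast
    from bumps_cover[OF this] show "t \<in> (\<Union>j\<in>UNIV. {t. bump j t \<noteq> 0})" by blast
  qed
  then obtain J where J: "finite J" "K \<subseteq> (\<Union>j\<in>J. {t. bump j t \<noteq> 0})"
    by (rule compactE_image[OF K(1) op])
  define u where "u = (\<lambda>t. \<Sum>i\<in>J. cut i t)"
  have u: "u \<in> test_functions" unfolding u_def by (intro test_functions_sum cut_test)
  have u0: "u t \<noteq> 0" if "t \<in> K" for t
  proof -
    obtain i where i: "i \<in> J" "bump i t \<noteq> 0" using J(2) \<open>t \<in> K\<close> by auto
    have "0 < Re (cut i t)" using i(2) by (rule cut_pos)
    also have "\<dots> \<le> (\<Sum>i\<in>J. Re (cut i t))" using J(1) i(1) cut_nonneg by (intro member_le_sum) auto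
    also have "\<dots> = Re (u t)" by (simp add: u_def)
    finally show ?thesis by auto
  qed
  have poly: "\<alpha> (fourier (\<lambda>t. u t * poly p (of_real t))) = 0" for p
  proof -
    let ?Q = "J \<times> {..degree p}"
    let ?w = "\<lambda>q t. cut (fst q) t * of_real t ^ snd q :: complex"
    have wt: "?w q \<in> test_functions" for q by (rule cut_power_test)
    have "(\<lambda>t. u t * poly p (of_real t)) = (\<lambda>t. \<Sum>q\<in>?Q. coeff p (snd q) * ?w q t)"
      unfolding u_def poly_altdef
      by (auto simp: sum_product sum.cartesian_product mult_ac case_prod_beta intro!: sum.cong)
    then have "fourier (\<lambda>t. u t * poly p (of_real t)) = (\<lambda>x. \<Sum>q\<in>?Q. coeff p (snd q) * fourier (?w q) x)"
      using fourier_sum[of ?Q "\<lambda>q t. coeff p (snd q) * ?w q t"] wt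
      by (simp add: fourier_cmult test_functions_cmult)
    then have "\<alpha> (fourier (\<lambda>t. u t * poly p (of_real t))) = (\<Sum>q\<in>?Q. coeff p (snd q) * \<alpha> (fourier (?w q)))"
      using linear_functional_sum[OF lin, of ?Q "\<lambda>q. fourier (?w q)"] J(1) fourier_test_in_schwartz[OF wt]
      by simp
    then show ?thesis by (simp add: annihilates_cut_power[OF \<alpha> ann])
  qed
  define g where "g = (\<lambda>t. \<psi> t / u t)"
  have g: "smooth g" unfolding g_def
    using K(3) u0 by (intro smooth_divide[of K] compact_imp_closed K(1) test_functions_smooth u \<psi>) auto
  have \<psi>eq: "\<psi> = (\<lambda>t. u t * g t)"
  proof
    fix t show "\<psi> t = u t * g t" using u0[of t] K(3)[of t] by (cases "t \<in> K") (auto simp: g_def)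
  qed
  obtain R where R: "R > 0" "\<forall>t. R \<le> \<bar>t\<bar> \<longrightarrow> u t = 0" using test_functions_vanish[OF u] by blast
  then have uz: "\<forall>t. t \<notin> {-R..R} \<longrightarrow> u t = 0" by auto
  have "\<exists>p. jet_le l {-R..R} (inverse (real (Suc l))) (\<lambda>x. g x - poly p (of_real x))" for l
    using R(1) by (intro smooth_poly_approx g) auto
  then obtain p where p: "\<And>l. jet_le l {-R..R} (inverse (real (Suc l))) (\<lambda>x. g x - poly (p l) (of_real x))"
    using choice[of "\<lambda>l p. jet_le l {-R..R} (inverse (real (Suc l))) (\<lambda>x. g x - poly p (of_real x))"] by blast
  have up: "(\<lambda>t. u t * poly (p l) (of_real t)) \<in> test_functions" for l
    by (intro test_functions_mult u smooth_poly)
  have ug: "(\<lambda>t. u t * g t) \<in> test_functions" by (intro test_functions_mult u g)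
  have "(\<lambda>l. \<alpha> (fourier (\<lambda>t. u t * poly (p l) (of_real t)))) \<longlonglongrightarrow> \<alpha> (fourier (\<lambda>t. u t * g t))"
  proof (rule temperate_distribution_sequential[OF \<alpha>])
    show "fourier (\<lambda>t. u t * poly (p l) (of_real t)) \<in> schwartz" for l by (rule fourier_test_in_schwartz[OF up])
    show "fourier (\<lambda>t. u t * g t) \<in> schwartz" by (rule fourier_test_in_schwartz[OF ug])
    fix n k
    let ?d = "\<lambda>l t. poly (p l) (of_real t) - g t"
    have sd: "smooth (?d l)" for l by (intro smooth_diff smooth_poly g)
    have "fourier (\<lambda>t. u t * ?d l t) = (\<lambda>x. fourier (\<lambda>t. u t * poly (p l) (of_real t)) x - fourier (\<lambda>t. u t * g t) x)" for l
      using fourier_diff[OF up ug, of l] by (simp add: right_diff_distrib)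
    note eq = this[symmetric]
    obtain C where C: "C \<ge> 0" "\<forall>g \<eta>. smooth g \<longrightarrow> \<eta> \<ge> 0 \<longrightarrow>
       (\<forall>i\<le>n. \<forall>x\<in>{-R..R}. cmod (higher_vderiv i g x) \<le> \<eta>) \<longrightarrow>
       (\<forall>x. (1 + \<bar>x\<bar>) ^ n * cmod (higher_vderiv k (fourier (\<lambda>t. u t * g t)) x) \<le> C * \<eta>)"
      using fourier_weighted_bound[OF compact_Icc test_functions_smooth[OF u] uz, of n k]
      by (elim exE conjE) (rule that)
    show "(\<lambda>l. schwartz_seminorm n k (\<lambda>x. fourier (\<lambda>t. u t * poly (p l) (of_real t)) x - fourier (\<lambda>t. u t * g t) x)) \<longlonglongrightarrow> 0"
      unfolding eq
    proof (rule tendsto_sandwich[where f = "\<lambda>l. 0" and h = "\<lambda>l. C * inverse (real (Suc l))"])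
      show "\<forall>\<^sub>F l in sequentially. 0 \<le> schwartz_seminorm n k (fourier (\<lambda>t. u t * ?d l t))"
        by (intro always_eventually allI schwartz_seminorm_nonneg fourier_test_in_schwartz test_functions_mult u sd)
      show "\<forall>\<^sub>F l in sequentially. schwartz_seminorm n k (fourier (\<lambda>t. u t * ?d l t)) \<le> C * inverse (real (Suc l))"
        using eventually_ge_at_top[of n]
      proof eventually_elim
        case (elim l)
        have "cmod (higher_vderiv i (?d l) x) \<le> inverse (real (Suc l))" if "i \<le> n" "x \<in> {-R..R}" for i x
        proof -
          have "cmod (higher_vderiv i (\<lambda>x. g x - poly (p l) (of_real x)) x) \<le> inverse (real (Suc l))"
            using p[of l] that elim unfolding jet_le_def by (meson order_trans)
          then show ?thesis
            by (simp add: higher_vderiv_diff[OF smooth_poly g] higher_vderiv_diff[OF g smooth_poly] norm_minus_commute)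
        qed
        then show ?case
          by (intro schwartz_seminorm_le C(2)[rule_format, OF sd]) auto
      qed
      have "(\<lambda>l. C * inverse (real (Suc l))) \<longlonglongrightarrow> C * 0"
        by (intro tendsto_intros LIMSEQ_inverse_real_of_nat)
      then show "(\<lambda>l. C * inverse (real (Suc l))) \<longlonglongrightarrow> 0" by simp
    qed simp
  qed
  then have "(\<lambda>l. 0) \<longlonglongrightarrow> \<alpha> (fourier \<psi>)" unfolding poly \<psi>eq[symmetric] .
  then show ?thesis by (metis LIMSEQ_const_iff)
qed

lemma spectrum_in_integers:
  assumes \<alpha>: "temperate_distribution \<alpha>" and ann: "\<And>n. n > N0 \<Longrightarrow> \<alpha> (\<lambda>x. f (x - lam n)) = 0"
  shows "distribution_supp (distribution_fourier \<alpha>) \<subseteq> \<int>"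
proof -
  have "open (- \<int> :: real set)" using closed_Ints by (simp add: open_Compl)
  moreover have "distribution_fourier \<alpha> \<psi> = 0"
    if "smooth \<psi>" "compact (closure {x. \<psi> x \<noteq> 0})" "closure {x. \<psi> x \<noteq> 0} \<subseteq> - \<int>" for \<psi>
    unfolding distribution_fourier_def
  proof (rule annihilates_test_off_integers[OF \<alpha> ann that(1,2)])
    show "closure {x. \<psi> x \<noteq> 0} \<inter> \<int> = {}" using that(3) by blast
    show "\<psi> t = 0" if "t \<notin> closure {x. \<psi> x \<noteq> 0}" for t
      using that closure_subset[of "{x. \<psi> x \<noteq> 0}"] by blast
  qed
  ultimately show ?thesis unfolding distribution_supp_def by blast
qed

end

theorem theorem5p1:
  shows "\<exists>(lam :: nat \<Rightarrow> real) (f :: real \<Rightarrow> complex).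
    (\<lambda>n. lam n - real n) \<in> o(\<lambda>_. 1) \<and>
    f \<in> schwartz \<and>
    (\<forall>N\<ge>1. \<forall>V p.
       banach_function_space V p \<and>
       schwartz_embedded V p \<and>
       (\<forall>\<alpha>\<in>dual_space V p.
          temperate_distribution \<alpha> \<and> distribution_supp (distribution_fourier \<alpha>) \<subseteq> \<int>
          \<longrightarrow> (\<forall>g\<in>V. \<alpha> g = 0))
       \<longrightarrow> complete_system (seminorm_topology V {p}) {\<lambda>x. f (x - lam n) | n. n > N})"
proof -
  define h where "h = (\<lambda>c. let q = prod_decode (fst (prod_decode c)) in target (fst q) (snd q))"
  have sh: "smooth (h c)" for c by (simp add: h_def smooth_target Let_def)
  obtain lam N cf where lam: "(\<lambda>n. lam n - real n) \<longlonglongrightarrow> 0" and N: "\<forall>c. N c < N (Suc c)"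
    and small: "\<forall>c. \<forall>j\<le>c. \<forall>n\<le>c. \<forall>k\<le>c. schwartz_seminorm n k
       (fourier (\<lambda>t. bump j t * (wave_sum {N c<..<N (Suc c)} (cf c) lam t - h c t))) \<le> (1 / 2) ^ c"
    using frequencies_exist[of h, OF sh] by (elim exE conjE) (rule that)
  define D where "D = (\<lambda>c t. wave_sum {N c<..<N (Suc c)} (cf c) lam t - h c t)"
  obtain a where a: "\<forall>j. 0 < a j \<and> a j \<le> (1 / 2) ^ j \<and>
    (\<forall>n\<le>j. \<forall>k\<le>j. a j * schwartz_seminorm n k (fourier (bump j)) \<le> (1 / 4) ^ j) \<and>
    (\<forall>c<j. \<forall>n\<le>j. \<forall>k\<le>j. a j * schwartz_seminorm n k (fourier (\<lambda>t. bump j t * D c t)) \<le> (1 / 4) ^ j)"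
    using amplitudes_exist[of D] by (elim exE) (rule that)
  interpret generator lam N cf a h D
    by unfold_locales (use sh N small a in \<open>simp_all add: D_def h_def\<close>)
  have "complete_system (seminorm_topology V {p}) {\<lambda>x. f (x - lam n) | n. n > N0}"
    if "banach_function_space V p" "schwartz_embedded V p"
      "\<forall>\<alpha>\<in>dual_space V p.
          temperate_distribution \<alpha> \<and> distribution_supp (distribution_fourier \<alpha>) \<subseteq> \<int>
          \<longrightarrow> (\<forall>g\<in>V. \<alpha> g = 0)" for N0 V p
  proof (rule ccontr)
    let ?A = "{\<lambda>x. f (x - lam n) | n. n > N0}"
    assume inc: "\<not> complete_system (seminorm_topology V {p}) ?A"
    have "?A \<subseteq> V"
      using that(2) schwartz_shift[OF f_schwartz] unfolding schwartz_embedded_def by blast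
    from incomplete_system_functional[OF that(1) this inc] show False
    proof (elim bexE conjE)
      fix \<alpha> g
      assume \<alpha>: "\<alpha> \<in> dual_space V p" "\<forall>g\<in>?A. \<alpha> g = 0" and g: "g \<in> V" "\<alpha> g \<noteq> 0"
      have td: "temperate_distribution \<alpha>" by (rule dual_restricts_to_temperate[OF that(2) \<alpha>(1)])
      have "distribution_supp (distribution_fourier \<alpha>) \<subseteq> \<int>"
        by (rule spectrum_in_integers[OF td, of N0]) (use \<alpha>(2) in blast)
      with td that(3) \<alpha>(1) g show False by blast
    qed
  qed
  moreover have "(\<lambda>n. lam n - real n) \<in> o(\<lambda>_. 1)"
    using lam by (intro smalloI_tendsto) auto
  ultimately show ?thesis using f_schwartz by blast
qed

end
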